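(* For $n$ a positive integer and $N=2n$, \begin{equation*} \sum_{\boldsymbol{m}\in\mathbb N^{N-1}} \frac{q^{\frac{1}{2}\boldsymbol{m} C \boldsymbol{m}^t}}{(q)_{\boldsymbol{m}}} =\frac{1}{(q)_{\infty}^{2n^2-n}} \sum \xi(\boldsymbol{v}/\boldsymbol{\rho}) (-1)^{|\boldsymbol{v}|-|\boldsymbol{\rho}|} q^{\tfrac{||\boldsymbol{v}||^2-||\boldsymbol{\rho}||^2}{2(2n+3)}}, \end{equation*} where the sum on the right is over $\boldsymbol{v}\in(\mathbb Z/2)^n$ such that $v_i\equiv\rho_i\pmod{2n+3}$, and \begin{equation*} \sum_{\boldsymbol{m}\in\mathbb N^{N-1}} \frac{q^{\frac{1}{2}\boldsymbol{m} C \boldsymbol{m}^t+|\boldsymbol{m}|_{-}}}{(q)_{\boldsymbol{m}}} =\frac{1}{(q)_{\infty}^{2n^2-n}} \sum \xi(\boldsymbol{v}/\boldsymbol{\rho}) (-1)^{|\boldsymbol{v}|-|\boldsymbol{\rho}+1|} q^{\tfrac{||\boldsymbol{v}||^2-||\boldsymbol{\rho}+1||^2}{2(2n+3)}}, \end{equation*} where the sum on the right is over $\boldsymbol{v}\in(\mathbb Z/2)^n$ such that $v_i\equiv \rho_i+1\pmod{2n+3}$.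
   Context: Notation: $(a)_m=(a;q)_m=\prod_{i=1}^m(1-aq^{i-1})$ for $m\in\mathbb N\cup\{\infty\}$, $\mathbb N=\{0,1,2,\dots\}$; $(q)_{\boldsymbol{m}}=(q)_{m_1}\cdots(q)_{m_{N-1}}$. $C$ is the Cartan matrix of $\textup{A}_{N-1}$, so $\frac{1}{2}\boldsymbol{m} C\boldsymbol{m}^t=\sum_{i=1}^{N-1}m_i^2-\sum_{i=1}^{N-2}m_im_{i+1}$, and $|\boldsymbol{m}|_{-}=\sum_{i=1}^{N-1}(-1)^{i-1}m_i$. For $\boldsymbol{v}=(v_1,\dots,v_n)$: $|\boldsymbol{v}|=v_1+\cdots+v_n$, $||\boldsymbol{v}||^2=v_1^2+\cdots+v_n^2$; $\boldsymbol{\rho}=(1/2,3/2,\dots,n-1/2)$; for a scalar $a$, $\boldsymbol{w}+a=(w_1+a,\dots,w_n+a)$; and $\xi(\boldsymbol{v}/\boldsymbol{w})=\prod_{1\leq i<j\leq n}\frac{v_i^2-v_j^2}{w_i^2-w_j^2}$. *)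

theory Defs
  imports "HOL-Analysis.Analysis" "HOL-Library.Real_Mod"
begin

text \<open>
  A vector of length \<open>r\<close> is a function on \<open>{1..r}\<close>; sets of vectors are the extensional
  function spaces \<open>{1..r} \<rightarrow>\<^sub>E A\<close>, so that each vector is counted exactly once when summing.
\<close>

definition nat_vectors :: "nat \<Rightarrow> (nat \<Rightarrow> nat) set" where
  "nat_vectors r = {1..r} \<rightarrow>\<^sub>E UNIV"

definition qpoch :: "complex \<Rightarrow> complex \<Rightarrow> nat \<Rightarrow> complex" where
  "qpoch a q m = (\<Prod>i=1..m. 1 - a * q ^ (i - 1))"

definition qpoch_inf :: "complex \<Rightarrow> complex \<Rightarrow> complex" where
  "qpoch_inf a q = (\<Prod>i. 1 - a * q ^ i)"

definition cartan_A :: "nat \<Rightarrow> nat \<Rightarrow> int" where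
  "cartan_A i j = (if i = j then 2 else if i = Suc j \<or> j = Suc i then -1 else 0)"

definition cartan_form :: "nat \<Rightarrow> (nat \<Rightarrow> nat) \<Rightarrow> int" where
  "cartan_form r m = (\<Sum>i=1..r. \<Sum>j=1..r. int (m i) * cartan_A i j * int (m j))"

definition alt_sum :: "nat \<Rightarrow> (nat \<Rightarrow> nat) \<Rightarrow> int" where
  "alt_sum r m = (\<Sum>i=1..r. (-1) ^ (i - 1) * int (m i))"

definition vsum :: "nat \<Rightarrow> (nat \<Rightarrow> real) \<Rightarrow> real" where
  "vsum n v = (\<Sum>i=1..n. v i)"

definition normsq :: "nat \<Rightarrow> (nat \<Rightarrow> real) \<Rightarrow> real" where
  "normsq n v = (\<Sum>i=1..n. (v i)\<^sup>2)"

definition rho :: "nat \<Rightarrow> real" where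
  "rho i = real i - 1 / 2"

definition shift :: "(nat \<Rightarrow> real) \<Rightarrow> real \<Rightarrow> nat \<Rightarrow> real" where
  "shift w a i = w i + a"

definition xi :: "nat \<Rightarrow> (nat \<Rightarrow> real) \<Rightarrow> (nat \<Rightarrow> real) \<Rightarrow> real" where
  "xi n v w = (\<Prod>(i, j) \<in> {(i, j). 1 \<le> i \<and> i < j \<and> j \<le> n}.
                 ((v i)\<^sup>2 - (v j)\<^sup>2) / ((w i)\<^sup>2 - (w j)\<^sup>2))"

definition half_integers :: "real set" where
  "half_integers = {x. 2 * x \<in> \<int>}"

definition cong_vectors :: "nat \<Rightarrow> (nat \<Rightarrow> real) \<Rightarrow> (nat \<Rightarrow> real) set" where
  "cong_vectors n w = {v \<in> {1..n} \<rightarrow>\<^sub>E half_integers.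
                         \<forall>i\<in>{1..n}. [v i = w i] (rmod (2 * real n + 3))}"

text \<open>
  The summand of the right-hand sides, for \<open>w = \<rho>\<close> and \<open>w = \<rho> + 1\<close>. In both cases the two real
  exponents are integers on \<open>cong_vectors n w\<close> (lemma \<open>rhs_exponents_integral\<close> below), so the
  floors only convert types there. Integer powers satisfy \<open>0 powi 0 = 1\<close>, so \<open>q = 0\<close> gives the
  constant terms.
\<close>

definition rhs_term :: "complex \<Rightarrow> nat \<Rightarrow> (nat \<Rightarrow> real) \<Rightarrow> (nat \<Rightarrow> real) \<Rightarrow> complex" where
  "rhs_term q n w v =
     of_real (xi n v rho) * (-1) powi \<lfloor>vsum n v - vsum n w\<rfloor>
       * q powi \<lfloor>(normsq n v - normsq n w) / (2 * (2 * real n + 3))\<rfloor>"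

lemma cartan_form_eq:
  "cartan_form r m = 2 * ((\<Sum>i=1..r. (int (m i))\<^sup>2) - (\<Sum>i=1..<r. int (m i) * int (m (i + 1))))"
proof (induction r)
  case 0
  then show ?case by (simp add: cartan_form_def)
next
  case (Suc r)
  have col: "(\<Sum>i=1..r. int (m i) * cartan_A i (Suc r) * int (m (Suc r)))
      = (if r = 0 then 0 else - int (m r) * int (m (Suc r)))"
  proof -
    have "(\<Sum>i=1..r. int (m i) * cartan_A i (Suc r) * int (m (Suc r)))
      = (\<Sum>i=1..r. if i = r then - int (m r) * int (m (Suc r)) else 0)"
      by (rule sum.cong) (auto simp: cartan_A_def)
    then show ?thesis by (auto simp: sum.delta)
  qed
  have row: "(\<Sum>j=1..r. int (m (Suc r)) * cartan_A (Suc r) j * int (m j))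
      = (if r = 0 then 0 else - int (m r) * int (m (Suc r)))"
    unfolding col[symmetric] by (rule sum.cong) (auto simp: cartan_A_def)
  have "cartan_form (Suc r) m = cartan_form r m
      + (\<Sum>i=1..r. int (m i) * cartan_A i (Suc r) * int (m (Suc r)))
      + (\<Sum>j=1..r. int (m (Suc r)) * cartan_A (Suc r) j * int (m j))
      + 2 * (int (m (Suc r)))\<^sup>2"
    unfolding cartan_form_def
    by (simp add: sum.distrib cartan_A_def power2_eq_square)
  also have "\<dots> = cartan_form r m + (if r = 0 then 0 else - 2 * int (m r) * int (m (Suc r)))
      + 2 * (int (m (Suc r)))\<^sup>2"
    unfolding col row by simp
  finally show ?case
    unfolding Suc.IH by (cases r) (simp_all add: algebra_simps)
qed

lemma rcong_imp_int_multiple: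
  assumes "[x = y] (rmod m)"
  shows "\<exists>k::int. x = y + of_int k * m"
proof -
  have "x = y + of_int ((\<lfloor>x / \<bar>m\<bar>\<rfloor> - \<lfloor>y / \<bar>m\<bar>\<rfloor>) * (if m < 0 then -1 else 1)) * m"
    using assms by (auto simp: rcong_def rmod_def algebra_simps split: if_splits)
  then show ?thesis by blast
qed

lemma rhs_exponents_integral:
  fixes s :: int
  assumes "v \<in> cong_vectors n (shift rho (of_int s))"
  defines "w \<equiv> shift rho (of_int s)"
  shows "vsum n v - vsum n w \<in> \<int>"
    and "(normsq n v - normsq n w) / (2 * (2 * real n + 3)) \<in> \<int>"
proof -
  have "\<forall>i\<in>{1..n}. \<exists>k::int. v i = w i + of_int k * (2 * real n + 3)"
    using assms rcong_imp_int_multiple by (auto simp: cong_vectors_def)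
  then obtain k :: "nat \<Rightarrow> int"
    where k: "\<And>i. i \<in> {1..n} \<Longrightarrow> v i = w i + of_int (k i) * (2 * real n + 3)"
    by metis
  have "vsum n v - vsum n w = (\<Sum>i=1..n. of_int (k i * (2 * int n + 3)))"
    unfolding vsum_def sum_subtractf[symmetric] by (rule sum.cong) (auto simp: k)
  then show "vsum n v - vsum n w \<in> \<int>" by (simp only: Ints_sum Ints_of_int)
  have "((v i)\<^sup>2 - (w i)\<^sup>2) / (2 * (2 * real n + 3))
      = of_int ((k i * (2 * int i - 1 + 2 * s + k i * (2 * int n + 3))) div 2)"
    if i: "i \<in> {1..n}" for i
  proof -
    define A where "A = k i * (2 * int i - 1 + 2 * s + k i * (2 * int n + 3))"
    have "even A" by (auto simp: A_def)
    then obtain B where B: "A = 2 * B" by (rule evenE)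
    have "(v i)\<^sup>2 - (w i)\<^sup>2 = (2 * real n + 3) * of_int A"
      by (simp add: k[OF i] w_def shift_def rho_def A_def power2_eq_square algebra_simps)
    also have "\<dots> = (2 * (2 * real n + 3)) * of_int B"
      by (simp add: B)
    finally have "(v i)\<^sup>2 - (w i)\<^sup>2 = (2 * (2 * real n + 3)) * of_int B" .
    moreover have "2 * real n + 3 \<noteq> 0"
      using of_nat_0_le_iff[where ?'a = real, of n] by linarith
    ultimately have "((v i)\<^sup>2 - (w i)\<^sup>2) / (2 * (2 * real n + 3)) = of_int B"
      by (simp del: distrib_left_numeral)
    then show ?thesis
      unfolding A_def[symmetric] B by simp
  qed
  then have "(normsq n v - normsq n w) / (2 * (2 * real n + 3))
      = (\<Sum>i=1..n. of_int ((k i * (2 * int i - 1 + 2 * s + k i * (2 * int n + 3))) div 2))"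
    unfolding normsq_def sum_subtractf[symmetric] sum_divide_distrib by (intro sum.cong) auto
  then show "(normsq n v - normsq n w) / (2 * (2 * real n + 3)) \<in> \<int>"
    by (simp only: Ints_sum Ints_of_int)
qed

end

theory Submission
  imports Defs "HOL-Complex_Analysis.Complex_Analysis"
begin

text \<open>
  For \<open>q \<noteq> 0\<close> the Cartan form makes each fermionic sum a matrix element of a product of \<open>2n - 1\<close>
  transfer matrices \<open>(- t)\<^bsup>a - b\<^esup> q\<^bsup>(a - b)(a - b - 1)/2\<^esup>\<close>. Continuous big \<open>q\<close>-Hermite polynomials
  diagonalise them, which turns the sums into the Laurent coefficients \<open>c\<^sub>0\<close> and
  \<open>(-1)\<^sup>n c\<^bsub>n + 1\<^esub>\<close> of \<open>F(x) = \<theta>(x\<^sup>2) \<theta>(x)\<^bsup>2n - 1\<^esup>\<close>, up to powers of \<open>(q)\<^sub>\<infinity>\<close>.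

  The quasi-periodicity \<open>c\<^bsub>k + 2n + 3\<^esub> = - q\<^bsup>k + 1\<^esup> c\<^sub>k\<close> and the symmetry \<open>c\<^bsub>2n + 1 - k\<^esub> = c\<^sub>k\<close> leave \<open>n + 1\<close>
  unknown coefficients. As \<open>F\<close> vanishes to order \<open>2n\<close> at \<open>x = 1\<close>, the even moments of \<open>c\<close> about
  \<open>n + 1/2\<close> give \<open>n + 1\<close> linear equations, with only the last one inhomogeneous. Cramer's rule writes
  each coefficient as a quotient of two Vandermonde sums. The numerator is the right-hand side of
  the theorem, and the denominator is evaluated by Macdonald's identity for \<open>A\<^bsub>2n + 2\<^esub>\<^bsup>(2)\<^esup>\<close>.
  The case \<open>q = 0\<close> follows by continuity in \<open>q\<close>.
\<close>

section \<open>Finite and infinite q-products\<close>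

text \<open>Applying the eigenvalue equation of the transfer matrix turns the parameter
  \<open>t\<close> into \<open>q / t\<close>, so a chain of matrices alternates between the two.
  With \<open>t = csqrt q\<close> the parameter stays fixed, which gives the first sum; with
  \<open>t = q\<close> it alternates between \<open>q\<close> and \<open>1\<close>, and the extra
  powers of \<open>q\<close> at odd steps add up to \<open>alt_sum\<close>. The modulus 2n + 3 is
  the degree of F as a theta function: theta(x^2) counts 4, the remaining factors 2n - 1. The even
  moments involve k only through (k - n - 1/2)^2, and along a residue class these are the squares
  v_i^2 of the theorem. Deleting the class of c_(2n+1) = c_0 leaves the classes of rho, deleting
  that of c_(n+1) those of rho + 1. Macdonald's identity comes from the same linear system: Cramer's
  rule with one more symmetric factor, the sum of the squares, brings in the moment of order 2n + 2,
  and dividing it by the rule for order 2n yields the logarithmic derivative in q of the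
  denominator, because each square is an affine function of its exponent of q.\<close>

lemma qpoch_0 [simp]: "qpoch a q 0 = 1"
  by (simp add: qpoch_def)

lemma qpoch_lessThan: "qpoch a q m = (\<Prod>i<m. 1 - a * q ^ i)"
  unfolding qpoch_def
  by (rule prod.reindex_bij_witness[of _ Suc "\<lambda>i. i - 1"]) auto

lemma qpoch_Suc: "qpoch a q (Suc m) = qpoch a q m * (1 - a * q ^ m)"
  by (simp add: qpoch_lessThan)

lemma qpoch_add: "qpoch a q (m + k) = qpoch a q m * qpoch (a * q ^ m) q k"
  by (induction k) (auto simp: qpoch_Suc power_add algebra_simps)

text \<open>The ratio of consecutive terms is \<open>R * r ^ i\<close> and tends to 0, so
  \<open>R\<close> may be arbitrarily large. This makes Euler's series entire.\<close>

lemma summable_power_triangular: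
  fixes r R :: real
  assumes "0 \<le> r" "r < 1"
  shows "summable (\<lambda>i. R ^ i * r ^ (i choose 2))"
proof -
  have "(\<lambda>i. norm R * r ^ i) \<longlonglongrightarrow> norm R * 0"
    using assms by (intro tendsto_intros LIMSEQ_realpow_zero) auto
  then have "eventually (\<lambda>i. norm R * r ^ i < 1 / 2) sequentially"
    by (rule order_tendstoD) auto
  then obtain N where N: "\<And>i. i \<ge> N \<Longrightarrow> norm R * r ^ i < 1 / 2"
    by (auto simp: eventually_sequentially)
  show ?thesis
  proof (rule summable_ratio_test)
    show "norm (R ^ Suc i * r ^ (Suc i choose 2)) \<le> 1 / 2 * norm (R ^ i * r ^ (i choose 2))"
      if "i \<ge> N" for i
    proof -
      have c: "Suc i choose 2 = i + (i choose 2)"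
        by (simp add: numeral_2_eq_2)
      have "norm (R ^ Suc i * r ^ (Suc i choose 2)) = (norm R * r ^ i) * norm (R ^ i * r ^ (i choose 2))"
        using assms(1) unfolding c by (simp add: power_add abs_mult power_abs)
      also have "\<dots> \<le> 1 / 2 * norm (R ^ i * r ^ (i choose 2))"
        by (rule mult_right_mono) (use N[OF that] in auto)
      finally show ?thesis .
    qed
  qed auto
qed

section \<open>Estimates and expansions in the open unit disc\<close>

locale qdisc =
  fixes q :: complex
  assumes norm_q: "norm q < 1"
begin

lemma summable_norm_q: "summable (\<lambda>i. norm (a * q ^ i))"
  unfolding norm_mult norm_power using norm_q by (intro summable_mult summable_geometric) auto

lemma convergent_prod_qpoch: "convergent_prod (\<lambda>i. 1 - a * q ^ i)"
  by (intro abs_convergent_prod_imp_convergent_prod summable_imp_abs_convergent_prod)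
     (use summable_norm_q[of a] in simp)

lemma qpoch_tendsto: "qpoch a q \<longlonglongrightarrow> qpoch_inf a q"
proof -
  have "(\<lambda>n. \<Prod>i\<le>n. 1 - a * q ^ i) \<longlonglongrightarrow> qpoch_inf a q"
    unfolding qpoch_inf_def by (rule convergent_prod_LIMSEQ[OF convergent_prod_qpoch])
  then have "(\<lambda>n. qpoch a q (Suc n)) \<longlonglongrightarrow> qpoch_inf a q"
    by (simp add: qpoch_lessThan lessThan_Suc_atMost)
  then show ?thesis by (rule LIMSEQ_imp_Suc)
qed

lemma qpoch_inf_split: "qpoch_inf a q = qpoch a q m * qpoch_inf (a * q ^ m) q"
proof -
  have "(\<lambda>k. qpoch a q (m + k)) \<longlonglongrightarrow> qpoch_inf a q"
    using qpoch_tendsto[of a] by (subst add.commute) (rule LIMSEQ_ignore_initial_segment)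
  moreover have "(\<lambda>k. qpoch a q (m + k)) \<longlonglongrightarrow> qpoch a q m * qpoch_inf (a * q ^ m) q"
    unfolding qpoch_add by (intro tendsto_intros qpoch_tendsto)
  ultimately show ?thesis by (rule LIMSEQ_unique)
qed

lemma qpoch_inf_rec: "qpoch_inf a q = (1 - a) * qpoch_inf (a * q) q"
  using qpoch_inf_split[of a 1] by (simp add: qpoch_def)

lemma one_minus_q_power_nonzero: "1 - q * q ^ i \<noteq> 0"
proof
  assume "1 - q * q ^ i = 0"
  then have "norm q ^ Suc i = 1"
    by (metis eq_iff_diff_eq_0 norm_one norm_power power_Suc)
  then show False
    using norm_q power_Suc_less_one[of "norm q" i] by (cases "q = 0") auto
qed

lemma qfact_nonzero [simp]: "qpoch q q m \<noteq> 0"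
  unfolding qpoch_lessThan using one_minus_q_power_nonzero by simp

lemma qpoch_inf_q_nonzero [simp]: "qpoch_inf q q \<noteq> 0"
  unfolding qpoch_inf_def
  by (rule prodinf_nonzero[OF convergent_prod_qpoch one_minus_q_power_nonzero])

text \<open>The sequence converges, because its denominators tend to the nonzero value
  \<open>qpoch_inf q q\<close>. The bound, uniform in \<open>m\<close>, feeds most of the domination
  arguments below.\<close>

lemma inverse_qfact_bounded: obtains B where "B > 0" "\<And>m. norm (1 / qpoch q q m) \<le> B"
proof -
  have "(\<lambda>m. 1 / qpoch q q m) \<longlonglongrightarrow> 1 / qpoch_inf q q"
    by (intro tendsto_intros qpoch_tendsto) auto
  then have "Bseq (\<lambda>m. 1 / qpoch q q m)"
    by (meson convergentI convergent_imp_Bseq)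
  then show ?thesis using that unfolding Bseq_def by blast
qed

lemma qpoch_bounded: obtains B where "B > 0" "\<And>a m. norm a \<le> R \<Longrightarrow> norm (qpoch a q m) \<le> B"
proof -
  define B where "B = exp (\<Sum>i. norm (of_real R * q ^ i))"
  have "norm (qpoch a q m) \<le> B" if a: "norm a \<le> R" for a m
  proof -
    have R: "R \<ge> 0" using a norm_ge_zero order_trans by blast
    have "norm (qpoch a q m) = (\<Prod>i<m. norm (1 - a * q ^ i))"
      unfolding qpoch_lessThan by (simp add: prod_norm)
    also have "\<dots> \<le> (\<Prod>i<m. exp (norm (of_real R * q ^ i)))"
    proof (rule prod_mono, safe)
      fix i
      have "norm (1 - a * q ^ i) \<le> 1 + norm (a * q ^ i)"
        by (metis norm_one norm_triangle_ineq4)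
      also have "\<dots> \<le> 1 + norm (of_real R * q ^ i)"
        using a R by (simp add: norm_mult mult_right_mono)
      also have "\<dots> \<le> exp (norm (of_real R * q ^ i))"
        by (rule exp_ge_add_one_self)
      finally show "norm (1 - a * q ^ i) \<le> exp (norm (of_real R * q ^ i))" .
    qed auto
    also have "\<dots> = exp (\<Sum>i<m. norm (of_real R * q ^ i))"
      by (simp add: exp_sum)
    also have "\<dots> \<le> B"
      unfolding B_def by (simp add: sum_le_suminf summable_norm_q)
    finally show ?thesis .
  qed
  then show ?thesis using that[of B] by (simp add: B_def)
qed

text \<open>The finite \<open>q\<close>-binomial theorem, divided by \<open>(q)\<^sub>n\<close> so that no Gaussian binomials occur.\<close>

lemma q_binomial:
  "(\<Sum>i\<le>n. (-z) ^ i * q ^ (i choose 2) / (qpoch q q i * qpoch q q (n - i))) = qpoch z q n / qpoch q q n"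
proof (induction n)
  case 0
  then show ?case by (simp add: numeral_2_eq_2)
next
  case (Suc n)
  define T where "T m i = (-z) ^ i * q ^ (i choose 2) / (qpoch q q i * qpoch q q (m - i))" for m i
  have c: "Suc i choose 2 = i + (i choose 2)" for i
    by (simp add: numeral_2_eq_2)
  \<comment> \<open>The q-Pascal rule in divided form: 1 - q^(n+1) = (1 - q^(n+1-i)) + q^(n+1-i) (1
    - q^i). The first part cancels the last factor of (q)_(n+1-i), the second that of (q)_i;
    \<open>S1\<close> and \<open>S2\<close> evaluate the two resulting sums.\<close>
  have S1: "(\<Sum>i\<le>Suc n. (1 - q ^ (Suc n - i)) * T (Suc n) i) = (\<Sum>i\<le>n. T n i)"
  proof -
    have "(\<Sum>i\<le>Suc n. (1 - q ^ (Suc n - i)) * T (Suc n) i) = (\<Sum>i\<le>n. (1 - q ^ (Suc n - i)) * T (Suc n) i)"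
      by simp
    also have "\<dots> = (\<Sum>i\<le>n. T n i)"
    proof (rule sum.cong[OF refl])
      fix i assume "i \<in> {..n}"
      then have "Suc n - i = Suc (n - i)" by auto
      then show "(1 - q ^ (Suc n - i)) * T (Suc n) i = T n i"
        using one_minus_q_power_nonzero[of "n - i"] by (simp add: T_def qpoch_Suc)
    qed
    finally show ?thesis .
  qed
  have S2: "(\<Sum>i\<le>Suc n. q ^ (Suc n - i) * (1 - q ^ i) * T (Suc n) i) = - z * q ^ n * (\<Sum>i\<le>n. T n i)"
  proof -
    have "(\<Sum>i\<le>Suc n. q ^ (Suc n - i) * (1 - q ^ i) * T (Suc n) i)
        = (\<Sum>i\<le>n. q ^ (n - i) * (1 - q ^ Suc i) * T (Suc n) (Suc i))"
      by (subst sum.atMost_Suc_shift) simp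
    also have "\<dots> = (\<Sum>i\<le>n. - z * q ^ n * T n i)"
    proof (rule sum.cong[OF refl])
      fix i assume "i \<in> {..n}"
      then have "q ^ n = q ^ (n - i) * q ^ i"
        by (metis atMost_iff le_add_diff_inverse2 power_add)
      then show "q ^ (n - i) * (1 - q ^ Suc i) * T (Suc n) (Suc i) = - z * q ^ n * T n i"
        using one_minus_q_power_nonzero[of i]
        by (simp add: T_def qpoch_Suc c power_add divide_simps)
    qed
    finally show ?thesis by (simp add: sum_distrib_left)
  qed
  have "(1 - q ^ Suc n) * (\<Sum>i\<le>Suc n. T (Suc n) i)
      = (\<Sum>i\<le>Suc n. (1 - q ^ (Suc n - i)) * T (Suc n) i + q ^ (Suc n - i) * (1 - q ^ i) * T (Suc n) i)"
    unfolding sum_distrib_left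
  proof (rule sum.cong[OF refl])
    fix i assume "i \<in> {..Suc n}"
    then have "q ^ Suc n = q ^ (Suc n - i) * q ^ i"
      by (metis atMost_iff le_add_diff_inverse2 power_add)
    then show "(1 - q ^ Suc n) * T (Suc n) i
        = (1 - q ^ (Suc n - i)) * T (Suc n) i + q ^ (Suc n - i) * (1 - q ^ i) * T (Suc n) i"
      by (simp add: algebra_simps)
  qed
  also have "\<dots> = (1 - z * q ^ n) * (\<Sum>i\<le>n. T n i)"
    unfolding sum.distrib S1 S2 by (simp add: algebra_simps)
  also have "(\<Sum>i\<le>n. T n i) = qpoch z q n / qpoch q q n"
    using Suc.IH by (simp add: T_def)
  finally have "(\<Sum>i\<le>Suc n. T (Suc n) i) = qpoch z q (Suc n) / qpoch q q (Suc n)"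
    using one_minus_q_power_nonzero[of n] by (simp add: qpoch_Suc field_simps)
  then show ?case by (simp add: T_def)
qed

lemma euler_abs_summable:
  "(\<lambda>i. norm (z ^ i * q ^ (i choose 2) / qpoch q q i)) summable_on UNIV"
proof -
  obtain B where B: "B > 0" "\<And>m. norm (1 / qpoch q q m) \<le> B"
    using inverse_qfact_bounded by blast
  have S: "summable (\<lambda>i. B * (norm z ^ i * norm q ^ (i choose 2)))"
    by (intro summable_mult summable_power_triangular) (use norm_q in auto)
  have le: "norm (z ^ i * q ^ (i choose 2) / qpoch q q i) \<le> B * (norm z ^ i * norm q ^ (i choose 2))" for i
  proof -
    have "norm (z ^ i * q ^ (i choose 2) / qpoch q q i)
        = norm (1 / qpoch q q i) * (norm z ^ i * norm q ^ (i choose 2))"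
      by (simp add: norm_mult norm_power norm_divide)
    also have "\<dots> \<le> B * (norm z ^ i * norm q ^ (i choose 2))"
      by (intro mult_right_mono B) auto
    finally show ?thesis .
  qed
  have "summable (\<lambda>i. norm (z ^ i * q ^ (i choose 2) / qpoch q q i))"
    by (rule summable_comparison_test'[OF S]) (unfold real_norm_def abs_norm_cancel, rule le)
  then show ?thesis
    by (subst summable_on_UNIV_nonneg_real_iff) (rule norm_ge_zero)
qed

text \<open>Series and product both satisfy g(z) = (1 - z) g(zq). Iterating this and letting z q^m
  tend to 0 determines g from its continuity and value 1 at 0.\<close>

lemma euler: "((\<lambda>i. (-z) ^ i * q ^ (i choose 2) / qpoch q q i) has_sum qpoch_inf z q) UNIV"
proof -
  define f where "f i = q ^ (i choose 2) / qpoch q q i" for i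
  define g where "g z = (\<Sum>i. f i * (-z) ^ i)" for z
  have summ: "summable (\<lambda>i. f i * (-z) ^ i)" for z
  proof -
    have "summable (\<lambda>i. norm (f i * (-z) ^ i))"
      using summable_on_imp_summable[OF euler_abs_summable[of "-z"]]
      by (simp add: f_def norm_mult norm_divide mult.commute)
    then show ?thesis by (rule summable_norm_cancel)
  qed
  have cont: "isCont (\<lambda>z. \<Sum>i. f i * z ^ i) 0"
    by (rule isCont_powser[where K = 1]) (use summ[of "-1"] in auto)
  have pow: "(- (z * q)) ^ i = (-z) ^ i * q ^ i" for z :: complex and i
    by (metis mult_minus_left power_mult_distrib)
  have rec: "g z = (1 - z) * g (z * q)" for z
  proof -
    have "g z - g (z * q) = (\<Sum>i. f i * (-z) ^ i - f i * (-(z * q)) ^ i)"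
      unfolding g_def by (rule suminf_diff[OF summ summ])
    also have "\<dots> = (\<Sum>i. f i * (-z) ^ i * (1 - q ^ i))"
      by (intro suminf_cong) (unfold pow, simp add: algebra_simps)
    also have "\<dots> = (\<Sum>i. f (Suc i) * (-z) ^ Suc i * (1 - q ^ Suc i))"
    proof -
      have "summable (\<lambda>i. f i * (-z) ^ i - f i * (-(z * q)) ^ i)"
        by (rule summable_diff[OF summ summ])
      also have "(\<lambda>i. f i * (-z) ^ i - f i * (-(z * q)) ^ i) = (\<lambda>i. f i * (-z) ^ i * (1 - q ^ i))"
        by (rule ext) (unfold pow, simp add: algebra_simps)
      finally show ?thesis
        using suminf_split_head[of "\<lambda>i. f i * (-z) ^ i * (1 - q ^ i)"] by simp
    qed
    also have "\<dots> = (\<Sum>i. - z * (f i * (-(z * q)) ^ i))"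
    proof (rule suminf_cong)
      fix i
      have "Suc i choose 2 = i + (i choose 2)" by (simp add: numeral_2_eq_2)
      then show "f (Suc i) * (-z) ^ Suc i * (1 - q ^ Suc i) = - z * (f i * (-(z * q)) ^ i)"
        using one_minus_q_power_nonzero[of i]
        unfolding pow by (simp add: f_def qpoch_Suc power_add)
    qed
    also have "\<dots> = - z * g (z * q)"
      unfolding g_def by (rule suminf_mult[OF summ])
    finally show ?thesis by (simp add: algebra_simps)
  qed
  have g_pow: "g z = qpoch z q m * g (z * q ^ m)" for m
  proof (induction m)
    case (Suc m)
    have "g (z * q ^ m) = (1 - z * q ^ m) * g (z * q ^ Suc m)"
      using rec[of "z * q ^ m"] by (simp add: mult_ac)
    then show ?case using Suc.IH by (simp add: qpoch_Suc)
  qed simp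
  have "(\<lambda>m. - (z * q ^ m)) \<longlonglongrightarrow> - (z * 0)"
    by (intro tendsto_intros LIMSEQ_power_zero norm_q)
  then have "(\<lambda>m. \<Sum>i. f i * (- (z * q ^ m)) ^ i) \<longlonglongrightarrow> (\<Sum>i. f i * 0 ^ i)"
    by (intro isCont_tendsto_compose[OF cont]) auto
  then have "(\<lambda>m. qpoch z q m * g (z * q ^ m)) \<longlonglongrightarrow> qpoch_inf z q * (\<Sum>i. f i * 0 ^ i)"
    unfolding g_def by (intro tendsto_mult qpoch_tendsto)
  then have "(\<lambda>m. g z) \<longlonglongrightarrow> qpoch_inf z q * (\<Sum>i. f i * 0 ^ i)"
    by (subst (asm) g_pow[symmetric])
  then have "g z = qpoch_inf z q * (\<Sum>i. f i * 0 ^ i)"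
    by (simp add: LIMSEQ_const_iff)
  then have g_eq: "g z = qpoch_inf z q"
    unfolding powser_zero by (simp add: f_def numeral_2_eq_2)
  have eq: "(-z) ^ i * q ^ (i choose 2) / qpoch q q i = f i * (-z) ^ i" for i
    by (simp add: f_def)
  have hs: "((\<lambda>i. f i * (-z) ^ i) has_sum infsum (\<lambda>i. f i * (-z) ^ i) UNIV) UNIV"
    using abs_summable_summable[OF euler_abs_summable[of "-z"]] unfolding eq by (rule has_sum_infsum)
  then have "infsum (\<lambda>i. f i * (-z) ^ i) UNIV = g z"
    unfolding g_def by (rule sums_unique[OF has_sum_imp_sums])
  then show ?thesis
    using hs unfolding eq g_eq by simp
qed

end

section \<open>Laurent expansions on the punctured plane\<close>

lemma abs_summable_on_times:
  fixes f :: "'a \<Rightarrow> 'c :: real_normed_field" and g :: "'b \<Rightarrow> 'c"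
  assumes "(\<lambda>i. norm (f i)) summable_on A" "(\<lambda>j. norm (g j)) summable_on B"
  shows "(\<lambda>p. norm (case p of (i, j) \<Rightarrow> f i * g j)) summable_on A \<times> B"
proof -
  have "(\<lambda>j. norm (f i * g j)) summable_on B" for i
    unfolding norm_mult by (rule summable_on_cmult_right[OF assms(2)])
  moreover have "(\<lambda>i. norm (\<Sum>\<^sub>\<infinity>j\<in>B. norm (f i * g j))) summable_on A"
  proof -
    have "norm (\<Sum>\<^sub>\<infinity>j\<in>B. norm (f i * g j)) = norm (f i) * (\<Sum>\<^sub>\<infinity>j\<in>B. norm (g j))" for i
      unfolding norm_mult infsum_cmult_right' by (simp add: abs_mult infsum_nonneg)
    then show ?thesis
      using summable_on_cmult_left[OF assms(1)] by simp
  qed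
  ultimately show ?thesis
    by (subst Infinite_Sum.abs_summable_on_Sigma_iff) simp
qed

text \<open>The constant term, taken as a mean over the unit circle. It applies to any continuous
  function, so it commutes with infinite sums by uniform convergence, without reference to
  coefficients.\<close>

definition CT :: "(complex \<Rightarrow> complex) \<Rightarrow> complex" where
  "CT f = integral {0..1} (\<lambda>s. f (cis (2 * pi * s)))"

lemma CT_cong: "(\<And>x. norm x = 1 \<Longrightarrow> f x = g x) \<Longrightarrow> CT f = CT g"
  unfolding CT_def by (intro integral_cong) auto

lemma continuous_on_circle_param:
  assumes "continuous_on (sphere 0 1) f"
  shows "continuous_on {0..1} (\<lambda>s. f (cis (2 * pi * s)))"
proof (rule continuous_on_compose2[OF assms])
  show "continuous_on {0..1} (\<lambda>s. cis (2 * pi * s))"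
    unfolding cis_conv_exp by (intro continuous_intros)
qed auto

lemma CT_has_sum:
  assumes cont: "\<And>i. i \<in> I \<Longrightarrow> continuous_on (sphere 0 1) (f i)"
    and bound: "\<And>i x. i \<in> I \<Longrightarrow> norm x = 1 \<Longrightarrow> norm (f i x) \<le> M i"
    and summ: "M summable_on I"
  shows "((\<lambda>i. CT (f i)) has_sum CT (\<lambda>x. \<Sum>\<^sub>\<infinity>i\<in>I. f i x)) I"
proof -
  \<comment> \<open>Extension by zero outside \<open>I\<close> makes every finite partial sum
    continuous, including those over sets not contained in \<open>I\<close>, as the limit theorem
    for integrals requires.\<close>
  define h where "h i s = (if i \<in> I then f i (cis (2 * pi * s)) else 0)" for i and s :: real
  have cont_h: "continuous_on {0..1} (h i)" for i
    using continuous_on_circle_param[OF cont, of i] by (cases "i \<in> I") (auto simp: h_def)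
  have int_h: "h i integrable_on {0..1}" for i
    by (rule integrable_continuous_real[OF cont_h])
  have "uniform_limit {0..1} (\<lambda>X s. \<Sum>i\<in>X. h i s) (\<lambda>s. \<Sum>\<^sub>\<infinity>i\<in>I. h i s) (finite_subsets_at_top I)"
    by (rule Weierstrass_m_test_general[OF _ summ]) (auto simp: h_def bound)
  then obtain J J' where J: "\<And>X. ((\<lambda>s. \<Sum>i\<in>X. h i s) has_integral J X) {0..1}"
      "((\<lambda>s. \<Sum>\<^sub>\<infinity>i\<in>I. h i s) has_integral J') {0..1}" "(J \<longlongrightarrow> J') (finite_subsets_at_top I)"
    by (rule uniform_limit_integral) (auto intro!: continuous_on_sum cont_h)
  have J_eq: "J X = (\<Sum>i\<in>X. CT (f i))" if "finite X" "X \<subseteq> I" for X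
  proof -
    have "J X = integral {0..1} (\<lambda>s. \<Sum>i\<in>X. h i s)"
      using J(1)[of X] by (simp add: integral_unique)
    also have "\<dots> = (\<Sum>i\<in>X. integral {0..1} (h i))"
      by (rule integral_sum[OF that(1) int_h])
    also have "\<dots> = (\<Sum>i\<in>X. CT (f i))"
      unfolding CT_def by (intro sum.cong arg_cong[where f = "integral _"]) (use that(2) in \<open>auto simp: h_def fun_eq_iff\<close>)
    finally show ?thesis .
  qed
  have J'_eq: "J' = CT (\<lambda>x. \<Sum>\<^sub>\<infinity>i\<in>I. f i x)"
  proof -
    have "(\<Sum>\<^sub>\<infinity>i\<in>I. h i s) = (\<Sum>\<^sub>\<infinity>i\<in>I. f i (cis (2 * pi * s)))" for s
      by (intro infsum_cong) (simp add: h_def)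
    then show ?thesis
      using J(2) by (simp add: CT_def integral_unique)
  qed
  have "((\<lambda>X. \<Sum>i\<in>X. CT (f i)) \<longlongrightarrow> J') (finite_subsets_at_top I)"
    using J(3) by (rule Lim_transform_eventually)
      (auto simp: J_eq intro!: eventually_finite_subsets_at_top_weakI)
  then show ?thesis
    by (simp add: has_sum_def J'_eq)
qed

lemma CT_power_int: "CT (\<lambda>x. c * x powi k) = (if k = 0 then c else 0)"
proof (cases "k = 0")
  case True
  then show ?thesis by (simp add: CT_def)
next
  case False
  define a where "a = 2 * pi * of_int k"
  have a: "a \<noteq> 0" using False by (simp add: a_def)
  have eq: "cis (2 * pi * s) powi k = cis (a * s)" for s
    by (simp add: cis_power_int a_def mult_ac)
  have "((\<lambda>s. c * cis (a * s)) has_integral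
      (c * cis (a * 1) / (\<i> * of_real a) - c * cis (a * 0) / (\<i> * of_real a))) {0..1}"
  proof (rule fundamental_theorem_of_calculus)
    fix s :: real
    have "((\<lambda>z. c * exp (\<i> * of_real a * z) / (\<i> * of_real a)) has_field_derivative
        c * exp (\<i> * of_real a * of_real s)) (at (of_real s))"
      using a by (auto intro!: derivative_eq_intros)
    then have "((\<lambda>s. c * exp (\<i> * of_real a * of_real s) / (\<i> * of_real a)) has_vector_derivative
        c * exp (\<i> * of_real a * of_real s)) (at s within {0..1})"
      by (rule has_vector_derivative_real_field)
    then show "((\<lambda>s. c * cis (a * s) / (\<i> * of_real a)) has_vector_derivative c * cis (a * s)) (at s within {0..1})"
      by (simp add: cis_conv_exp mult_ac)
  qed auto
  moreover have "cis a = 1"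
    using cis_multiple_2pi[of "of_int k"] by (simp add: a_def mult_ac)
  ultimately have "((\<lambda>s. c * cis (a * s)) has_integral 0) {0..1}"
    by simp
  then have "integral {0..1} (\<lambda>s. c * cis (a * s)) = 0"
    by (rule integral_unique)
  then show ?thesis
    unfolding CT_def eq using False by simp
qed

text \<open>Convergence is demanded at every nonzero point and not only on an annulus. The functions
  in question are analytic on the punctured plane, so scaling by \<open>q\<close> and evaluation at
  arbitrary exponentials need no bookkeeping of radii.\<close>

definition laurent :: "(complex \<Rightarrow> complex) \<Rightarrow> (int \<Rightarrow> complex) \<Rightarrow> bool" where
  "laurent f c \<longleftrightarrow> (\<forall>x. x \<noteq> 0 \<longrightarrow> ((\<lambda>k. c k * x powi k) has_sum f x) UNIV)"

lemma laurentD: "laurent f c \<Longrightarrow> x \<noteq> 0 \<Longrightarrow> ((\<lambda>k. c k * x powi k) has_sum f x) UNIV"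
  by (simp add: laurent_def)

lemma laurent_cong: "laurent f c \<Longrightarrow> (\<And>x. x \<noteq> 0 \<Longrightarrow> f x = g x) \<Longrightarrow> laurent g c"
  by (simp add: laurent_def)

lemma laurent_abs_summable:
  assumes "laurent f c" "x \<noteq> 0"
  shows "(\<lambda>k. norm (c k * x powi k)) summable_on UNIV"
  by (rule summable_on_iff_abs_summable_on_complex[THEN iffD1, OF has_sum_imp_summable[OF laurentD[OF assms]]])

lemma laurent_uniform_limit:
  assumes "laurent f c"
  shows "uniform_limit (sphere 0 1) (\<lambda>X x. \<Sum>k\<in>X. c k * x powi k) f (finite_subsets_at_top UNIV)"
proof (rule Weierstrass_m_test_general'[where M = "\<lambda>k. norm (c k * 1 powi k)"])
  show "(\<lambda>k. norm (c k * 1 powi k)) summable_on UNIV"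
    by (rule laurent_abs_summable[OF assms]) simp
  show "((\<lambda>k. c k * x powi k) has_sum f x) UNIV" if "x \<in> sphere 0 1" for x
    using that by (intro laurentD[OF assms]) auto
qed (auto simp: norm_mult norm_power_int)

lemma laurent_continuous:
  assumes "laurent f c"
  shows "continuous_on (sphere 0 1) f"
  by (rule uniform_limit_theorem[OF _ laurent_uniform_limit[OF assms]])
     (auto intro!: always_eventually continuous_intros)

lemma laurent_bounded:
  assumes "laurent f c"
  obtains B where "B > 0" "\<And>x. norm x = 1 \<Longrightarrow> norm (f x) \<le> B"
proof -
  have "bounded (f ` sphere 0 1)"
    by (intro compact_imp_bounded compact_continuous_image laurent_continuous[OF assms]) auto
  then obtain B where B: "B > 0" "\<forall>y\<in>f ` sphere 0 1. norm y \<le> B"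
    unfolding bounded_pos by blast
  show ?thesis
    by (rule that[OF B(1)]) (use B(2) in auto)
qed

lemma laurent_scale:
  assumes "laurent f c" "a \<noteq> 0"
  shows "laurent (\<lambda>x. f (a * x)) (\<lambda>k. c k * a powi k)"
  unfolding laurent_def
proof safe
  fix x :: complex assume "x \<noteq> 0"
  then have "((\<lambda>k. c k * (a * x) powi k) has_sum f (a * x)) UNIV"
    using assms by (intro laurentD) auto
  then show "((\<lambda>k. c k * a powi k * x powi k) has_sum f (a * x)) UNIV"
    by (simp add: power_int_mult_distrib mult_ac)
qed

lemma laurent_CT:
  assumes "laurent f c"
  shows "CT f = c 0"
proof -
  have "((\<lambda>k. CT (\<lambda>x. c k * x powi k)) has_sum CT (\<lambda>x. \<Sum>\<^sub>\<infinity>k. c k * x powi k)) UNIV"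
  proof (rule CT_has_sum[where M = "\<lambda>k. norm (c k * 1 powi k)"])
    show "(\<lambda>k. norm (c k * 1 powi k)) summable_on UNIV"
      by (rule laurent_abs_summable[OF assms]) simp
  qed (auto intro!: continuous_intros simp: norm_mult norm_power_int)
  also have "(\<lambda>k. CT (\<lambda>x. c k * x powi k)) = (\<lambda>k. if k = 0 then c k else 0)"
    unfolding CT_power_int ..
  also have "CT (\<lambda>x. \<Sum>\<^sub>\<infinity>k. c k * x powi k) = CT f"
    by (intro CT_cong infsumI laurentD[OF assms]) auto
  finally have "((\<lambda>k. if k = 0 then c k else 0) has_sum CT f) UNIV" .
  moreover have "((\<lambda>k. if k = 0 then c k else 0) has_sum c 0) (UNIV :: int set)"
    by (rule has_sum_finite_neutralI[where B = "{0}"]) auto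
  ultimately show ?thesis by (rule has_sum_unique)
qed

lemma laurent_cmult:
  assumes "laurent f c"
  shows "laurent (\<lambda>x. a * f x) (\<lambda>k. a * c k)"
  unfolding laurent_def mult.assoc by (intro allI impI has_sum_cmult_right laurentD[OF assms])

lemma laurent_shift:
  assumes "laurent f c"
  shows "laurent (\<lambda>x. x powi j * f x) (\<lambda>k. c (k - j))"
  unfolding laurent_def
proof safe
  fix x :: complex assume x: "x \<noteq> 0"
  have "((\<lambda>k. x powi j * (c k * x powi k)) has_sum x powi j * f x) UNIV"
    by (intro has_sum_cmult_right laurentD[OF assms x])
  also have "?this \<longleftrightarrow> ((\<lambda>k. c (k - j) * x powi k) has_sum x powi j * f x) UNIV"
    by (rule has_sum_reindex_bij_witness[of _ "\<lambda>k. k - j" "\<lambda>k. k + j"])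
       (use x in \<open>auto simp: power_int_add power_int_diff\<close>)
  finally show "((\<lambda>k. c (k - j) * x powi k) has_sum x powi j * f x) UNIV" .
qed

text \<open>The coefficient of index \<open>k\<close> is the constant term of x^(-k) f(x). Through
  this lemma each functional equation becomes a recurrence for coefficients.\<close>

lemma laurent_unique:
  assumes "laurent f c" "laurent f d"
  shows "c = d"
proof
  fix k
  have "CT (\<lambda>x. x powi (-k) * f x) = c (0 - (-k))"
    by (rule laurent_CT[OF laurent_shift[OF assms(1)]])
  moreover have "CT (\<lambda>x. x powi (-k) * f x) = d (0 - (-k))"
    by (rule laurent_CT[OF laurent_shift[OF assms(2)]])
  ultimately show "c k = d k" by simp
qed

lemma laurent_inverse:
  assumes "laurent f c"
  shows "laurent (\<lambda>x. f (1 / x)) (\<lambda>k. c (- k))"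
  unfolding laurent_def
proof safe
  fix x :: complex assume x: "x \<noteq> 0"
  have "((\<lambda>k. c k * (1 / x) powi k) has_sum f (1 / x)) UNIV"
    by (intro laurentD[OF assms]) (use x in auto)
  also have "?this \<longleftrightarrow> ((\<lambda>k. c (- k) * x powi k) has_sum f (1 / x)) UNIV"
    by (rule has_sum_reindex_bij_witness[of _ uminus uminus])
       (auto simp: power_int_minus power_int_divide_distrib field_simps)
  finally show "((\<lambda>k. c (- k) * x powi k) has_sum f (1 / x)) UNIV" .
qed

lemma laurent_square:
  assumes "laurent f c"
  shows "laurent (\<lambda>x. f (x\<^sup>2)) (\<lambda>k. if even k then c (k div 2) else 0)"
  unfolding laurent_def
proof safe
  fix x :: complex assume x: "x \<noteq> 0"
  have "((\<lambda>k. c k * (x\<^sup>2) powi k) has_sum f (x\<^sup>2)) UNIV"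
    by (intro laurentD[OF assms]) (use x in auto)
  also have "?this \<longleftrightarrow> ((\<lambda>k. (if even k then c (k div 2) else 0) * x powi k) has_sum f (x\<^sup>2)) {k. even k}"
    by (rule has_sum_reindex_bij_witness[of _ "\<lambda>k. k div 2" "\<lambda>k. 2 * k"])
       (auto simp: power_int_mult)
  also have "\<dots> \<longleftrightarrow> ((\<lambda>k. (if even k then c (k div 2) else 0) * x powi k) has_sum f (x\<^sup>2)) UNIV"
    by (rule has_sum_cong_neutral) auto
  finally show "((\<lambda>k. (if even k then c (k div 2) else 0) * x powi k) has_sum f (x\<^sup>2)) UNIV" .
qed

text \<open>At each nonzero point the double series converges absolutely and may be regrouped along
  the diagonals i + j = k; the second claim is the summability of one diagonal, read off at x =
  1.\<close>

lemma laurent_mult: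
  assumes f: "laurent f c" and g: "laurent g d"
  shows "laurent (\<lambda>x. f x * g x) (\<lambda>k. \<Sum>\<^sub>\<infinity>i. c i * d (k - i))"
    and "(\<lambda>i. c i * d (k - i)) summable_on UNIV"
proof -
  have key: "((\<lambda>k. (\<Sum>\<^sub>\<infinity>i. c i * d (k - i)) * x powi k) has_sum f x * g x) UNIV
      \<and> (\<forall>k. (\<lambda>i. c i * d (k - i)) summable_on UNIV)" if x: "x \<noteq> 0" for x
  proof -
    have "(\<lambda>(i, j). (c i * x powi i) * (d j * x powi j)) summable_on UNIV \<times> UNIV"
      by (rule abs_summable_summable[OF abs_summable_on_times[OF laurent_abs_summable[OF f x]
          laurent_abs_summable[OF g x]]])
    moreover have "((\<lambda>j. (c i * x powi i) * (d j * x powi j)) has_sum (c i * x powi i) * g x) UNIV" for i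
      by (intro has_sum_cmult_right laurentD[OF g x])
    moreover have "((\<lambda>i. (c i * x powi i) * g x) has_sum f x * g x) UNIV"
      by (intro has_sum_cmult_left laurentD[OF f x])
    ultimately have "((\<lambda>(i, j). (c i * x powi i) * (d j * x powi j)) has_sum f x * g x) (UNIV \<times> UNIV)"
      by (intro has_sum_SigmaI[where g = "\<lambda>i. (c i * x powi i) * g x"]) simp_all
    also have "?this \<longleftrightarrow> ((\<lambda>(k, i). c i * d (k - i) * x powi k) has_sum f x * g x) (UNIV \<times> UNIV)"
      by (rule has_sum_reindex_bij_witness[of _ "\<lambda>(k, i). (i, k - i)" "\<lambda>(i, j). (i + j, i)"])
         (use x in \<open>auto simp: power_int_diff power_int_add\<close>)
    finally have hs: "((\<lambda>(k, i). c i * d (k - i) * x powi k) has_sum f x * g x) (UNIV \<times> UNIV)" .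
    have "(\<lambda>i. c i * d (k - i) * x powi k) summable_on UNIV" for k
      using summable_on_SigmaD1[OF has_sum_imp_summable[OF hs]] by simp
    then have s: "(\<lambda>i. c i * d (k - i)) summable_on UNIV" for k
      using x by (metis power_int_eq_0_iff summable_on_cmult_left')
    have "((\<lambda>i. c i * d (k - i) * x powi k) has_sum (\<Sum>\<^sub>\<infinity>i. c i * d (k - i)) * x powi k) UNIV" for k
      by (intro has_sum_cmult_left has_sum_infsum s)
    then have "((\<lambda>k. (\<Sum>\<^sub>\<infinity>i. c i * d (k - i)) * x powi k) has_sum f x * g x) UNIV"
      by (intro has_sum_SigmaD[OF hs]) simp
    with s show ?thesis by blast
  qed
  show "laurent (\<lambda>x. f x * g x) (\<lambda>k. \<Sum>\<^sub>\<infinity>i. c i * d (k - i))"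
    unfolding laurent_def using key by blast
  show "(\<lambda>i. c i * d (k - i)) summable_on UNIV"
    using key[of 1] by simp
qed

lemma laurent_power:
  assumes "laurent f c"
  shows "\<exists>d. laurent (\<lambda>x. f x ^ m) d"
proof (induction m)
  case 0
  have "laurent (\<lambda>x. f x ^ 0) (\<lambda>k. if k = 0 then 1 else 0)"
    unfolding laurent_def
  proof safe
    fix x :: complex
    show "((\<lambda>k. (if k = 0 then 1 else 0) * x powi k) has_sum f x ^ 0) UNIV"
      by (rule has_sum_finite_neutralI[where B = "{0}"]) auto
  qed
  then show ?case by blast
next
  case (Suc m)
  then show ?case using laurent_mult(1)[OF assms] by force
qed

lemma has_sum_nat_to_int:
  fixes g :: "nat \<Rightarrow> complex"
  assumes "(g has_sum S) UNIV"
  shows "((\<lambda>k::int. if k < 0 then 0 else g (nat k)) has_sum S) UNIV"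
proof -
  have "((\<lambda>k::int. if k < 0 then 0 else g (nat k)) has_sum S) {0..}"
    using assms has_sum_reindex_bij_witness[of UNIV nat int "{0..}" "\<lambda>k. if k < 0 then 0 else g (nat k)" g S S]
    by auto
  also have "?this \<longleftrightarrow> ?thesis"
    by (rule has_sum_cong_neutral) auto
  finally show ?thesis .
qed

context qdisc
begin

lemma laurent_qpoch_inf:
  "laurent (\<lambda>x. qpoch_inf (a * x) q)
     (\<lambda>k. if k < 0 then 0 else (-a) ^ nat k * q ^ (nat k choose 2) / qpoch q q (nat k))"
  unfolding laurent_def
proof safe
  fix x :: complex
  have "((\<lambda>k::int. if k < 0 then 0 else (- (a * x)) ^ nat k * q ^ (nat k choose 2) / qpoch q q (nat k))
      has_sum qpoch_inf (a * x) q) UNIV"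
    by (rule has_sum_nat_to_int[OF euler])
  also have "(\<lambda>k::int. if k < 0 then 0 else (- (a * x)) ^ nat k * q ^ (nat k choose 2) / qpoch q q (nat k))
     = (\<lambda>k. (if k < 0 then 0 else (-a) ^ nat k * q ^ (nat k choose 2) / qpoch q q (nat k)) * x powi k)"
  proof
    fix k :: int
    have "(- (a * x)) ^ nat k = (-a) ^ nat k * x ^ nat k"
      by (metis mult_minus_left power_mult_distrib)
    then show "(if k < 0 then 0 else (- (a * x)) ^ nat k * q ^ (nat k choose 2) / qpoch q q (nat k))
        = (if k < 0 then 0 else (-a) ^ nat k * q ^ (nat k choose 2) / qpoch q q (nat k)) * x powi k"
      by (auto simp: power_int_def)
  qed
  finally show "((\<lambda>k. (if k < 0 then 0 else (-a) ^ nat k * q ^ (nat k choose 2) / qpoch q q (nat k)) * x powi k)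
      has_sum qpoch_inf (a * x) q) UNIV" .
qed

end

section \<open>The Jacobi triple product\<close>

text \<open>The binomial coefficient \<open>k choose 2\<close> continued to all integers; the
  division is exact.\<close>

definition tri :: "int \<Rightarrow> int" where
  "tri k = k * (k - 1) div 2"

lemma two_tri: "2 * tri k = k * (k - 1)"
  by (simp add: tri_def)

lemma tri_add: "tri (a + b) = tri a + tri b + a * b"
  using two_tri[of "a + b"] two_tri[of a] two_tri[of b] by (simp add: algebra_simps)

lemma tri_minus: "tri (- a) = tri a + a"
  using two_tri[of "- a"] two_tri[of a] by (simp add: algebra_simps)

lemma tri_0 [simp]: "tri 0 = 0" and tri_1 [simp]: "tri 1 = 0"
  by (simp_all add: tri_def)

lemma tri_of_nat: "tri (int n) = int (n choose 2)"
proof (induction n)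
  case (Suc n)
  have "Suc n choose 2 = n + (n choose 2)" by (simp add: numeral_2_eq_2)
  then show ?case
    using Suc tri_add[of "int n" 1] by (simp add: add.commute)
qed (simp add: numeral_2_eq_2)

lemma choose_two_square: "2 * (j choose 2) + j = j * j"
proof -
  have "int (2 * (j choose 2) + j) = int (j * j)"
    using two_tri[of "int j"] by (simp add: tri_of_nat algebra_simps)
  then show ?thesis by (simp only: of_nat_eq_iff)
qed

lemma choose_two_add: "(m + j) choose 2 = (m choose 2) + (j choose 2) + m * j"
proof -
  have "int ((m + j) choose 2) = int ((m choose 2) + (j choose 2) + m * j)"
    using tri_add[of "int m" "int j"] unfolding of_nat_add[symmetric] tri_of_nat by simp
  then show ?thesis by (simp only: of_nat_eq_iff)
qed

text \<open>A linear lower bound for a quadratic exponent: it is enough to turn the Gaussian decay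
  of the kernels into geometric decay in the size of a step.\<close>

lemma tri_ge: "tri k \<ge> \<bar>k\<bar> - 1"
proof -
  have "k * (k - 1) \<ge> 2 * (\<bar>k\<bar> - 1)"
  proof (cases "k \<ge> 0")
    case True
    have "(k - 1) * (k - 2) \<ge> 0" by (cases "k \<ge> 2") (auto simp: mult_nonpos_nonpos)
    then show ?thesis using True by (simp add: algebra_simps)
  next
    case False
    have "(- k - 1) * (- k - 1) \<ge> 0" "- k > 0" using False by auto
    then show ?thesis using False by (simp add: algebra_simps)
  qed
  then have "2 * (\<bar>k\<bar> - 1) \<le> 2 * tri k" unfolding two_tri .
  then show ?thesis by simp
qed

lemma tri_nonneg: "tri k \<ge> 0"
proof (cases "k = 0")
  case False
  then show ?thesis using tri_ge[of k] by linarith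
qed simp

context qdisc
begin

text \<open>The factor \<open>qpoch_inf q q\<close> normalises the Laurent coefficients to signs
  times powers of \<open>q\<close>.\<close>

definition theta :: "complex \<Rightarrow> complex" where
  "theta x = qpoch_inf q q * (qpoch_inf x q * qpoch_inf (q / x) q)"

lemma theta_rec:
  assumes "x \<noteq> 0"
  shows "theta x = qpoch_inf q q * ((1 - x) * qpoch_inf (q * x) q * qpoch_inf (q / x) q)"
    and "qpoch_inf (1 / x) q = (1 - 1 / x) * qpoch_inf (q / x) q"
  using qpoch_inf_rec[of x] qpoch_inf_rec[of "1 / x"] by (simp_all add: theta_def mult.commute)

lemma theta_q_mult:
  assumes "x \<noteq> 0" "q \<noteq> 0"
  shows "theta (q * x) = - theta x / x"
proof -
  have aux: "P * (A * ((1 - 1 / x) * C)) = - (P * ((1 - x) * A * C)) / x" for P A C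
    using assms by (simp add: field_simps)
  have "theta (q * x) = qpoch_inf q q * (qpoch_inf (q * x) q * ((1 - 1 / x) * qpoch_inf (q / x) q))"
    unfolding theta_rec(2)[OF assms(1), symmetric] theta_def using assms by simp
  then show ?thesis
    unfolding aux theta_rec(1)[OF assms(1), symmetric] .
qed

lemma theta_inverse:
  assumes "x \<noteq> 0"
  shows "theta (1 / x) = - theta x / x"
proof -
  have aux: "P * (A * ((1 - 1 / x) * C)) = - (P * ((1 - x) * A * C)) / x" for P A C
    using assms by (simp add: field_simps)
  have "theta (1 / x) = qpoch_inf q q * (qpoch_inf (q * x) q * ((1 - 1 / x) * qpoch_inf (q / x) q))"
    unfolding theta_rec(2)[OF assms, symmetric] theta_def by (simp add: mult_ac)
  then show ?thesis
    unfolding aux theta_rec(1)[OF assms, symmetric] .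
qed

text \<open>The Jacobi triple product. The functional equation fixes the Laurent coefficients \<open>d\<^sub>k\<close> of
  \<open>(x)\<^sub>\<infinity> (q/x)\<^sub>\<infinity>\<close> up to \<open>d\<^sub>0\<close>; Euler's expansions of the two factors
  express \<open>d\<^sub>0\<close> through \<open>d\<^sub>M\<close> as \<open>\<Sum>\<^sub>j q\<^bsup>j(j+M)\<^esup> / (q)\<^sub>j (q)\<^bsub>j+M\<^esub>\<close> for each \<open>M\<close>,
  and \<open>M \<rightarrow> \<infinity>\<close> gives \<open>d\<^sub>0 = 1 / (q)\<^sub>\<infinity>\<close>.\<close>

lemma laurent_theta:
  assumes q: "q \<noteq> 0"
  shows "laurent theta (\<lambda>k. (-1) powi k * q powi tri k)"
proof -
  define c where "c = (\<lambda>k::int. if k < 0 then 0 else (-1) ^ nat k * q ^ (nat k choose 2) / qpoch q q (nat k))"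
  define e where "e = (\<lambda>k::int. if k < 0 then 0 else (-q) ^ nat k * q ^ (nat k choose 2) / qpoch q q (nat k))"
  define d where "d k = (\<Sum>\<^sub>\<infinity>i. c i * e (i - k))" for k
  define \<psi> where "\<psi> x = qpoch_inf x q * qpoch_inf (q / x) q" for x
  have theta_psi: "theta x = qpoch_inf q q * \<psi> x" for x
    by (simp add: theta_def \<psi>_def)
  have Lc: "laurent (\<lambda>x. qpoch_inf x q) c"
    using laurent_qpoch_inf[of 1] by (simp add: c_def)
  have Le: "laurent (\<lambda>x. qpoch_inf (q / x) q) (\<lambda>k. e (- k))"
    using laurent_inverse[OF laurent_qpoch_inf[of q]] by (simp add: e_def)
  have Ld: "laurent \<psi> d" and summ: "(\<lambda>i. c i * e (i - k)) summable_on UNIV" for k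
    using laurent_mult[OF Lc Le] unfolding \<psi>_def d_def by simp_all
  have "laurent (\<lambda>x. \<psi> (q * x)) (\<lambda>k. d k * q powi k)"
    by (rule laurent_scale[OF Ld q])
  moreover have "laurent (\<lambda>x. \<psi> (q * x)) (\<lambda>k. (-1) * d (k - (-1)))"
  proof (rule laurent_cong[OF laurent_cmult[OF laurent_shift[OF Ld]]])
    fix x :: complex assume "x \<noteq> 0"
    then have "qpoch_inf q q * \<psi> (q * x) = qpoch_inf q q * (- \<psi> x / x)"
      using theta_q_mult[OF _ q, of x] by (simp add: theta_psi)
    then have "\<psi> (q * x) = - \<psi> x / x"
      by (rule mult_left_cancel[OF qpoch_inf_q_nonzero, THEN iffD1])
    then show "-1 * (x powi - 1 * \<psi> x) = \<psi> (q * x)"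
      by (simp add: power_int_minus divide_inverse)
  qed
  ultimately have "(\<lambda>k. d k * q powi k) = (\<lambda>k. (-1) * d (k - (-1)))"
    by (rule laurent_unique)
  then have rec: "d (k + 1) = - (q powi k * d k)" for k
    by (metis diff_minus_eq_add mult.commute mult_minus1 minus_minus)
  have d: "d k = (-1) powi k * q powi tri k * d 0" for k
  proof (induction k rule: int_induct[where k = 0])
    case (step1 i)
    then show ?case
      using rec[of i] q by (simp add: tri_add power_int_add)
  next
    case (step2 i)
    have "tri i = tri (i - 1) + (i - 1)"
      using tri_add[of "i - 1" 1] by simp
    then have "(-1) powi i * q powi tri i = - ((-1) powi (i - 1) * q powi tri (i - 1) * q powi (i - 1))"
      using q by (simp add: power_int_add power_int_diff)
    moreover have "d i = - (q powi (i - 1) * d (i - 1))"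
      using rec[of "i - 1"] by simp
    ultimately have "q powi (i - 1) * d (i - 1) = q powi (i - 1) * ((-1) powi (i - 1) * q powi tri (i - 1) * d 0)"
      using step2 by (auto simp add: algebra_simps)
    then show ?case using q by auto
  qed simp
  have d0: "d 0 = 1 / qpoch_inf q q"
  proof -
    define a where "a j M = q ^ (j * j + M * j) / (qpoch q q (M + j) * qpoch q q j)" for j M
    have hs: "((\<lambda>j. a j M) has_sum d 0) UNIV" for M
    proof -
      define u where "u = (-1) ^ M * q ^ (M choose 2)"
      have u: "u \<noteq> 0" using q by (simp add: u_def)
      have "((\<lambda>i. c i * e (i - int M)) has_sum d (int M)) UNIV"
        unfolding d_def using summ by (rule has_sum_infsum)
      also have "?this \<longleftrightarrow> ((\<lambda>i. c i * e (i - int M)) has_sum d (int M)) {int M..}"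
        by (rule has_sum_cong_neutral) (auto simp: e_def)
      also have "\<dots> \<longleftrightarrow> ((\<lambda>j. u * a j M) has_sum d (int M)) (UNIV :: nat set)"
      proof (rule has_sum_reindex_bij_witness[of _ "\<lambda>j. int (M + j)" "\<lambda>i. nat (i - int M)"])
        fix i assume "i \<in> {int M..}"
        then obtain j where i: "i = int (M + j)"
          by (metis atLeast_iff of_nat_add zle_iff_zadd)
        have "((M + j) choose 2) + (j + (j choose 2)) = (M choose 2) + (j * j + M * j)"
          using choose_two_square[of j] choose_two_add[of M j] by simp
        then have "q ^ ((M + j) choose 2) * (q ^ j * q ^ (j choose 2)) = q ^ (M choose 2) * q ^ (j * j + M * j)"
          by (metis power_add)
        then show "u * a (nat (i - int M)) M = c i * e (i - int M)"
          unfolding i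
          by (simp add: u_def a_def c_def e_def nat_int_add power_add power_minus[of q] field_simps)
      qed auto
      finally have "((\<lambda>j. u * a j M) has_sum u * d 0) UNIV"
        unfolding d[of "int M"] by (simp add: u_def tri_of_nat)
      then show ?thesis
        using u by (simp add: has_sum_cmult_right_iff)
    qed
    have suminf_a: "suminf (\<lambda>j. a j M) = d 0" for M
      using has_sum_imp_sums[OF hs] by (simp add: sums_iff)
    obtain B where B: "B > 0" "\<And>m. norm (1 / qpoch q q m) \<le> B"
      using inverse_qfact_bounded by blast
    \<comment> \<open>The majorant does not depend on \<open>M\<close>, as Tannery's theorem
      requires for exchanging the limit with the sum.\<close>
    have bound: "norm (a j M) \<le> B * B * norm q ^ j" for j M
    proof -
      have "norm (a j M) = norm (1 / qpoch q q (M + j)) * norm (1 / qpoch q q j) * norm q ^ (j * j + M * j)"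
        by (simp add: a_def norm_divide norm_mult norm_power)
      also have "\<dots> \<le> B * B * norm q ^ j"
        using B norm_q by (intro mult_mono power_decreasing trans_le_add1 le_square) auto
      finally show ?thesis .
    qed
    have lim: "(\<lambda>M. a j M) \<longlonglongrightarrow> (if j = 0 then 1 / qpoch_inf q q else 0)" for j
    proof (cases "j = 0")
      case True
      have "(\<lambda>M. 1 / qpoch q q M) \<longlonglongrightarrow> 1 / qpoch_inf q q"
        by (intro tendsto_intros qpoch_tendsto) auto
      then show ?thesis using True by (simp add: a_def)
    next
      case False
      have "(\<lambda>M. q ^ M) \<longlonglongrightarrow> 0" by (rule LIMSEQ_power_zero[OF norm_q])
      moreover have "(\<lambda>M. qpoch q q (M + j)) \<longlonglongrightarrow> qpoch_inf q q"
        by (rule LIMSEQ_ignore_initial_segment[OF qpoch_tendsto])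
      ultimately have "(\<lambda>M. q ^ (j * j) * (q ^ M) ^ j / (qpoch q q (M + j) * qpoch q q j))
          \<longlonglongrightarrow> q ^ (j * j) * 0 ^ j / (qpoch_inf q q * qpoch q q j)"
        by (intro tendsto_intros) (auto simp: norm_q)
      then show ?thesis
        using False by (simp add: a_def power_add power_mult zero_power)
    qed
    have "(\<lambda>M. suminf (\<lambda>j. a j M)) \<longlonglongrightarrow> suminf (\<lambda>j. if j = 0 then 1 / qpoch_inf q q else 0)"
    proof -
      have "summable (\<lambda>j. B * B * norm q ^ j)"
        using norm_q by (intro summable_mult summable_geometric) auto
      then show ?thesis
        using tannerys_theorem[where a = a and M = "\<lambda>j. B * B * norm q ^ j", OF lim always_eventually] bound
        by simp
    qed
    then have "(\<lambda>M::nat. d 0) \<longlonglongrightarrow> 1 / qpoch_inf q q"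
      unfolding suminf_a by (subst (asm) suminf_finite[of "{0}"]) auto
    then show ?thesis by (simp add: LIMSEQ_const_iff)
  qed
  have "laurent (\<lambda>x. qpoch_inf q q * \<psi> x) (\<lambda>k. qpoch_inf q q * d k)"
    by (rule laurent_cmult[OF Ld])
  also have "(\<lambda>x. qpoch_inf q q * \<psi> x) = theta"
    by (simp add: fun_eq_iff theta_def \<psi>_def)
  also have "(\<lambda>k. qpoch_inf q q * d k) = (\<lambda>k. (-1) powi k * q powi tri k)"
    by (subst d) (simp add: d0)
  finally show ?thesis .
qed

end

section \<open>Transfer matrices and big q-Hermite functions\<close>

lemma has_sum_sum:
  fixes f :: "'a \<Rightarrow> 'b \<Rightarrow> 'c :: topological_comm_monoid_add"
  assumes "\<And>i. i \<in> I \<Longrightarrow> (f i has_sum S i) A"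
  shows "((\<lambda>x. \<Sum>i\<in>I. f i x) has_sum (\<Sum>i\<in>I. S i)) A"
proof (cases "finite I")
  case True
  then show ?thesis using assms
    by (induction I rule: finite_induct) (auto intro: has_sum_add)
qed simp

lemma qpoch_Suc_left: "qpoch a q (Suc m) = (1 - a) * qpoch (a * q) q m"
  using qpoch_add[of a q 1 m] by (simp add: qpoch_lessThan)

context qdisc
begin

text \<open>The exponent is \<open>tri d\<close> and not half a square, so that all powers of
  \<open>q\<close> are integral; the linear terms cancel along a chain that starts and ends at
  0.\<close>

definition ker :: "complex \<Rightarrow> int \<Rightarrow> complex" where
  "ker t d = (-t) powi d * q powi tri d"

definition bigH :: "complex \<Rightarrow> nat \<Rightarrow> complex \<Rightarrow> complex" where
  "bigH t b x = (\<Sum>k\<le>b. qpoch (t * x) q k * x powi (int (b - k) - int k) / (qpoch q q (b - k) * qpoch q q k))"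

lemma ker_add:
  assumes "q \<noteq> 0" "t \<noteq> 0"
  shows "ker t (a + b) = ker t a * ker t b * q powi (a * b)"
  using assms by (simp add: ker_def tri_add power_int_add)

lemma ker_of_nat: "ker t (int j) = (-t) ^ j * q ^ (j choose 2)"
  by (simp add: ker_def tri_of_nat)

text \<open>Each factor 1 - y q^(-k) equals -y q^(-k) (1 - q^k / y), and the exponents k = 1, ..., m
  add up to m(m+1)/2, which is \<open>tri (- int m)\<close>.\<close>

lemma qpoch_reverse:
  assumes "q \<noteq> 0" "y \<noteq> 0"
  shows "qpoch (y * q powi (- int m)) q m = (-y) ^ m * q powi (- tri (- int m)) * qpoch (q / y) q m"
proof (induction m)
  case (Suc m)
  have e: "q powi (- int (Suc m)) * q = q powi (- int m)"
    using assms power_int_add_1[of q "- int (Suc m)"] by simp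
  have e': "q powi (- int (Suc m)) * (q * q ^ m) = 1"
    using assms by (simp add: power_int_minus field_simps del: of_nat_Suc)
  have t: "tri (- int (Suc m)) = tri (- int m) + int (Suc m)"
    unfolding tri_minus using tri_add[of "int m" 1] by (simp add: add.commute)
  have e'': "q powi (- (tri (- int m) + int (Suc m))) = q powi (- tri (- int m)) * q powi (- int (Suc m))"
    unfolding minus_add_distrib by (rule power_int_add) (use assms in simp)
  have "qpoch (y * q powi (- int (Suc m))) q (Suc m)
      = (1 - y * q powi (- int (Suc m))) * qpoch (y * q powi (- int m)) q m"
    unfolding qpoch_Suc_left mult.assoc e ..
  also have "1 - y * q powi (- int (Suc m)) = - y * q powi (- int (Suc m)) * (1 - (q / y) * q ^ m)"
  proof -
    have "- y * Q * (1 - (q / y) * q ^ m) = Q * (q * q ^ m) - y * Q" for Q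
      using assms by (simp add: field_simps)
    then show ?thesis unfolding e' by (simp only: e')
  qed
  finally show ?case
    unfolding Suc.IH t qpoch_Suc e'' by (simp add: mult_ac)
qed simp

text \<open>The eigenvalue equation behind the fermionic sum: \<open>ker t (a - b)\<close> is the transfer matrix, and
  \<open>(q)\<^sub>b bigH t b x\<close> is the continuous big \<open>q\<close>-Hermite polynomial in \<open>x + 1/x\<close>.\<close>

lemma bigH_transfer:
  assumes q: "q \<noteq> 0" and x: "x \<noteq> 0" and tt: "t * t' = q"
  shows "((\<lambda>a. ker t (int a - int b) * bigH t a x) has_sum
     qpoch_inf (t * x) q * qpoch_inf (t / x) q * (qpoch q q b * bigH t' b x)) UNIV"
proof -
  have t: "t \<noteq> 0" and t': "t' = q / t" using tt q by auto
  define U where "U k = ker t (int k - int b) * qpoch (t * x) q k * x powi (- int k) / qpoch q q k" for k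
  define z where "z k = t * x * q powi (int k - int b)" for k :: nat
  define G where "G = (\<lambda>(k, j). U k * ((- z k) ^ j * q ^ (j choose 2) / qpoch q q j))"
  define W where "W i = ker t (- int b) * (- (t * x)) ^ i * q powi (- int i * int b)" for i
  define y where "y i = t / x * q powi (int i - int b)" for i :: nat
  have kerU: "ker t (int k - int b) = ker t (- int b) * ((-t) ^ k * q ^ (k choose 2)) * q powi (- int b * int k)" for k
    using ker_add[OF q t, of "- int b" "int k"] by (simp add: ker_of_nat)
  have G_eq: "G (k, j) = ker t (int (j + k) - int b) *
      (qpoch (t * x) q k * x powi (int j - int k) / (qpoch q q j * qpoch q q k))" for k j
  proof -
    have "ker t (int (j + k) - int b) = ker t (int k - int b) * ((-t) ^ j * q ^ (j choose 2)) * q powi ((int k - int b) * int j)"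
      using ker_add[OF q t, of "int k - int b" "int j"] by (simp add: ker_of_nat algebra_simps)
    moreover have "(- z k) ^ j = (-t) ^ j * x ^ j * q powi ((int k - int b) * int j)"
    proof -
      have "- z k = (-t) * x * q powi (int k - int b)" by (simp add: z_def)
      then show ?thesis by (simp only: power_mult_distrib power_int_power')
    qed
    ultimately show ?thesis
      using x by (simp add: G_def U_def power_int_diff power_int_minus field_simps)
  qed
  obtain B where B: "B > 0" "\<And>a m. norm a \<le> norm (t * x) \<Longrightarrow> norm (qpoch a q m) \<le> B"
    using qpoch_bounded by metis
  have U_le: "norm (U k) \<le> norm (ker t (- int b)) * B * norm ((t / x * q powi (- int b)) ^ k * q ^ (k choose 2) / qpoch q q k)" for k
  proof -
    have "U k = ker t (- int b) * qpoch (t * x) q k *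
       ((- (t / x * q powi (- int b))) ^ k * q ^ (k choose 2) / qpoch q q k)"
    proof -
      have "(- (t / x * q powi (- int b))) ^ k = ((-t) * (1 / x) * q powi (- int b)) ^ k" by simp
      also have "\<dots> = (-t) ^ k * x powi (- int k) * q powi (- int b * int k)"
        by (simp only: power_mult_distrib power_int_power') (simp add: power_int_minus power_one_over divide_inverse power_inverse)
      finally show ?thesis by (simp add: U_def kerU)
    qed
    then have "norm (U k) = norm (ker t (- int b)) * norm (qpoch (t * x) q k) *
       norm ((t / x * q powi (- int b)) ^ k * q ^ (k choose 2) / qpoch q q k)"
      by (simp add: norm_mult norm_divide norm_power)
    also have "\<dots> \<le> norm (ker t (- int b)) * B * norm ((t / x * q powi (- int b)) ^ k * q ^ (k choose 2) / qpoch q q k)"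
      by (intro mult_right_mono mult_left_mono B) auto
    finally show ?thesis .
  qed
  have U_summ: "(\<lambda>k. norm (U k)) summable_on UNIV"
    by (rule summable_on_comparison_test[OF summable_on_cmult_right[OF euler_abs_summable] U_le]) simp
  have "(\<lambda>p. norm (G p)) summable_on UNIV \<times> UNIV"
  proof (rule summable_on_comparison_test[OF abs_summable_on_times[OF U_summ
          euler_abs_summable[of "t * x * q powi (- int b)"]]])
    fix p :: "nat \<times> nat"
    obtain k j where p: "p = (k, j)" by (cases p)
    have "norm (z k) \<le> norm (t * x * q powi (- int b))"
    proof -
      have "z k = t * x * q powi (- int b) * q ^ k"
        using q by (simp add: z_def power_int_diff power_int_minus field_simps)
      moreover have "norm q ^ k \<le> 1" using norm_q by (intro power_le_one) auto
      ultimately show ?thesis by (simp add: norm_mult norm_power mult_left_le)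
    qed
    then have "norm (z k) ^ j \<le> norm (t * x * q powi (- int b)) ^ j"
      by (intro power_mono) auto
    then show "norm (G p) \<le> norm (case p of (i, j) \<Rightarrow>
        U i * ((t * x * q powi (- int b)) ^ j * q ^ (j choose 2) / qpoch q q j))"
      unfolding p G_def prod.case norm_mult norm_divide norm_power norm_minus_cancel
      by (intro mult_left_mono divide_right_mono mult_right_mono) (auto simp: norm_mult)
  qed auto
  then have G_summ: "G summable_on UNIV \<times> UNIV"
    by (rule abs_summable_summable)
  \<comment> \<open>With a = j + k, the sum over \<open>j\<close> at fixed \<open>k\<close> is
    Euler's series for \<open>qpoch_inf (z k) q\<close>. Splitting off the first \<open>b\<close>
    factors leaves \<open>qpoch_inf (t * x * q ^ k) q\<close>, which combines with
    \<open>qpoch (t * x) q k\<close> from \<open>U k\<close> to a product independent of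
    \<open>k\<close>. The \<open>b\<close> factors are expanded by the q-binomial theorem, and the
    sum over \<open>k\<close> becomes an Euler series again.\<close>
  define V where "V k = U k * qpoch_inf (z k) q" for k
  have G_V: "((\<lambda>j. G (k, j)) has_sum V k) UNIV" for k
    unfolding G_def V_def prod.case by (intro has_sum_cmult_right euler)
  define c where "c i = qpoch_inf (t * x) q * qpoch q q b * W i * q ^ (i choose 2) / (qpoch q q i * qpoch q q (b - i))" for i
  have V_eq: "V k = (\<Sum>i\<le>b. c i * ((- y i) ^ k * q ^ (k choose 2) / qpoch q q k))" for k
  proof -
    have "qpoch_inf (z k) q = qpoch (z k) q b * qpoch_inf (t * x * q ^ k) q"
      using qpoch_inf_split[of "z k" b] q by (simp add: z_def power_int_diff field_simps)
    then have "V k = qpoch_inf (t * x) q * (ker t (int k - int b) * x powi (- int k) / qpoch q q k) * qpoch (z k) q b"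
      unfolding V_def U_def qpoch_inf_split[of "t * x" k] by simp
    also have "qpoch (z k) q b = qpoch q q b * (\<Sum>i\<le>b. (- z k) ^ i * q ^ (i choose 2) / (qpoch q q i * qpoch q q (b - i)))"
      by (subst q_binomial) simp
    also have "qpoch_inf (t * x) q * (ker t (int k - int b) * x powi (- int k) / qpoch q q k) * \<dots> =
      (\<Sum>i\<le>b. qpoch_inf (t * x) q * qpoch q q b * q ^ (i choose 2) / (qpoch q q i * qpoch q q (b - i)) *
        (ker t (int k - int b) * x powi (- int k) * (- z k) ^ i / qpoch q q k))"
      unfolding sum_distrib_left by (intro sum.cong) (simp_all add: mult_ac)
    also have "\<dots> = (\<Sum>i\<le>b. c i * ((- y i) ^ k * q ^ (k choose 2) / qpoch q q k))"
    proof (rule sum.cong[OF refl])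
      fix i
      have "(- z k) ^ i = ((- (t * x)) * q powi (int k - int b)) ^ i" by (simp add: z_def)
      also have "\<dots> = (- (t * x)) ^ i * (q powi (int k * int i) * q powi (- int i * int b))"
        using q by (simp only: power_mult_distrib power_int_power')
          (simp add: power_int_add[symmetric] algebra_simps)
      finally have z: "(- z k) ^ i = (- (t * x)) ^ i * (q powi (int k * int i) * q powi (- int i * int b))" .
      have "(- y i) ^ k = ((-t) * (1 / x) * q powi (int i - int b)) ^ k" by (simp add: y_def)
      also have "\<dots> = (-t) ^ k * x powi (- int k) * (q powi (int k * int i) * q powi (- int b * int k))"
        using q by (simp only: power_mult_distrib power_int_power')
          (simp add: power_int_add[symmetric] power_int_diff power_int_minus field_simps)
      finally have y: "(- y i) ^ k = (-t) ^ k * x powi (- int k) * (q powi (int k * int i) * q powi (- int b * int k))" .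
      show "qpoch_inf (t * x) q * qpoch q q b * q ^ (i choose 2) / (qpoch q q i * qpoch q q (b - i)) *
        (ker t (int k - int b) * x powi (- int k) * (- z k) ^ i / qpoch q q k)
        = c i * ((- y i) ^ k * q ^ (k choose 2) / qpoch q q k)"
        unfolding z y c_def W_def kerU by simp
    qed
    finally show ?thesis .
  qed
  have "((\<lambda>k. V k) has_sum (\<Sum>i\<le>b. c i * qpoch_inf (y i) q)) UNIV"
    unfolding V_eq by (intro has_sum_sum has_sum_cmult_right euler)
  also have "(\<Sum>i\<le>b. c i * qpoch_inf (y i) q)
      = qpoch_inf (t * x) q * qpoch_inf (t / x) q * (qpoch q q b * bigH t' b x)"
  proof -
    \<comment> \<open>The first m = b - i factors of \<open>qpoch_inf (y i) q\<close> are reversed;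
      since q x / t = t' x, they become the factors of the polynomial with the exchanged
      parameter.\<close>
    have "c (b - m) * qpoch_inf (y (b - m)) q = qpoch_inf (t * x) q * qpoch_inf (t / x) q * (qpoch q q b *
       (qpoch (t' * x) q m * x powi (int (b - m) - int m) / (qpoch q q (b - m) * qpoch q q m)))"
      if m: "m \<le> b" for m
    proof -
      define i where "i = b - m"
      have b: "int b = int i + int m" "b - i = m" using m by (auto simp: i_def)
      have "qpoch_inf (y i) q = qpoch (t / x * q powi (- int m)) q m * qpoch_inf (t / x) q"
        using qpoch_inf_split[of "y i" m] q by (simp add: y_def b power_int_minus field_simps)
      also have "qpoch (t / x * q powi (- int m)) q m = (- (t / x)) ^ m * q powi (- tri (- int m)) * qpoch (t' * x) q m"
        using qpoch_reverse[OF q, of "t / x" m] t x by (simp add: t' mult_ac)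
      finally have y: "qpoch_inf (y i) q = (- (t / x)) ^ m * q powi (- tri (- int m)) * qpoch (t' * x) q m * qpoch_inf (t / x) q" .
      have "tri (- int b) + int (i choose 2) + (- int i * int b) - tri (- int m) = 0"
      proof -
        have "tri (- int b) = tri (- int i) + tri (- int m) + int i * int m"
          using tri_add[of "- int i" "- int m"] by (simp add: b)
        then show ?thesis
          using two_tri[of "int i"] by (simp add: b tri_minus tri_of_nat[symmetric] algebra_simps)
      qed
      then have "q powi tri (- int b) * q ^ (i choose 2) * q powi (- int i * int b) * q powi (- tri (- int m)) = 1" (is "?A = 1")
        using q by (simp only: power_int_of_nat[symmetric] power_int_add[symmetric] simp_thms) simp
      moreover have "(-t) powi (- int b) * (- (t * x)) ^ i * (- (t / x)) ^ m = x powi (int i - int m)" (is "?B = _")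
      proof -
        have "(- (t * x)) ^ i = (-t) ^ i * x ^ i" "(- (t / x)) ^ m = (-t) ^ m / x ^ m"
          by (metis mult_minus_left power_mult_distrib, metis minus_divide_left power_divide)
        then show ?thesis
          using t x by (simp add: b power_int_diff power_int_minus power_int_add field_simps)
      qed
      moreover have "W i * q ^ (i choose 2) * ((- (t / x)) ^ m * q powi (- tri (- int m))) = ?A * ?B"
        unfolding W_def ker_def by (simp only: mult_ac)
      ultimately have W: "W i * q ^ (i choose 2) * ((- (t / x)) ^ m * q powi (- tri (- int m))) = x powi (int i - int m)"
        by simp
      have "c i * qpoch_inf (y i) q = (W i * q ^ (i choose 2) * ((- (t / x)) ^ m * q powi (- tri (- int m)))) *
        (qpoch_inf (t * x) q * qpoch q q b * qpoch (t' * x) q m * qpoch_inf (t / x) q) / (qpoch q q i * qpoch q q m)"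
        unfolding c_def y b by (simp add: mult_ac)
      then show ?thesis
        unfolding W i_def[symmetric] by simp
    qed
    moreover have "(\<Sum>i\<le>b. c i * qpoch_inf (y i) q) = (\<Sum>m\<le>b. c (b - m) * qpoch_inf (y (b - m)) q)"
      by (rule sum.reindex_bij_witness[of _ "\<lambda>m. b - m" "\<lambda>m. b - m"]) auto
    ultimately show ?thesis
      by (simp add: bigH_def sum_distrib_left)
  qed
  finally have V_sum: "(V has_sum qpoch_inf (t * x) q * qpoch_inf (t / x) q * (qpoch q q b * bigH t' b x)) UNIV"
    (is "(_ has_sum ?R) _") .
  have "(G has_sum ?R) (UNIV \<times> UNIV)"
    by (rule has_sum_SigmaI[OF G_V V_sum G_summ])
  also have "?this \<longleftrightarrow> ((\<lambda>(a, k). G (k, a - k)) has_sum ?R) (SIGMA a:UNIV. {..a})"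
    by (rule has_sum_reindex_bij_witness[of _ "\<lambda>(a, k). (k, a - k)" "\<lambda>(k, j). (j + k, k)"]) auto
  finally have "((\<lambda>(a, k). G (k, a - k)) has_sum ?R) (SIGMA a:UNIV. {..a})" .
  then have "((\<lambda>a. \<Sum>k\<le>a. G (k, a - k)) has_sum ?R) UNIV"
    by (rule has_sum_SigmaD) (auto intro: has_sum_finite)
  also have "(\<lambda>a. \<Sum>k\<le>a. G (k, a - k)) = (\<lambda>a. ker t (int a - int b) * bigH t a x)"
    unfolding bigH_def sum_distrib_left G_eq by (intro ext sum.cong) auto
  finally show ?thesis .
qed

end

lemma laurent_sum:
  assumes "\<And>i. i \<in> I \<Longrightarrow> laurent (f i) (c i)"
  shows "laurent (\<lambda>x. \<Sum>i\<in>I. f i x) (\<lambda>k. \<Sum>i\<in>I. c i k)"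
  unfolding laurent_def sum_distrib_right
  by (intro allI impI has_sum_sum laurentD[OF assms])

section \<open>Absolute convergence of sums over chains\<close>

lemma summable_on_int_abs:
  fixes g :: "nat \<Rightarrow> real"
  assumes "summable g" "\<And>k. g k \<ge> 0"
  shows "(\<lambda>k::int. g (nat \<bar>k\<bar>)) summable_on UNIV"
proof -
  have "g summable_on UNIV"
    using assms by (simp add: summable_on_UNIV_nonneg_real_iff)
  then have "(\<lambda>k::int. g (nat \<bar>k\<bar>)) summable_on {0..}"
    by (rule summable_on_reindex_bij_witness[THEN iffD1, rotated -1, of _ UNIV nat int]) auto
  moreover from this have "(\<lambda>k::int. g (nat \<bar>k\<bar>)) summable_on {..0}"
    by (rule summable_on_reindex_bij_witness[THEN iffD1, rotated -1, of _ _ uminus uminus]) auto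
  ultimately have "(\<lambda>k::int. g (nat \<bar>k\<bar>)) summable_on ({0..} \<union> {..0})"
    by (rule summable_on_union)
  also have "{0..} \<union> {..0} = (UNIV :: int set)" by auto
  finally show ?thesis .
qed

lemma summable_on_power_abs_int:
  fixes s :: real
  assumes "0 \<le> s" "s < 1"
  shows "(\<lambda>k::int. s ^ nat \<bar>k\<bar>) summable_on UNIV"
  by (rule summable_on_int_abs) (use assms in \<open>auto intro: summable_geometric\<close>)

text \<open>Elements of \<open>nat_vectors r\<close> are \<open>undefined\<close> at 0;
  \<open>entry\<close> supplies the boundary value m_0 = 0, so the first link of a chain is no
  special case.\<close>

definition entry :: "(nat \<Rightarrow> nat) \<Rightarrow> nat \<Rightarrow> int" where
  "entry m i = (if i = 0 then 0 else int (m i))"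

lemma entry_upd: "entry (m(k := a)) i = (if i = k \<and> k > 0 then int a else entry m i)"
  by (simp add: entry_def)

lemma nat_vectors_Suc_bij:
  "bij_betw (\<lambda>(m, a). m(Suc r := a)) (nat_vectors r \<times> UNIV) (nat_vectors (Suc r))"
  by (rule bij_betwI[of _ _ _ "\<lambda>m. (m(Suc r := undefined), m (Suc r))"])
     (auto simp: nat_vectors_def PiE_def extensional_def fun_eq_iff Pi_def)

text \<open>Summation over the last coordinate costs at most the constant \<open>C\<close>, wherever
  the previous coordinate lies. Fixing the left end at 0 is enough for convergence.\<close>

lemma chain_abs_summable:
  fixes s :: real
  assumes "0 \<le> s" "s < 1"
  shows "(\<lambda>m. \<Prod>i<r. s ^ nat \<bar>entry m i - entry m (Suc i)\<bar>) summable_on nat_vectors r"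
proof (induction r)
  case 0
  have "finite (nat_vectors 0)" by (simp add: nat_vectors_def)
  then show ?case by (rule summable_on_finite)
next
  case (Suc r)
  define C where "C = (\<Sum>\<^sub>\<infinity>k::int. s ^ nat \<bar>k\<bar>)"
  define w where "w m = (\<Prod>i<r. s ^ nat \<bar>entry m i - entry m (Suc i)\<bar>)" for m
  define f where "f = (\<lambda>(m, a::nat). w m * s ^ nat \<bar>entry m r - int a\<bar>)"
  have w: "w m \<ge> 0" for m using assms by (simp add: w_def prod_nonneg)
  have inj: "inj (\<lambda>a::nat. e - int a)" for e by (auto simp: inj_def)
  have inner: "(\<lambda>a::nat. s ^ nat \<bar>e - int a\<bar>) summable_on UNIV"
    and inner_le: "(\<Sum>\<^sub>\<infinity>a::nat. s ^ nat \<bar>e - int a\<bar>) \<le> C" for e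
  proof -
    have sub: "(\<lambda>k::int. s ^ nat \<bar>k\<bar>) summable_on range (\<lambda>a::nat. e - int a)"
      using summable_on_power_abs_int[OF assms] by (rule summable_on_subset_banach) auto
    then show "(\<lambda>a::nat. s ^ nat \<bar>e - int a\<bar>) summable_on UNIV"
      by (simp add: summable_on_reindex[OF inj] o_def)
    have "(\<Sum>\<^sub>\<infinity>a::nat. s ^ nat \<bar>e - int a\<bar>) = (\<Sum>\<^sub>\<infinity>k\<in>range (\<lambda>a::nat. e - int a). s ^ nat \<bar>k\<bar>)"
      by (simp add: infsum_reindex[OF inj] o_def)
    also have "\<dots> \<le> C"
      unfolding C_def
      by (rule infsum_mono_neutral[OF sub summable_on_power_abs_int[OF assms]]) (use assms in auto)
    finally show "(\<Sum>\<^sub>\<infinity>a::nat. s ^ nat \<bar>e - int a\<bar>) \<le> C" .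
  qed
  have "(\<lambda>p. norm (f p)) summable_on nat_vectors r \<times> UNIV"
    unfolding Infinite_Sum.abs_summable_on_Sigma_iff
  proof (intro conjI ballI)
    show "(\<lambda>a. norm (f (m, a))) summable_on UNIV" for m
      using summable_on_cmult_right[OF inner, of "w m"] w assms by (simp add: f_def abs_mult)
    have "(\<Sum>\<^sub>\<infinity>a. norm (f (m, a))) = w m * (\<Sum>\<^sub>\<infinity>a::nat. s ^ nat \<bar>entry m r - int a\<bar>)" for m
      using w assms by (simp add: f_def abs_mult infsum_cmult_right')
    then have "norm (\<Sum>\<^sub>\<infinity>a. norm (f (m, a))) \<le> w m * C" for m
      using inner_le w assms by (simp add: abs_mult infsum_nonneg mult_left_mono)
    then show "(\<lambda>m. norm (\<Sum>\<^sub>\<infinity>a. norm (f (m, a)))) summable_on nat_vectors r"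
      by (rule summable_on_comparison_test[OF summable_on_cmult_left[OF Suc.IH[folded w_def]]]) auto
  qed
  then have "f summable_on nat_vectors r \<times> UNIV"
    by (rule abs_summable_summable)
  also have "?this \<longleftrightarrow> (\<lambda>p. (\<lambda>m. \<Prod>i<Suc r. s ^ nat \<bar>entry m i - entry m (Suc i)\<bar>)
      ((\<lambda>(m, a). m(Suc r := a)) p)) summable_on nat_vectors r \<times> UNIV"
    by (intro summable_on_cong)
       (auto simp: f_def w_def entry_upd intro!: prod.cong)
  also have "\<dots> \<longleftrightarrow> ?case"
    by (rule summable_on_reindex_bij_betw[OF nat_vectors_Suc_bij])
  finally show ?case .
qed

section \<open>The orthogonality weight and its constant terms\<close>

context qdisc
begin

text \<open>This is (q)_inf (x^2)_inf (x^-2)_inf / (1 - x^2). As 1/(1 - x^2) + 1/(1 - x^-2) = 1, on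
  functions invariant under x -> 1/x it has the same constant terms as half of (q)_inf (x^2)_inf
  (x^-2)_inf, the weight of the continuous q-Hermite polynomials. In this form its Laurent
  coefficients are explicit.\<close>

definition weight_u :: "complex \<Rightarrow> complex" where
  "weight_u x = theta (1 / x\<^sup>2)"

text \<open>The eigenvalue in \<open>bigH_transfer\<close>.\<close>

definition lam :: "complex \<Rightarrow> complex \<Rightarrow> complex" where
  "lam t x = qpoch_inf (t * x) q * qpoch_inf (t / x) q"

text \<open>The parameter of link \<open>i\<close>. Each use of \<open>bigH_transfer\<close>
  exchanges \<open>t\<close> and \<open>q / t\<close>; link 0 carries \<open>q / t\<close> because
  it is the reversal of a link with parameter \<open>t\<close>, see
  \<open>ker_uminus\<close>.\<close>

definition alternate :: "complex \<Rightarrow> nat \<Rightarrow> complex" where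
  "alternate t i = (if odd i then t else q / t)"

definition chain_weight :: "complex \<Rightarrow> nat \<Rightarrow> (nat \<Rightarrow> nat) \<Rightarrow> complex" where
  "chain_weight t r m = (\<Prod>i<r. ker (alternate t i) (entry m i - entry m (Suc i)) / qpoch q q (m (Suc i)))"

lemma laurent_weight_u:
  assumes "q \<noteq> 0"
  shows "laurent weight_u (\<lambda>k. if even k then (-1) powi (- k div 2) * q powi tri (- k div 2) else 0)"
proof -
  have "laurent (\<lambda>x. theta ((1 / x)\<^sup>2))
     (\<lambda>k. if even (- k) then (-1) powi (- k div 2) * q powi tri (- k div 2) else 0)"
    by (rule laurent_inverse[OF laurent_square[OF laurent_theta[OF assms]]])
  then show ?thesis by (simp add: weight_u_def[abs_def] power_one_over)
qed

lemma laurent_lam: "\<exists>c. laurent (lam t) c"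
proof -
  have "laurent (\<lambda>x. qpoch_inf (t / x) q)
     (\<lambda>k. if - k < 0 then 0 else (- t) ^ nat (- k) * q ^ (nat (- k) choose 2) / qpoch q q (nat (- k)))"
    using laurent_inverse[OF laurent_qpoch_inf[of t]] by simp
  from laurent_mult(1)[OF laurent_qpoch_inf[of t] this]
  show ?thesis unfolding lam_def[abs_def] by blast
qed

text \<open>Orthogonality to 1 of the continuous q-Hermite polynomials, written as Rogers-Szego sums
  divided by (q)_M. For odd \<open>M\<close> parity suffices. For M = 2m the q-binomial theorem sums
  the constant term to a multiple of (z)_(2m) with z = q^(1-m), which contains the factor 1 - z
  q^(m-1) = 0 when m > 0.\<close>

lemma weight_u_rogers_szego:
  assumes q: "q \<noteq> 0"
  defines "R \<equiv> (\<lambda>M x. \<Sum>p\<le>M. 1 / (qpoch q q p * qpoch q q (M - p)) * (x powi (int M - 2 * int p) * weight_u x))"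
  shows "\<exists>c. laurent (R M) c \<and> c 0 = (if M = 0 then 1 else 0)"
proof -
  define uc where "uc k = (if even k then (-1) powi (- k div 2) * q powi tri (- k div 2) else 0)" for k :: int
  define c where "c k = (\<Sum>p\<le>M. 1 / (qpoch q q p * qpoch q q (M - p)) * uc (k - (int M - 2 * int p)))" for k
  have L: "laurent weight_u uc"
    using laurent_weight_u[OF q] by (simp add: uc_def[abs_def])
  have "laurent (R M) c"
    unfolding R_def c_def by (intro laurent_sum laurent_cmult laurent_shift[OF L])
  moreover have "c 0 = (if M = 0 then 1 else 0)"
  proof (cases "even M")
    case False
    then have "M \<noteq> 0" by (metis even_zero)
    then show ?thesis using False by (auto simp: c_def uc_def)
  next
    case True
    then obtain m where M: "M = 2 * m" by (rule evenE)
    define A where "A = (-1) powi int m * q powi tri (int m)"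
    define z where "z = q powi (1 - int m)"
    have "uc (0 - (int M - 2 * int p)) = A * ((- z) ^ p * q ^ (p choose 2))" for p
    proof -
      have d: "(- (0 - (int M - 2 * int p))) div 2 = int m + (- int p)"
        by (simp add: M)
      have t: "tri (int m + (- int p)) = tri (int m) + tri (int p) + (1 - int m) * int p"
        unfolding tri_add tri_minus by (simp add: algebra_simps)
      have s: "(-1 :: complex) powi (int m + (- int p)) = (-1) powi int m * (-1) ^ p"
        by (cases "even p") (simp_all add: power_int_diff)
      have "(- z) ^ p = (-1) ^ p * q powi ((1 - int m) * int p)"
        unfolding z_def power_minus[of "q powi (1 - int m)"] power_int_power' ..
      then show ?thesis
        unfolding uc_def d t s A_def using q by (simp add: M power_int_add tri_of_nat)
    qed
    then have "c 0 = A * (\<Sum>p\<le>M. (- z) ^ p * q ^ (p choose 2) / (qpoch q q p * qpoch q q (M - p)))"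
      unfolding c_def sum_distrib_left by (intro sum.cong) simp_all
    also have "\<dots> = A * (qpoch z q M / qpoch q q M)"
      by (simp only: q_binomial)
    also have "\<dots> = (if M = 0 then 1 else 0)"
    proof (cases "m = 0")
      case True
      then show ?thesis by (simp add: A_def M)
    next
      case False
      have "z * q ^ (m - 1) = 1"
        using False q unfolding z_def power_int_of_nat[symmetric]
        by (subst power_int_add[symmetric]) (auto simp: of_nat_diff)
      then have "qpoch z q M = 0"
        unfolding qpoch_lessThan using False by (intro prod_zero bexI[of _ "m - 1"]) (auto simp: M)
      then show ?thesis using False by (simp add: M)
    qed
    finally show ?thesis .
  qed
  ultimately show ?thesis by blast
qed

text \<open>Expanding \<open>qpoch (t * x) q k\<close> by the q-binomial theorem writes
  \<open>bigH t b\<close> as a combination of q-Hermite polynomials of degrees b - i; by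
  orthogonality only i = b contributes.\<close>

lemma CT_weight_bigH:
  assumes q: "q \<noteq> 0"
  shows "CT (\<lambda>x. weight_u x * (qpoch q q b * bigH t b x)) = ker t (int b)"
proof -
  define R where "R M x = (\<Sum>p\<le>M. 1 / (qpoch q q p * qpoch q q (M - p)) * (x powi (int M - 2 * int p) * weight_u x))" for M x
  have "\<forall>M. \<exists>c. laurent (R M) c \<and> c 0 = (if M = 0 then 1 else 0)"
    unfolding R_def using weight_u_rogers_szego[OF q] by (rule allI)
  then obtain c where c: "\<And>M. laurent (R M) (c M)" "\<And>M. c M 0 = (if M = 0 then 1 else 0)"
    by (auto dest!: choice)
  define e where "e i = qpoch q q b * ((-t) ^ i * q ^ (i choose 2) / qpoch q q i)" for i
  have expand: "weight_u x * (qpoch q q b * bigH t b x) = (\<Sum>i\<le>b. e i * R (b - i) x)" if x: "x \<noteq> 0" for x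
  proof -
    define T where "T i p = (-t) ^ i * q ^ (i choose 2) / qpoch q q i *
        (1 / (qpoch q q p * qpoch q q (b - i - p)) * x powi (int (b - i) - 2 * int p))" for i p
    have "bigH t b x = (\<Sum>k\<le>b. \<Sum>i\<le>k. T i (k - i))"
      unfolding bigH_def
    proof (rule sum.cong[OF refl])
      fix k assume k: "k \<in> {..b}"
      have "qpoch (t * x) q k * x powi (int (b - k) - int k) / (qpoch q q (b - k) * qpoch q q k)
        = x powi (int (b - k) - int k) / qpoch q q (b - k) * (qpoch (t * x) q k / qpoch q q k)" by simp
      also have "\<dots> = (\<Sum>i\<le>k. x powi (int (b - k) - int k) / qpoch q q (b - k) *
         ((- (t * x)) ^ i * q ^ (i choose 2) / (qpoch q q i * qpoch q q (k - i))))"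
        unfolding q_binomial[symmetric] sum_distrib_left ..
      also have "\<dots> = (\<Sum>i\<le>k. T i (k - i))"
      proof (rule sum.cong[OF refl])
        fix i assume i: "i \<in> {..k}"
        have e1: "int (b - i) - 2 * int (k - i) = (int (b - k) - int k) + int i" and e2: "b - i - (k - i) = b - k"
          using i k by auto
        have e3: "(- (t * x)) ^ i = (-t) ^ i * x ^ i"
          using power_mult_distrib[of "-t" x i] by simp
        show "x powi (int (b - k) - int k) / qpoch q q (b - k) *
         ((- (t * x)) ^ i * q ^ (i choose 2) / (qpoch q q i * qpoch q q (k - i))) = T i (k - i)"
          unfolding T_def e1 e2 e3 power_int_add[OF disjI1[OF x]] by (simp add: mult_ac)
      qed
      finally show "qpoch (t * x) q k * x powi (int (b - k) - int k) / (qpoch q q (b - k) * qpoch q q k)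
        = (\<Sum>i\<le>k. T i (k - i))" .
    qed
    also have "\<dots> = (\<Sum>(k, i)\<in>(SIGMA k:{..b}. {..k}). T i (k - i))"
      by (simp add: sum.Sigma)
    also have "\<dots> = (\<Sum>(i, p)\<in>(SIGMA i:{..b}. {..b - i}). T i p)"
      by (rule sum.reindex_bij_witness[of _ "\<lambda>(i, p). (i + p, i)" "\<lambda>(k, i). (i, k - i)"])
         auto
    also have "\<dots> = (\<Sum>i\<le>b. \<Sum>p\<le>b - i. T i p)"
      by (simp add: sum.Sigma)
    finally have "weight_u x * (qpoch q q b * bigH t b x) = (\<Sum>i\<le>b. weight_u x * (qpoch q q b * (\<Sum>p\<le>b - i. T i p)))"
      by (simp only: sum_distrib_left)
    also have "\<dots> = (\<Sum>i\<le>b. e i * R (b - i) x)"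
      unfolding e_def R_def T_def sum_distrib_left by (intro sum.cong refl) (simp_all add: mult_ac)
    finally show ?thesis .
  qed
  have "laurent (\<lambda>x. \<Sum>i\<le>b. e i * R (b - i) x) (\<lambda>k. \<Sum>i\<le>b. e i * c (b - i) k)"
    by (intro laurent_sum laurent_cmult c)
  then have "laurent (\<lambda>x. weight_u x * (qpoch q q b * bigH t b x)) (\<lambda>k. \<Sum>i\<le>b. e i * c (b - i) k)"
    by (rule laurent_cong) (simp add: expand)
  from laurent_CT[OF this] have "CT (\<lambda>x. weight_u x * (qpoch q q b * bigH t b x)) = (\<Sum>i\<le>b. e i * c (b - i) 0)" .
  also have "\<dots> = (\<Sum>i\<in>{b}. e i * c (b - i) 0)"
    by (rule sum.mono_neutral_right) (auto simp: c)
  also have "\<dots> = ker t (int b)"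
    by (simp add: c e_def ker_of_nat)
  finally show ?thesis .
qed

end

section \<open>Chains of transfer matrices with alternating parameters\<close>

lemma CT_cmult: "CT (\<lambda>x. c * f x) = c * CT f"
  unfolding CT_def by (rule integral_mult_right)

text \<open>The closed annulus is invariant under t -> q / t, and on it the kernel decays in both
  directions. Its boundary circles belong to it because the second sum uses \<open>t = q\<close>,
  which alternates with 1.\<close>

locale qdisc_pair = qdisc +
  fixes t :: complex
  assumes q_nonzero: "q \<noteq> 0" and norm_t_ge: "norm q \<le> norm t" and norm_t_le: "norm t \<le> 1"
begin

lemma t_nonzero: "t \<noteq> 0"
  using norm_t_ge q_nonzero by auto

lemma ker_uminus: "ker (q / t) (- d) = ker t d"
proof -
  have "(-t) powi d * (- (q / t)) powi d = q powi d"
    using t_nonzero by (simp flip: power_int_mult_distrib)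
  then have "(- (q / t)) powi (- d) = (-t) powi d * q powi (- d)"
    using q_nonzero t_nonzero by (simp add: power_int_minus field_simps)
  then show ?thesis
    using q_nonzero by (simp add: ker_def tri_minus power_int_add power_int_minus)
qed

text \<open>For negative \<open>d\<close> the growth of |s|^d is at most that of |q|^d, which the
  Gaussian factor absorbs through \<open>tri d + d = tri (- d)\<close>.\<close>

lemma norm_ker_le_aux:
  assumes "norm q \<le> norm s" "norm s \<le> 1"
  shows "norm (ker s d) \<le> 1 / norm q * norm q ^ nat \<bar>d\<bar>"
proof -
  have s: "s \<noteq> 0" using assms q_nonzero by auto
  have le: "norm q powi j \<le> 1 / norm q * norm q ^ nat \<bar>d\<bar>" if "j \<ge> \<bar>d\<bar> - 1" for j
  proof -
    have "norm q powi j \<le> norm q powi (\<bar>d\<bar> - 1)"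
      using that norm_q q_nonzero by (intro power_int_decreasing) auto
    also have "\<dots> = norm q ^ nat \<bar>d\<bar> / norm q"
      using q_nonzero by (subst power_int_diff) (auto simp: power_int_nonneg_exp)
    finally show ?thesis by simp
  qed
  show ?thesis
  proof (cases "d \<ge> 0")
    case True
    have "norm (ker s d) = norm s powi d * norm q powi tri d"
      by (simp add: ker_def norm_mult norm_power_int)
    also have "\<dots> \<le> 1 * norm q powi tri d"
      using True assms by (intro mult_right_mono power_int_le_one) auto
    finally show ?thesis using le[OF tri_ge[of d]] by simp
  next
    case False
    have "norm (ker s d) = inverse (norm s powi (- d)) * norm q powi tri d"
      by (simp add: ker_def norm_mult norm_power_int power_int_minus)
    also have "\<dots> \<le> inverse (norm q powi (- d)) * norm q powi tri d"
      using False assms q_nonzero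
      by (intro mult_right_mono le_imp_inverse_le power_int_mono zero_less_power_int) auto
    also have "\<dots> = norm q powi tri (- d)"
      using q_nonzero by (simp add: tri_minus power_int_add power_int_minus)
    finally show ?thesis using le[of "tri (- d)"] tri_ge[of "- d"] by simp
  qed
qed

lemma norm_alternate:
  "norm q \<le> norm (alternate t i)" "norm (alternate t i) \<le> 1"
proof -
  have "norm t > 0" using t_nonzero by simp
  then have "norm q \<le> norm (q / t)" "norm (q / t) \<le> 1"
    using norm_t_ge norm_t_le by (simp_all add: norm_divide le_divide_eq mult_left_le divide_le_eq)
  then show "norm q \<le> norm (alternate t i)" "norm (alternate t i) \<le> 1"
    using norm_t_ge norm_t_le by (simp_all add: alternate_def)
qed

lemma alternate_mult: "alternate t i * alternate t (Suc i) = q"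
  using t_nonzero by (simp add: alternate_def)

lemma norm_ker_le: "norm (ker (alternate t i) d) \<le> 1 / norm q * norm q ^ nat \<bar>d\<bar>"
  using norm_ker_le_aux[OF norm_alternate(1)[of i] norm_alternate(2)[of i]] .

lemma norm_bigH_le: obtains C where "C > 0" "\<And>a s x. norm s \<le> 1 \<Longrightarrow> norm x = 1 \<Longrightarrow> norm (bigH s a x) \<le> C * real (Suc a)"
proof -
  obtain B where B: "B > 0" "\<And>m. norm (1 / qpoch q q m) \<le> B"
    using inverse_qfact_bounded by blast
  obtain B' where B': "B' > 0" "\<And>a m. norm a \<le> 1 \<Longrightarrow> norm (qpoch a q m) \<le> B'"
    using qpoch_bounded by blast
  have "norm (bigH s a x) \<le> (B' * (B * B)) * real (Suc a)" if "norm s \<le> 1" "norm x = 1" for a s x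
  proof -
    have "norm (bigH s a x) \<le> (\<Sum>k\<le>a. norm (qpoch (s * x) q k * x powi (int (a - k) - int k) / (qpoch q q (a - k) * qpoch q q k)))"
      unfolding bigH_def by (rule norm_sum)
    also have "\<dots> \<le> (\<Sum>k\<le>a. B' * (B * B))"
    proof (rule sum_mono)
      fix k
      have "norm (qpoch (s * x) q k * x powi (int (a - k) - int k) / (qpoch q q (a - k) * qpoch q q k))
        = norm (qpoch (s * x) q k) * (norm (1 / qpoch q q (a - k)) * norm (1 / qpoch q q k))"
        using that by (simp add: norm_mult norm_divide norm_power_int)
      also have "\<dots> \<le> B' * (B * B)"
        using that B(1) B'(1) by (intro mult_mono B B') (auto simp: norm_mult)
      finally show "norm (qpoch (s * x) q k * x powi (int (a - k) - int k) / (qpoch q q (a - k) * qpoch q q k)) \<le> B' * (B * B)" .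
    qed
    finally show ?thesis by (simp add: mult.commute)
  qed
  then show ?thesis using that[of "B' * (B * B)"] B B' by simp
qed

lemma continuous_bigH: "continuous_on (sphere 0 1) (bigH s a)"
proof -
  have "continuous_on (sphere 0 1) (\<lambda>x. qpoch (s * x) q k)" for k
    unfolding qpoch_def by (intro continuous_intros)
  then show ?thesis
    unfolding bigH_def[abs_def] by (intro continuous_intros) auto
qed

lemma chain_weight_abs_summable:
  "(\<lambda>m. norm (chain_weight t r m * ker (alternate t r) (entry m r - int b))) summable_on nat_vectors r"
proof -
  obtain B where B: "B > 0" "\<And>m. norm (1 / qpoch q q m) \<le> B"
    using inverse_qfact_bounded by blast
  define C where "C = B / norm q"
  have le: "norm (chain_weight t r m * ker (alternate t r) (entry m r - int b))
      \<le> (\<Prod>i<r. norm q ^ nat \<bar>entry m i - entry m (Suc i)\<bar>) * (C ^ r / norm q)" for m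
  proof -
    have "norm (chain_weight t r m)
      = (\<Prod>i<r. norm (ker (alternate t i) (entry m i - entry m (Suc i))) * norm (1 / qpoch q q (m (Suc i))))"
      by (simp add: chain_weight_def norm_mult norm_divide flip: prod_norm)
    also have "\<dots> \<le> (\<Prod>i<r. (1 / norm q * norm q ^ nat \<bar>entry m i - entry m (Suc i)\<bar>) * B)"
      by (intro prod_mono conjI mult_mono norm_ker_le B) auto
    also have "\<dots> = (\<Prod>i<r. norm q ^ nat \<bar>entry m i - entry m (Suc i)\<bar> * C)"
      by (intro prod.cong) (simp_all add: C_def)
    also have "\<dots> = (\<Prod>i<r. norm q ^ nat \<bar>entry m i - entry m (Suc i)\<bar>) * C ^ r"
      by (simp add: prod.distrib)
    finally have 1: "norm (chain_weight t r m) \<le> (\<Prod>i<r. norm q ^ nat \<bar>entry m i - entry m (Suc i)\<bar>) * C ^ r" .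
    have "norm (ker (alternate t r) (entry m r - int b)) \<le> 1 / norm q * norm q ^ nat \<bar>entry m r - int b\<bar>"
      by (rule norm_ker_le)
    also have "\<dots> \<le> 1 / norm q * 1"
      using norm_q by (intro mult_left_mono power_le_one) auto
    finally have 2: "norm (ker (alternate t r) (entry m r - int b)) \<le> 1 / norm q" by simp
    have "norm (chain_weight t r m) * norm (ker (alternate t r) (entry m r - int b))
      \<le> ((\<Prod>i<r. norm q ^ nat \<bar>entry m i - entry m (Suc i)\<bar>) * C ^ r) * (1 / norm q)"
      by (intro mult_mono 1 2) (auto intro!: mult_nonneg_nonneg prod_nonneg simp: C_def less_imp_le[OF B(1)])
    then show ?thesis by (simp add: norm_mult)
  qed
  show ?thesis
    by (rule summable_on_comparison_test[OF summable_on_cmult_left[OF chain_abs_summable] le]) (use norm_q in auto)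
qed

text \<open>The right end \<open>b\<close> stays free in the induction: as a function of
  \<open>b\<close>, the sum over the first \<open>r\<close> coordinates is the vector to which the
  next matrix is applied, and the eigenvalue equation does this under the integral. The parameter of
  \<open>bigH\<close> reached after \<open>r\<close> links is the one the next link acts on.\<close>

lemma chain_has_sum:
  "((\<lambda>m. chain_weight t r m * ker (alternate t r) (entry m r - int b)) has_sum
     CT (\<lambda>x. weight_u x * (\<Prod>i=1..r. lam (alternate t i) x) * (qpoch q q b * bigH (alternate t (Suc r)) b x)))
   (nat_vectors r)"
proof (induction r arbitrary: b)
  case 0
  have nv: "nat_vectors 0 = {\<lambda>_. undefined}" by (simp add: nat_vectors_def)
  have "ker (q / t) (- int b) = CT (\<lambda>x. weight_u x * (qpoch q q b * bigH t b x))"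
    by (simp add: ker_uminus CT_weight_bigH[OF q_nonzero])
  then show ?case
    unfolding nv by (intro has_sum_finiteI) (auto simp: chain_weight_def alternate_def entry_def)
next
  case (Suc r)
  define \<Phi> where "\<Phi> = (\<lambda>x. weight_u x * (\<Prod>i=1..r. lam (alternate t i) x))"
  define s where "s = alternate t (Suc r)"
  define s' where "s' = alternate t (Suc (Suc r))"
  have ss: "s * s' = q" unfolding s_def s'_def by (rule alternate_mult)
  have "\<exists>c. laurent (\<lambda>x. weight_u x * (\<Prod>i=1..k. lam (alternate t i) x)) c" for k
  proof (induction k)
    case (Suc k)
    then show ?case
      using laurent_lam[of "alternate t (Suc k)"] laurent_mult(1) by (force simp: mult.assoc[symmetric])
  qed (use laurent_weight_u[OF q_nonzero] in auto)
  then obtain c where \<Phi>: "laurent \<Phi> c" unfolding \<Phi>_def by blast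
  obtain B where B: "B > 0" "\<And>x. norm x = 1 \<Longrightarrow> norm (\<Phi> x) \<le> B"
    using laurent_bounded[OF \<Phi>] by blast
  obtain C where C: "C > 0" "\<And>a s x. norm s \<le> 1 \<Longrightarrow> norm x = 1 \<Longrightarrow> norm (bigH s a x) \<le> C * real (Suc a)"
    using norm_bigH_le by blast
  define k where "k a = ker s (int a - int b)" for a
  have norm_s: "norm s \<le> 1" unfolding s_def by (rule norm_alternate)
  \<comment> \<open>The majorant for \<open>CT_has_sum\<close>: a bounded weight, a geometrically
    small kernel, and a polynomial that grows only linearly with its degree on the unit
    circle.\<close>
  define M where "M a = B * (1 / norm q * norm q ^ nat \<bar>int a - int b\<bar>) * (C * real (Suc a))" for a
  have M: "M summable_on UNIV"
  proof -
    have "summable (\<lambda>a. real (Suc a) * norm q ^ a)"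
      using geometric_deriv_sums[of "norm q"] norm_q by (auto simp: sums_iff)
    then have "summable (\<lambda>a. (B * C / norm q / norm q ^ b) * (real (Suc a) * norm q ^ a))"
      by (rule summable_mult)
    then have "(\<lambda>a. (B * C / norm q / norm q ^ b) * (real (Suc a) * norm q ^ a)) summable_on UNIV"
      using B C by (subst summable_on_UNIV_nonneg_real_iff) (auto intro!: mult_nonneg_nonneg)
    moreover have "M a \<le> (B * C / norm q / norm q ^ b) * (real (Suc a) * norm q ^ a)" for a
    proof -
      have "norm q ^ nat \<bar>int a - int b\<bar> * norm q ^ b = norm q ^ (nat \<bar>int a - int b\<bar> + b)"
        by (simp add: power_add)
      also have "\<dots> \<le> norm q ^ a"
        using norm_q by (intro power_decreasing) auto
      finally have "norm q ^ nat \<bar>int a - int b\<bar> \<le> norm q ^ a / norm q ^ b"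
        using q_nonzero by (simp add: field_simps)
      then have "(B * C / norm q * real (Suc a)) * norm q ^ nat \<bar>int a - int b\<bar>
          \<le> (B * C / norm q * real (Suc a)) * (norm q ^ a / norm q ^ b)"
        using B C by (intro mult_left_mono) auto
      then show ?thesis by (simp add: M_def mult_ac)
    qed
    moreover have "M a \<ge> 0" for a using B C by (auto simp: M_def intro!: mult_nonneg_nonneg)
    ultimately show ?thesis by (rule summable_on_comparison_test)
  qed
  have "((\<lambda>a. CT (\<lambda>x. \<Phi> x * (k a * bigH s a x))) has_sum CT (\<lambda>x. \<Sum>\<^sub>\<infinity>a. \<Phi> x * (k a * bigH s a x))) UNIV"
  proof (rule CT_has_sum[OF _ _ M])
    fix a show "continuous_on (sphere 0 1) (\<lambda>x. \<Phi> x * (k a * bigH s a x))"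
      by (intro continuous_intros laurent_continuous[OF \<Phi>] continuous_bigH)
  next
    fix a and x :: complex assume x: "norm x = 1"
    have "norm (\<Phi> x * (k a * bigH s a x)) = norm (\<Phi> x) * norm (k a) * norm (bigH s a x)"
      by (simp add: norm_mult)
    also have "\<dots> \<le> M a"
      unfolding M_def k_def s_def using B C x norm_alternate
      by (intro mult_mono norm_ker_le) auto
    finally show "norm (\<Phi> x * (k a * bigH s a x)) \<le> M a" .
  qed
  also have "CT (\<lambda>x. \<Sum>\<^sub>\<infinity>a. \<Phi> x * (k a * bigH s a x)) = CT (\<lambda>x. \<Phi> x * lam s x * (qpoch q q b * bigH s' b x))"
  proof (rule CT_cong)
    fix x :: complex assume "norm x = 1"
    then have "x \<noteq> 0" by auto
    then have "((\<lambda>a. \<Phi> x * (k a * bigH s a x)) has_sum \<Phi> x * (lam s x * (qpoch q q b * bigH s' b x))) UNIV"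
      unfolding k_def lam_def by (intro has_sum_cmult_right bigH_transfer q_nonzero ss)
    then show "(\<Sum>\<^sub>\<infinity>a. \<Phi> x * (k a * bigH s a x)) = \<Phi> x * lam s x * (qpoch q q b * bigH s' b x)"
      by (simp add: infsumI mult.assoc)
  qed
  also have "(\<lambda>x. \<Phi> x * lam s x * (qpoch q q b * bigH s' b x))
      = (\<lambda>x. weight_u x * (\<Prod>i=1..Suc r. lam (alternate t i) x) * (qpoch q q b * bigH (alternate t (Suc (Suc r))) b x))"
    by (simp add: \<Phi>_def s_def s'_def mult_ac)
  finally have outer: "((\<lambda>a. CT (\<lambda>x. \<Phi> x * (k a * bigH s a x))) has_sum
     CT (\<lambda>x. weight_u x * (\<Prod>i=1..Suc r. lam (alternate t i) x) * (qpoch q q b * bigH (alternate t (Suc (Suc r))) b x))) UNIV" .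
  define g where "g = (\<lambda>m. chain_weight t (Suc r) m * ker (alternate t (Suc r)) (entry m (Suc r) - int b))"
  have g_upd: "g (m(Suc r := a)) = k a / qpoch q q a * (chain_weight t r m * ker (alternate t r) (entry m r - int a))" for m a
    by (simp add: g_def chain_weight_def entry_upd k_def s_def)
  have inner: "((\<lambda>m. g (m(Suc r := a))) has_sum CT (\<lambda>x. \<Phi> x * (k a * bigH s a x))) (nat_vectors r)" for a
  proof -
    have "CT (\<lambda>x. \<Phi> x * (k a * bigH s a x)) = k a / qpoch q q a * CT (\<lambda>x. \<Phi> x * (qpoch q q a * bigH s a x))"
      unfolding CT_cmult[symmetric] by (simp add: mult_ac)
    then show ?thesis
      unfolding g_upd \<Phi>_def s_def by (simp only:) (intro has_sum_cmult_right Suc.IH)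
  qed
  have "g summable_on nat_vectors (Suc r)"
    unfolding g_def by (rule abs_summable_summable[OF chain_weight_abs_summable])
  then have "(\<lambda>p. g ((\<lambda>(m, a). m(Suc r := a)) p)) summable_on nat_vectors r \<times> UNIV"
    by (subst summable_on_reindex_bij_betw[OF nat_vectors_Suc_bij])
  then have summ: "(\<lambda>(a, m). g (m(Suc r := a))) summable_on UNIV \<times> nat_vectors r"
    by (subst (asm) summable_on_swap) (simp add: case_prod_unfold)
  have "((\<lambda>(a, m). g (m(Suc r := a))) has_sum
     CT (\<lambda>x. weight_u x * (\<Prod>i=1..Suc r. lam (alternate t i) x) * (qpoch q q b * bigH (alternate t (Suc (Suc r))) b x)))
     (UNIV \<times> nat_vectors r)"
    by (rule has_sum_SigmaI[OF _ outer summ]) (simp add: inner)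
  then have "((\<lambda>p. g ((\<lambda>(m, a). m(Suc r := a)) p)) has_sum
     CT (\<lambda>x. weight_u x * (\<Prod>i=1..Suc r. lam (alternate t i) x) * (qpoch q q b * bigH (alternate t (Suc (Suc r))) b x)))
     (nat_vectors r \<times> UNIV)"
    by (subst (asm) has_sum_swap) (simp add: case_prod_unfold)
  then have "(g has_sum
     CT (\<lambda>x. weight_u x * (\<Prod>i=1..Suc r. lam (alternate t i) x) * (qpoch q q b * bigH (alternate t (Suc (Suc r))) b x)))
     (nat_vectors (Suc r))"
    by (subst (asm) has_sum_reindex_bij_betw[OF nat_vectors_Suc_bij])
  then show ?case unfolding g_def .
qed

end

section \<open>Fermionic sums as Laurent coefficients\<close>

lemma power_int_sum:
  fixes x :: "'a :: field"
  assumes "x \<noteq> 0"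
  shows "(\<Prod>i\<in>A. x powi f i) = x powi (\<Sum>i\<in>A. f i)"
  by (induction A rule: infinite_finite_induct) (auto simp: power_int_add assms)

text \<open>The case \<open>i = r\<close> encodes the right boundary value m_(r+1) = 0, whereas
  \<open>entry\<close> pads only the left end. The r + 1 steps therefore form a closed
  chain.\<close>

definition step :: "nat \<Rightarrow> (nat \<Rightarrow> nat) \<Rightarrow> nat \<Rightarrow> int" where
  "step r m i = entry m i - (if i = r then 0 else entry m (Suc i))"

lemma sum_step: "(\<Sum>i\<le>r. step r m i) = 0"
proof -
  have "(\<Sum>i<r. entry m i - entry m (Suc i)) + entry m r = 0"
    by (induction r) (auto simp: entry_def)
  moreover have "(\<Sum>i<r. step r m i) = (\<Sum>i<r. entry m i - entry m (Suc i))"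
    by (intro sum.cong) (auto simp: step_def)
  ultimately show ?thesis
    by (simp add: step_def flip: lessThan_Suc_atMost)
qed

lemma sum_step_square: "(\<Sum>i\<le>r. (step r m i)\<^sup>2) = cartan_form r m"
proof -
  have "(\<Sum>i<r. (entry m i - entry m (Suc i))\<^sup>2) + (entry m r)\<^sup>2 = cartan_form r m"
  proof (induction r)
    case (Suc r)
    have "cartan_form (Suc r) m = cartan_form r m + 2 * (int (m (Suc r)))\<^sup>2 - 2 * entry m r * int (m (Suc r))"
      unfolding cartan_form_eq by (cases r) (simp_all add: entry_def algebra_simps)
    then show ?case
      using Suc by (simp add: entry_def power2_eq_square algebra_simps)
  qed (simp add: entry_def cartan_form_def)
  moreover have "(\<Sum>i<r. (step r m i)\<^sup>2) = (\<Sum>i<r. (entry m i - entry m (Suc i))\<^sup>2)"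
    by (intro sum.cong) (auto simp: step_def)
  ultimately show ?thesis
    by (simp add: step_def flip: lessThan_Suc_atMost)
qed

lemma sum_step_odd: "(\<Sum>i\<le>r. if odd i then step r m i else 0) = alt_sum r m"
proof -
  have "(\<Sum>i<r. if odd i then entry m i - entry m (Suc i) else 0) + (if odd r then entry m r else 0) = alt_sum r m"
  proof (induction r)
    case (Suc r)
    have "alt_sum (Suc r) m = alt_sum r m + (-1) ^ r * entry m (Suc r)"
      by (simp add: alt_sum_def entry_def)
    then show ?case using Suc by (cases "even r") auto
  qed (simp add: alt_sum_def)
  moreover have "(\<Sum>i<r. if odd i then step r m i else 0) = (\<Sum>i<r. if odd i then entry m i - entry m (Suc i) else 0)"
    by (intro sum.cong) (auto simp: step_def)
  ultimately show ?thesis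
    by (auto simp: step_def simp flip: lessThan_Suc_atMost)
qed

text \<open>The linear parts of \<open>tri\<close> cancel over a closed chain, which leaves half the
  sum of the squares.\<close>

lemma sum_tri_step: "(\<Sum>i\<le>r. tri (step r m i)) = cartan_form r m div 2"
proof -
  have "2 * (\<Sum>i\<le>r. tri (step r m i)) = (\<Sum>i\<le>r. (step r m i)\<^sup>2) - (\<Sum>i\<le>r. step r m i)"
    unfolding sum_distrib_left two_tri sum_subtractf[symmetric]
    by (intro sum.cong) (simp_all add: power2_eq_square algebra_simps)
  then show ?thesis unfolding sum_step sum_step_square by simp
qed

context qdisc
begin

definition bosF :: "nat \<Rightarrow> complex \<Rightarrow> complex" where
  "bosF n x = theta (x\<^sup>2) * theta x ^ (2 * n - 1)"

lemma laurent_bosF: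
  assumes "q \<noteq> 0"
  shows "\<exists>c. laurent (bosF n) c"
proof -
  obtain d where "laurent (\<lambda>x. theta x ^ (2 * n - 1)) d"
    using laurent_power[OF laurent_theta[OF assms]] by blast
  from laurent_mult(1)[OF laurent_square[OF laurent_theta[OF assms]] this]
  show ?thesis unfolding bosF_def[abs_def] by blast
qed

lemma weight_u_eq: "x \<noteq> 0 \<Longrightarrow> weight_u x = - theta (x\<^sup>2) / x\<^sup>2"
  unfolding weight_u_def by (rule theta_inverse) simp

lemma bigH_0 [simp]: "bigH t 0 x = 1"
  by (simp add: bigH_def)

end

context qdisc_pair
begin

lemma chain_weight_eq_prod:
  "chain_weight t r m * ker (alternate t r) (entry m r)
     = (\<Prod>i\<le>r. ker (alternate t i) (step r m i)) / (\<Prod>i=1..r. qpoch q q (m i))"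
proof -
  have "(\<Prod>i\<le>r. ker (alternate t i) (step r m i))
      = (\<Prod>i<r. ker (alternate t i) (step r m i)) * ker (alternate t r) (entry m r)"
    by (simp add: step_def flip: lessThan_Suc_atMost)
  also have "(\<Prod>i<r. ker (alternate t i) (step r m i)) = (\<Prod>i<r. ker (alternate t i) (entry m i - entry m (Suc i)))"
    by (intro prod.cong) (auto simp: step_def)
  finally have "(\<Prod>i\<le>r. ker (alternate t i) (step r m i))
      = (\<Prod>i<r. ker (alternate t i) (entry m i - entry m (Suc i))) * ker (alternate t r) (entry m r)" .
  moreover have "(\<Prod>i=1..r. qpoch q q (m i)) = (\<Prod>i<r. qpoch q q (m (Suc i)))"
    by (rule prod.reindex_bij_witness[of _ Suc "\<lambda>i. i - 1"]) auto
  ultimately show ?thesis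
    by (simp add: chain_weight_def prod_dividef)
qed

text \<open>The chain is closed by taking b = 0, where \<open>bigH\<close> is 1.\<close>

lemma fermionic_has_sum_CT:
  "((\<lambda>m. (\<Prod>i\<le>r. ker (alternate t i) (step r m i)) / (\<Prod>i=1..r. qpoch q q (m i))) has_sum
     CT (\<lambda>x. weight_u x * (\<Prod>i=1..r. lam (alternate t i) x))) (nat_vectors r)"
  using chain_has_sum[of r 0] by (simp add: chain_weight_eq_prod)

end

context qdisc
begin

text \<open>With t^2 = q each eigenvalue times (q)_inf is theta(t x), and quasi-periodicity
  identifies the weight with theta((t x)^2). The integrand thus becomes F(t x), whose constant term
  is that of F.\<close>

lemma fermionic_sum_1:
  assumes q: "q \<noteq> 0" and n: "n > 0" and F: "laurent (bosF n) c"
  shows "((\<lambda>m. q powi (cartan_form (2 * n - 1) m div 2) / (\<Prod>i=1..2 * n - 1. qpoch q q (m i))) has_sum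
     c 0 / qpoch_inf q q ^ (2 * n - 1)) (nat_vectors (2 * n - 1))"
proof -
  define t where "t = csqrt q"
  have tt: "t * t = q" using power2_csqrt[of q] by (simp add: t_def power2_eq_square)
  have t0: "t \<noteq> 0" using tt q by auto
  have nt: "norm t * norm t = norm q" using tt by (metis norm_mult)
  have "norm t < 1"
  proof (rule ccontr)
    assume "\<not> norm t < 1"
    then have "1 * 1 \<le> norm t * norm t" by (intro mult_mono) auto
    then show False using nt norm_q by simp
  qed
  moreover from this have "norm t * norm t \<le> 1 * norm t" by (intro mult_right_mono) auto
  ultimately interpret qdisc_pair q t
    by unfold_locales (use q nt in auto)
  have alt: "alternate t i = t" for i
    using tt t0 by (simp add: alternate_def field_simps)
  have ker_prod: "(\<Prod>i\<le>r. ker (alternate t i) (step r m i)) = q powi (cartan_form r m div 2)" for r m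
    using t0 q by (simp add: alt ker_def prod.distrib power_int_sum sum_step sum_tri_step)
  have "CT (\<lambda>x. bosF n (t * x)) = c 0 * t powi 0"
    by (rule laurent_CT[OF laurent_scale[OF F t0]])
  moreover have "CT (\<lambda>x. bosF n (t * x))
      = CT (\<lambda>x. qpoch_inf q q ^ (2 * n - 1) * (weight_u x * (\<Prod>i=1..2 * n - 1. lam (alternate t i) x)))"
  proof (rule CT_cong)
    fix x :: complex assume "norm x = 1"
    then have x: "x \<noteq> 0" by auto
    have "q / (t * x) = t / x"
      unfolding tt[symmetric] using t0 x by simp
    then have "theta (t * x) = qpoch_inf q q * lam t x"
      by (simp add: theta_def lam_def)
    moreover have "theta ((t * x)\<^sup>2) = weight_u x"
    proof -
      have "(t * x)\<^sup>2 = q * x\<^sup>2" unfolding tt[symmetric] by (simp add: power2_eq_square mult_ac)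
      then show ?thesis using theta_q_mult[of "x\<^sup>2"] x q by (simp add: weight_u_eq)
    qed
    ultimately show "bosF n (t * x) = qpoch_inf q q ^ (2 * n - 1) * (weight_u x * (\<Prod>i=1..2 * n - 1. lam (alternate t i) x))"
      by (simp add: bosF_def alt power_mult_distrib)
  qed
  ultimately have "CT (\<lambda>x. weight_u x * (\<Prod>i=1..2 * n - 1. lam (alternate t i) x)) = c 0 / qpoch_inf q q ^ (2 * n - 1)"
    unfolding CT_cmult by (simp add: field_simps)
  then show ?thesis
    using fermionic_has_sum_CT[of "2 * n - 1"] by (simp only: ker_prod)
qed

text \<open>The eigenvalues are now \<open>lam q\<close> and \<open>lam 1\<close> in turn. Their
  product is a theta square up to a monomial, but one \<open>lam q\<close> stays unpaired and
  becomes a theta function only after multiplication by 1 - x. The constant term of \<open>g\<close>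
  has to be recovered from that of (1 - x) g.\<close>

lemma fermionic_sum_2:
  assumes q: "q \<noteq> 0" and n: "n > 0" and F: "laurent (bosF n) c"
  shows "((\<lambda>m. q powi (cartan_form (2 * n - 1) m div 2 + alt_sum (2 * n - 1) m)
       / (\<Prod>i=1..2 * n - 1. qpoch q q (m i))) has_sum
     (-1) ^ n * c (int n + 1) / qpoch_inf q q ^ (2 * n - 1)) (nat_vectors (2 * n - 1))"
proof -
  interpret qdisc_pair q q
    by unfold_locales (use q norm_q in auto)
  define P where "P = qpoch_inf q q"
  have P: "P \<noteq> 0" by (simp add: P_def)
  have alt: "alternate q i = (if odd i then q else 1)" for i
    using q by (simp add: alternate_def)
  have ker_prod: "(\<Prod>i\<le>r. ker (alternate q i) (step r m i)) = q powi (cartan_form r m div 2 + alt_sum r m)" for r m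
  proof -
    have "ker (alternate q i) d = (-1) powi d * (q powi (if odd i then d else 0) * q powi tri d)" for i d
      using power_int_mult_distrib[of "-1" q d] by (simp add: alt ker_def)
    then have "(\<Prod>i\<le>r. ker (alternate q i) (step r m i))
      = (\<Prod>i\<le>r. (-1) powi step r m i) * ((\<Prod>i\<le>r. q powi (if odd i then step r m i else 0)) * (\<Prod>i\<le>r. q powi tri (step r m i)))"
      by (simp add: prod.distrib)
    also have "\<dots> = q powi (cartan_form r m div 2 + alt_sum r m)"
      using q by (simp only: power_int_sum neg_equal_0_iff_equal one_neq_zero not_False_eq_True sum_step sum_step_odd sum_tri_step)
        (simp add: power_int_add)
    finally show ?thesis .
  qed
  define g where "g = (\<lambda>x. P ^ (2 * n - 1) * (weight_u x * (\<Prod>i=1..2 * n - 1. lam (alternate q i) x)))"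
  have Lam: "(\<Prod>i=1..2 * Suc k - 1. lam (alternate q i) x) = (lam q x * lam 1 x) ^ k * lam q x" for k x
  proof (induction k)
    case (Suc k)
    have e: "2 * Suc (Suc k) - 1 = Suc (Suc (2 * Suc k - 1))" by simp
    show ?case unfolding e prod.nat_ivl_Suc' using Suc by (simp add: alt mult_ac)
  qed (simp add: alt)
  have g_eq: "(1 - x) * g x = (-1) ^ n * (x powi (- int n - 1) * bosF n x)" if x: "x \<noteq> 0" for x
  proof -
    obtain k where k: "n = Suc k" using n by (cases n) auto
    have l1: "(1 - x) * (P * lam q x) = theta x"
      unfolding theta_rec(1)[OF x] by (simp add: lam_def P_def mult_ac)
    have l2: "(P * lam q x) * (P * lam 1 x) = - (theta x)\<^sup>2 / x"
    proof -
      have "(P * lam q x) * (P * lam 1 x) = (1 - 1 / x) * qpoch_inf (q * x) q * (P * qpoch_inf (q / x) q) * (P * (qpoch_inf x q * qpoch_inf (q / x) q))"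
        by (simp add: lam_def theta_rec(2)[OF x] mult_ac)
      also have "(1 - 1 / x) * qpoch_inf (q * x) q = - (1 / x) * qpoch_inf x q"
      proof -
        have r: "qpoch_inf x q = (1 - x) * qpoch_inf (q * x) q"
          using qpoch_inf_rec[of x] by (simp add: mult.commute)
        show ?thesis unfolding r using x by (simp add: field_simps)
      qed
      finally show ?thesis by (simp add: theta_def P_def power2_eq_square mult_ac)
    qed
    have "g x = weight_u x * (((P * lam q x) * (P * lam 1 x)) ^ k * (P * lam q x))"
      unfolding g_def k Lam by (simp add: power_mult_distrib mult_ac power_mult[symmetric] power_add[symmetric] mult_2 mult_2_right)
    then have "(1 - x) * g x = weight_u x * ((- (theta x)\<^sup>2 / x) ^ k * ((1 - x) * (P * lam q x)))"
      unfolding l2 by (simp only: mult_ac)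
    also have "\<dots> = (- theta (x\<^sup>2) / x\<^sup>2) * ((- (theta x)\<^sup>2 / x) ^ k * theta x)"
      unfolding l1 weight_u_eq[OF x] ..
    also have "\<dots> = (-1) ^ n * (x powi (- int n - 1) * bosF n x)"
    proof -
      have "x powi (- int n - 1) = x powi (- int (k + 2))" by (simp add: k)
      also have "\<dots> = 1 / (x\<^sup>2 * x ^ k)"
        unfolding power_int_minus power_int_of_nat by (simp add: divide_inverse power2_eq_square)
      finally have e: "x powi (- int n - 1) = 1 / (x\<^sup>2 * x ^ k)" .
      have e2: "(- (theta x)\<^sup>2 / x) ^ k = (-1) ^ k * (theta x ^ (2 * k) / x ^ k)"
        using power_minus[of "(theta x)\<^sup>2 / x" k] by (simp add: power_divide power_mult)
      show ?thesis
        unfolding bosF_def e e2 by (simp add: k)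
    qed
    finally show ?thesis .
  qed
  have g_inv: "g (1 / x) = - 1 * (x powi 2 * g x)" if x: "x \<noteq> 0" for x
  proof -
    have "lam s (1 / x) = lam s x" for s by (simp add: lam_def mult.commute)
    moreover have "weight_u (1 / x) = - (x\<^sup>2 * weight_u x)"
      using x weight_u_eq[OF x] by (simp add: weight_u_def power_divide)
    ultimately show ?thesis by (simp add: g_def)
  qed
  have "\<exists>d. laurent (\<lambda>x. weight_u x * (\<Prod>i=1..k. lam (alternate q i) x)) d" for k
  proof (induction k)
    case (Suc k)
    then show ?case
      using laurent_lam[of "alternate q (Suc k)"] laurent_mult(1) by (force simp: mult.assoc[symmetric])
  qed (use laurent_weight_u[OF q] in auto)
  then obtain d where d: "laurent g d"
    unfolding g_def using laurent_cmult by blast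
  have "(\<lambda>k. d (- k)) = (\<lambda>k. - 1 * d (k - 2))"
    by (rule laurent_unique[OF laurent_inverse[OF d] laurent_cong[OF laurent_cmult[OF laurent_shift[OF d]]]])
       (simp add: g_inv)
  \<comment> \<open>At index 1 the reflection formula reads d(-1) = - d(-1). Hence the constant term
    d(0) - d(-1) of (1 - x) g is that of \<open>g\<close>.\<close>
  from fun_cong[OF this, of 1] have d1: "d (-1) = 0" by simp
  have "laurent (\<lambda>x. \<Sum>i\<in>{0, 1 :: nat}. (-1) ^ i * (x powi (int i) * g x)) (\<lambda>k. \<Sum>i\<in>{0, 1 :: nat}. (-1) ^ i * d (k - int i))"
    by (intro laurent_sum laurent_cmult laurent_shift d)
  moreover have "laurent (\<lambda>x. \<Sum>i\<in>{0, 1 :: nat}. (-1) ^ i * (x powi (int i) * g x)) (\<lambda>k. (-1) ^ n * c (k - (- int n - 1)))"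
    by (rule laurent_cong[OF laurent_cmult[OF laurent_shift[OF F]]]) (subst g_eq[symmetric], simp, simp add: algebra_simps)
  ultimately have "(\<lambda>k. \<Sum>i\<in>{0, 1 :: nat}. (-1) ^ i * d (k - int i)) = (\<lambda>k. (-1) ^ n * c (k - (- int n - 1)))"
    by (rule laurent_unique)
  from fun_cong[OF this, of 0] have "d 0 = (-1) ^ n * c (int n + 1)"
    by (simp add: d1 add.commute)
  then have "CT g = (-1) ^ n * c (int n + 1)"
    using laurent_CT[OF d] by simp
  then have "CT (\<lambda>x. weight_u x * (\<Prod>i=1..2 * n - 1. lam (alternate q i) x)) = (-1) ^ n * c (int n + 1) / P ^ (2 * n - 1)"
    unfolding g_def CT_cmult using P by (simp add: field_simps)
  then show ?thesis
    using fermionic_has_sum_CT[of "2 * n - 1"] by (simp only: ker_prod P_def)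
qed

end

section \<open>Moments of the Laurent coefficients\<close>

text \<open>This is i! times the Taylor coefficient of exp(-\<alpha> w) f(exp w) at w = 0, where
  \<open>c\<close> are the Laurent coefficients of f.\<close>

definition moment :: "(int \<Rightarrow> complex) \<Rightarrow> complex \<Rightarrow> nat \<Rightarrow> complex" where
  "moment c \<alpha> i = (\<Sum>\<^sub>\<infinity>k. c k * (of_int k - \<alpha>) ^ i)"

text \<open>The exponentials exp((k - \<alpha>) w) are expanded and the double series is rearranged.
  Absolute convergence follows from convergence of the Laurent series at the two points R = exp |w|
  and 1/R, which dominate k > 0 and k < 0 respectively.\<close>

lemma
  assumes "laurent f c"
  shows laurent_moment_summable: "(\<lambda>k. c k * (of_int k - \<alpha>) ^ i) summable_on UNIV"
    and laurent_moment_sums: "(\<lambda>i. moment c \<alpha> i / fact i * w ^ i) sums (exp (- \<alpha> * w) * f (exp w))"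
proof -
  have main: "(\<forall>i. (\<lambda>k. c k * (of_int k - \<alpha>) ^ i * (w ^ i / fact i)) summable_on UNIV) \<and>
      ((\<lambda>i. \<Sum>\<^sub>\<infinity>k. c k * (of_int k - \<alpha>) ^ i * (w ^ i / fact i)) has_sum (exp (- \<alpha> * w) * f (exp w))) UNIV" for w
  proof -
    define b where "b k = (of_int k - \<alpha>) * w" for k :: int
    define g where "g = (\<lambda>(k, i). c k * (b k ^ i / fact i))"
    have hs_exp: "((\<lambda>i. g (k, i)) has_sum c k * exp (b k)) UNIV" for k
    proof -
      have "(\<lambda>i. b k ^ i / fact i) sums exp (b k)"
        using exp_converges[of "b k"] by (simp add: scaleR_conv_of_real divide_inverse mult.commute)
      moreover have "summable (\<lambda>i. norm (b k ^ i / fact i))"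
        using summable_norm_exp[of "b k"] by (simp add: scaleR_conv_of_real divide_inverse mult.commute norm_mult)
      ultimately have "((\<lambda>i. b k ^ i / fact i) has_sum exp (b k)) UNIV"
        by (intro norm_summable_imp_has_sum)
      then show ?thesis
        unfolding g_def prod.case by (rule has_sum_cmult_right)
    qed
    have norm_g: "((\<lambda>i. norm (g (k, i))) has_sum norm (c k) * exp (norm (b k))) UNIV" for k
    proof -
      have "(\<lambda>i. norm (b k) ^ i / fact i) sums exp (norm (b k))"
        using exp_converges[of "norm (b k)"] by (simp add: divide_inverse mult.commute)
      then have "((\<lambda>i. norm (b k) ^ i / fact i) has_sum exp (norm (b k))) UNIV"
        by (intro sums_nonneg_imp_has_sum) auto
      then show ?thesis
        unfolding g_def prod.case norm_mult norm_divide norm_power norm_fact by (rule has_sum_cmult_right)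
    qed
    define R where "R = exp (norm w)"
    have R: "of_real R \<noteq> (0 :: complex)" "of_real (1 / R) \<noteq> (0 :: complex)" by (simp_all add: R_def)
    have "(\<lambda>k. norm (c k) * exp (norm (b k))) summable_on UNIV"
    proof (rule summable_on_comparison_test)
      show "(\<lambda>k. exp (norm \<alpha> * norm w) * (norm (c k * of_real R powi k) + norm (c k * of_real (1 / R) powi k))) summable_on UNIV"
        by (intro summable_on_cmult_right summable_on_add laurent_abs_summable[OF assms] R)
      fix k :: int
      have "norm (b k) \<le> (norm (of_int k :: complex) + norm \<alpha>) * norm w"
        unfolding b_def norm_mult by (intro mult_right_mono norm_triangle_ineq4) auto
      then have "exp (norm (b k)) \<le> exp (\<bar>of_int k\<bar> * norm w + norm \<alpha> * norm w)"
        by (simp add: algebra_simps)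
      also have "\<dots> = exp (norm \<alpha> * norm w) * exp (\<bar>of_int k\<bar> * norm w)"
        by (simp add: exp_add)
      also have "exp (\<bar>of_int k\<bar> * norm w) \<le> R powi k + (1 / R) powi k"
      proof -
        have Rp: "R powi j = exp (of_int j * norm w)" for j :: int
          by (simp add: R_def exp_power_int mult.commute)
        have "(1 / R) powi k = exp (- of_int k * norm w)"
          using Rp[of "- k"] by (simp add: power_int_minus power_int_inverse divide_inverse)
        then show ?thesis
          unfolding Rp by (cases "k \<ge> 0") simp_all
      qed
      finally have "norm (c k) * exp (norm (b k)) \<le> norm (c k) * (exp (norm \<alpha> * norm w) * (R powi k + (1 / R) powi k))"
        by (simp add: mult_left_mono)
      also have "\<dots> = exp (norm \<alpha> * norm w) * (norm (c k * of_real R powi k) + norm (c k * of_real (1 / R) powi k))"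
        by (simp add: norm_mult norm_power_int norm_divide R_def algebra_simps)
      finally show "norm (c k) * exp (norm (b k)) \<le> exp (norm \<alpha> * norm w) * (norm (c k * of_real R powi k) + norm (c k * of_real (1 / R) powi k))" .
    qed auto
    then have "(\<lambda>p. norm (g p)) summable_on UNIV \<times> UNIV"
      using norm_g unfolding Infinite_Sum.abs_summable_on_Sigma_iff
      by (auto simp: infsumI[OF norm_g] intro: has_sum_imp_summable)
    then have summ: "g summable_on UNIV \<times> UNIV" by (rule abs_summable_summable)
    have "((\<lambda>k. c k * exp (b k)) has_sum exp (- \<alpha> * w) * f (exp w)) UNIV"
    proof -
      have "((\<lambda>k. exp (- \<alpha> * w) * (c k * exp w powi k)) has_sum exp (- \<alpha> * w) * f (exp w)) UNIV"
        by (intro has_sum_cmult_right laurentD[OF assms]) simp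
      also have "(\<lambda>k. exp (- \<alpha> * w) * (c k * exp w powi k)) = (\<lambda>k. c k * exp (b k))"
        by (simp add: fun_eq_iff b_def exp_power_int exp_diff exp_minus algebra_simps divide_inverse)
      finally show ?thesis .
    qed
    from has_sum_SigmaI[OF hs_exp this summ]
    have "(g has_sum exp (- \<alpha> * w) * f (exp w)) (UNIV \<times> UNIV)" .
    then have hs: "((\<lambda>(i, k). g (k, i)) has_sum exp (- \<alpha> * w) * f (exp w)) (UNIV \<times> UNIV)"
      by (subst (asm) has_sum_swap) (simp add: case_prod_unfold)
    have g: "g (k, i) = c k * (of_int k - \<alpha>) ^ i * (w ^ i / fact i)" for k i
      by (simp add: g_def b_def power_mult_distrib)
    have s: "(\<lambda>k. c k * (of_int k - \<alpha>) ^ i * (w ^ i / fact i)) summable_on UNIV" for i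
      using summable_on_SigmaD1[OF has_sum_imp_summable[OF hs], of i] by (simp add: g)
    have "((\<lambda>i. \<Sum>\<^sub>\<infinity>k. c k * (of_int k - \<alpha>) ^ i * (w ^ i / fact i)) has_sum (exp (- \<alpha> * w) * f (exp w))) UNIV"
      by (rule has_sum_SigmaD[OF hs], unfold prod.case g, rule has_sum_infsum, rule s)
    with s show ?thesis by blast
  qed
  show "(\<lambda>k. c k * (of_int k - \<alpha>) ^ i) summable_on UNIV"
  proof -
    have "(\<lambda>k. c k * (of_int k - \<alpha>) ^ i * (1 ^ i / fact i)) summable_on UNIV"
      using main[of 1] by blast
    then have "(\<lambda>k. c k * (of_int k - \<alpha>) ^ i * (1 ^ i / fact i) * fact i) summable_on UNIV"
      by (rule summable_on_cmult_left)
    then show ?thesis by simp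
  qed
  have "((\<lambda>i. moment c \<alpha> i * (w ^ i / fact i)) has_sum (exp (- \<alpha> * w) * f (exp w))) UNIV"
    using main[of w] unfolding moment_def infsum_cmult_left' by blast
  then show "(\<lambda>i. moment c \<alpha> i / fact i * w ^ i) sums (exp (- \<alpha> * w) * f (exp w))"
    by (intro has_sum_imp_sums) simp
qed

definition moment_fps :: "(int \<Rightarrow> complex) \<Rightarrow> complex \<Rightarrow> complex fps" where
  "moment_fps c \<alpha> = Abs_fps (\<lambda>i. moment c \<alpha> i / fact i)"

lemma laurent_moment_fps:
  assumes "laurent f c"
  shows "(\<lambda>w. exp (- \<alpha> * w) * f (exp w)) has_fps_expansion moment_fps c \<alpha>"
  using laurent_moment_sums[OF assms] by (intro has_fps_expansionI always_eventually) (simp add: moment_fps_def)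

text \<open>Serves the factor theta(x^2), which in terms of x = exp w is theta evaluated at
  exp(2w).\<close>

lemma laurent_moment_fps_scale:
  assumes "laurent f c"
  shows "(\<lambda>w. exp (- \<alpha> * (s * w)) * f (exp (s * w))) has_fps_expansion
    Abs_fps (\<lambda>i. s ^ i * fps_nth (moment_fps c \<alpha>) i)"
proof (rule has_fps_expansionI, rule always_eventually, rule allI)
  fix w
  show "(\<lambda>i. fps_nth (Abs_fps (\<lambda>i. s ^ i * fps_nth (moment_fps c \<alpha>) i)) i * w ^ i)
      sums (exp (- \<alpha> * (s * w)) * f (exp (s * w)))"
    using laurent_moment_sums[OF assms, of \<alpha> "s * w"]
    by (simp add: moment_fps_def power_mult_distrib mult_ac)
qed

lemma fps_power_nth_low:
  fixes S :: "complex fps"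
  assumes "fps_nth S 1 = 0"
  shows "fps_nth (S ^ m) 0 = fps_nth S 0 ^ m" "fps_nth (S ^ m) 1 = 0"
    "fps_nth (S ^ m) 2 = of_nat m * fps_nth S 0 ^ (m - 1) * fps_nth S 2"
proof -
  show 0: "fps_nth (S ^ m) 0 = fps_nth S 0 ^ m" for m
    by (simp add: fps_power_zeroth)
  show 1: "fps_nth (S ^ m) 1 = 0" for m
    by (induction m) (use assms in \<open>simp_all add: fps_mult_nth\<close>)
  show "fps_nth (S ^ m) 2 = of_nat m * fps_nth S 0 ^ (m - 1) * fps_nth S 2"
  proof (induction m)
    case (Suc m)
    have "fps_nth (S ^ Suc m) 2 = fps_nth S 0 * fps_nth (S ^ m) 2 + fps_nth S 1 * fps_nth (S ^ m) 1 + fps_nth S 2 * fps_nth (S ^ m) 0"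
      by (simp add: fps_mult_nth numeral_2_eq_2)
    then show ?case
      using Suc 0 1 assms by (cases m) (simp_all add: algebra_simps)
  qed simp
qed

context qdisc
begin

definition theta_coeff :: "int \<Rightarrow> complex" where
  "theta_coeff k = (-1) powi k * q powi tri k"

definition theta_moment :: "nat \<Rightarrow> complex" where
  "theta_moment i = moment theta_coeff (1 / 2) i"

lemma laurent_theta': "q \<noteq> 0 \<Longrightarrow> laurent theta theta_coeff"
  using laurent_theta by (simp add: theta_coeff_def[abs_def])

text \<open>The substitution k -> 1 - k preserves \<open>tri k\<close> and reverses the sign (-1)^k,
  so exp(-w/2) theta(exp w) is odd in w.\<close>

lemma theta_moment_even:
  assumes "even i"
  shows "theta_moment i = 0"
proof -
  have t: "tri (1 - k) = tri k" for k by (simp add: tri_def mult.commute algebra_simps)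
  have s: "(-1 :: complex) powi (1 - k) = - ((-1) powi k)" for k
    by (simp add: power_int_diff power_int_minus_one_minus divide_inverse flip: power_int_minus)
  have "theta_moment i = (\<Sum>\<^sub>\<infinity>k. theta_coeff (1 - k) * (of_int (1 - k) - 1 / 2) ^ i)"
    unfolding theta_moment_def moment_def
    by (rule infsum_reindex_bij_witness[of _ "\<lambda>k. 1 - k" "\<lambda>k. 1 - k"]) auto
  also have "\<dots> = (\<Sum>\<^sub>\<infinity>k. - (theta_coeff k * (of_int k - 1 / 2) ^ i))"
  proof (rule infsum_cong)
    fix k :: int
    have "(of_int (1 - k) - 1 / 2 :: complex) ^ i = (- (of_int k - 1 / 2)) ^ i" by simp
    also have "\<dots> = (of_int k - 1 / 2) ^ i" using assms by (rule power_minus_even)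
    finally show "theta_coeff (1 - k) * (of_int (1 - k) - 1 / 2) ^ i = - (theta_coeff k * (of_int k - 1 / 2) ^ i)"
      by (simp add: theta_coeff_def t s)
  qed
  also have "\<dots> = - theta_moment i"
    by (simp add: infsum_uminus theta_moment_def moment_def)
  finally show ?thesis by simp
qed

text \<open>Jacobi's formula for the cube of (q)_inf: the factor 1 - x gives a simple zero at x = 1,
  and the three remaining infinite products all equal (q)_inf there.\<close>

lemma theta_moment_1:
  assumes q: "q \<noteq> 0"
  shows "theta_moment 1 = - (qpoch_inf q q ^ 3)"
proof -
  define P where "P = qpoch_inf q q"
  have L: "laurent (\<lambda>x. qpoch_inf (q / x) q)
     (\<lambda>k. if - k < 0 then 0 else (- q) ^ nat (- k) * q ^ (nat (- k) choose 2) / qpoch q q (nat (- k)))"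
    using laurent_inverse[OF laurent_qpoch_inf[of q]] by simp
  define g where "g = (\<lambda>x. qpoch_inf (q * x) q * qpoch_inf (q / x) q)"
  obtain d where d: "laurent g d"
    unfolding g_def using laurent_mult(1)[OF laurent_qpoch_inf[of q] L] by blast
  have th: "theta x = P * ((1 - x) * g x)" if "x \<noteq> 0" for x
    using theta_rec(1)[OF that] by (simp add: P_def g_def mult_ac)
  define E where "E = fps_exp (- 1 / 2) - fps_exp (1 / 2 :: complex)"
  have E: "(\<lambda>w. exp (- 1 / 2 * w) - exp (1 / 2 * w)) has_fps_expansion E"
    unfolding E_def by (intro fps_expansion_intros)
  have G: "(\<lambda>w. exp (- 0 * w) * g (exp w)) has_fps_expansion moment_fps d 0"
    by (rule laurent_moment_fps[OF d])
  have "(\<lambda>w. P * ((exp (- 1 / 2 * w) - exp (1 / 2 * w)) * (exp (- 0 * w) * g (exp w)))) has_fps_expansion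
      fps_const P * (E * moment_fps d 0)"
    by (intro fps_expansion_intros E G)
  also have "(\<lambda>w. P * ((exp (- 1 / 2 * w) - exp (1 / 2 * w)) * (exp (- 0 * w) * g (exp w))))
      = (\<lambda>w. exp (- (1 / 2) * w) * theta (exp w))"
  proof
    fix w :: complex
    have "exp (1 / 2 * w) = exp (- (1 / 2) * w) * exp w"
      by (simp add: exp_add[symmetric])
    then show "P * ((exp (- 1 / 2 * w) - exp (1 / 2 * w)) * (exp (- 0 * w) * g (exp w))) = exp (- (1 / 2) * w) * theta (exp w)"
      by (simp add: th algebra_simps)
  qed
  finally have "moment_fps theta_coeff (1 / 2) = fps_const P * (E * moment_fps d 0)"
    using laurent_moment_fps[OF laurent_theta'[OF q]] by (intro fps_expansion_unique_complex)
  then have "fps_nth (moment_fps theta_coeff (1 / 2)) 1 = P * (- fps_nth (moment_fps d 0) 0)"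
    by (simp add: fps_mult_nth E_def)
  moreover have "fps_nth (moment_fps d 0) 0 = P * P"
    using has_fps_expansion_imp_0_eq_fps_nth_0[OF G] by (simp add: g_def P_def)
  ultimately show ?thesis
    by (simp add: theta_moment_def moment_fps_def P_def power3_eq_cube)
qed

text \<open>With \<open>\<alpha> = n + 1/2\<close>, \<open>e\<^bsup>-\<alpha>w\<^esup> bosF n (e\<^sup>w)\<close> is a product of \<open>2n\<close> odd functions of \<open>w\<close>, one for
  each theta factor, so it vanishes to order \<open>2n\<close> and has no term of order \<open>2n + 1\<close>.\<close>

lemma bosF_moments:
  assumes q: "q \<noteq> 0" and n: "n > 0" and F: "laurent (bosF n) c"
  defines "\<mu> \<equiv> moment c (of_nat n + 1 / 2)" and "\<tau>1 \<equiv> theta_moment 1" and "\<tau>3 \<equiv> theta_moment 3 / 6"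
  shows "\<And>i. i < 2 * n \<Longrightarrow> \<mu> i = 0"
    and "\<mu> (2 * n) = 2 * fact (2 * n) * \<tau>1 ^ (2 * n)"
    and "\<mu> (2 * n + 2) = 2 * fact (2 * n + 2) * of_nat (2 * n + 3) * \<tau>3 * \<tau>1 ^ (2 * n - 1)"
proof -
  define T where "T = moment_fps theta_coeff (1 / 2)"
  define S where "S = fps_shift 1 T"
  define S2 where "S2 = Abs_fps (\<lambda>i. 2 ^ i * fps_nth S i)"
  have T0: "fps_nth T 0 = 0" and T2: "fps_nth T 2 = 0"
    using theta_moment_even[of 0] theta_moment_even[of 2] by (simp_all add: T_def moment_fps_def theta_moment_def)
  have TS: "T = fps_X * S"
    unfolding S_def by (rule fps_ext) (use T0 in \<open>auto simp: gr0_conv_Suc\<close>)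
  have S0: "fps_nth S 0 = \<tau>1" and S1: "fps_nth S 1 = 0" and S2_: "fps_nth S 2 = \<tau>3"
    using T2 by (simp_all add: S_def T_def moment_fps_def \<tau>1_def \<tau>3_def theta_moment_def numeral_2_eq_2 numeral_3_eq_3)
  have TS2: "Abs_fps (\<lambda>i. 2 ^ i * fps_nth T i) = 2 * fps_X * S2"
  proof (rule fps_ext)
    fix i show "fps_nth (Abs_fps (\<lambda>i. 2 ^ i * fps_nth T i)) i = fps_nth (2 * fps_X * S2) i"
      by (cases i) (simp_all add: TS S2_def mult.assoc numeral_fps_const)
  qed
  have e1: "(\<lambda>w. exp (- (1 / 2) * w) * theta (exp w)) has_fps_expansion T"
    unfolding T_def by (rule laurent_moment_fps[OF laurent_theta'[OF q]])
  have e2: "(\<lambda>w. exp (- (1 / 2) * (2 * w)) * theta (exp (2 * w))) has_fps_expansion 2 * fps_X * S2"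
    unfolding TS2[symmetric] T_def by (rule laurent_moment_fps_scale[OF laurent_theta'[OF q]])
  have "(\<lambda>w. (exp (- (1 / 2) * (2 * w)) * theta (exp (2 * w))) * (exp (- (1 / 2) * w) * theta (exp w)) ^ (2 * n - 1))
      has_fps_expansion (2 * fps_X * S2) * T ^ (2 * n - 1)"
    by (intro fps_expansion_intros e1 e2)
  also have "(\<lambda>w. (exp (- (1 / 2) * (2 * w)) * theta (exp (2 * w))) * (exp (- (1 / 2) * w) * theta (exp w)) ^ (2 * n - 1))
      = (\<lambda>w. exp (- (of_nat n + 1 / 2) * w) * bosF n (exp w))"
  proof
    fix w :: complex
    have "exp (- (1 / 2) * w) ^ (2 * n - 1) = exp (of_nat (2 * n - 1) * (- (1 / 2) * w))"
      by (rule exp_of_nat_mult[symmetric])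
    also have "of_nat (2 * n - 1) * (- (1 / 2) * w) = - (of_nat n + 1 / 2) * w + w"
      using n by (simp add: of_nat_diff field_simps)
    finally have "exp (- (1 / 2) * (2 * w)) * exp (- (1 / 2) * w) ^ (2 * n - 1) = exp (- (of_nat n + 1 / 2) * w)"
      by (simp add: exp_add[symmetric])
    moreover have "exp (2 * w) = (exp w)\<^sup>2" by (simp add: exp_double)
    ultimately show "(exp (- (1 / 2) * (2 * w)) * theta (exp (2 * w))) * (exp (- (1 / 2) * w) * theta (exp w)) ^ (2 * n - 1)
      = exp (- (of_nat n + 1 / 2) * w) * bosF n (exp w)"
      by (simp only: bosF_def power_mult_distrib) (simp add: mult_ac)
  qed
  finally have "moment_fps c (of_nat n + 1 / 2) = (2 * fps_X * S2) * T ^ (2 * n - 1)"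
    using laurent_moment_fps[OF F] by (intro fps_expansion_unique_complex)
  also have "\<dots> = fps_const 2 * (fps_X ^ (2 * n) * (S2 * S ^ (2 * n - 1)))"
  proof -
    have "fps_X ^ (2 * n) = fps_X * (fps_X :: complex fps) ^ (2 * n - 1)"
      using n by (simp flip: power_Suc)
    then show ?thesis
      by (simp add: TS power_mult_distrib numeral_fps_const mult_ac)
  qed
  finally have eq: "moment_fps c (of_nat n + 1 / 2) = fps_const 2 * (fps_X ^ (2 * n) * (S2 * S ^ (2 * n - 1)))" .
  have \<mu>: "\<mu> i = fact i * (if i < 2 * n then 0 else 2 * fps_nth (S2 * S ^ (2 * n - 1)) (i - 2 * n))" for i
  proof -
    have "fps_nth (moment_fps c (of_nat n + 1 / 2)) i = (if i < 2 * n then 0 else 2 * fps_nth (S2 * S ^ (2 * n - 1)) (i - 2 * n))"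
      unfolding eq fps_mult_left_const_nth fps_X_power_mult_nth by simp
    moreover have "\<mu> i = fact i * fps_nth (moment_fps c (of_nat n + 1 / 2)) i"
      by (simp add: moment_fps_def \<mu>_def)
    ultimately show ?thesis by simp
  qed
  show "\<mu> i = 0" if "i < 2 * n" for i
    using that by (simp add: \<mu>)
  have pow: "\<tau>1 * \<tau>1 ^ (2 * n - 1) = \<tau>1 ^ (2 * n)" using n by (simp flip: power_Suc)
  show "\<mu> (2 * n) = 2 * fact (2 * n) * \<tau>1 ^ (2 * n)"
    using pow by (simp add: \<mu> fps_mult_nth S2_def S0 fps_power_zeroth)
  have "fps_nth (S2 * S ^ (2 * n - 1)) 2
      = fps_nth S2 0 * fps_nth (S ^ (2 * n - 1)) 2 + fps_nth S2 1 * fps_nth (S ^ (2 * n - 1)) 1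
        + fps_nth S2 2 * fps_nth (S ^ (2 * n - 1)) 0"
    by (simp add: fps_mult_nth numeral_2_eq_2)
  \<comment> \<open>Here 2n + 3 arises once more: each of the 2n - 1 plain theta factors contributes
    \<tau>3 once, and the doubled argument in theta(x^2) contributes it 2^2 = 4 times.\<close>
  also have "\<dots> = of_nat (2 * n - 1) * (\<tau>1 * \<tau>1 ^ (2 * n - 1 - 1)) * \<tau>3 + 4 * \<tau>3 * \<tau>1 ^ (2 * n - 1)"
    unfolding fps_power_nth_low[OF S1] by (simp add: S2_def S0 S2_ mult_ac)
  also have "\<tau>1 * \<tau>1 ^ (2 * n - 1 - 1) = \<tau>1 ^ (2 * n - 1)"
    using n by (cases n) simp_all
  also have "of_nat (2 * n - 1) * \<tau>1 ^ (2 * n - 1) * \<tau>3 + 4 * \<tau>3 * \<tau>1 ^ (2 * n - 1)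
      = of_nat (2 * n + 3) * \<tau>3 * \<tau>1 ^ (2 * n - 1)"
    using n by (simp add: of_nat_diff algebra_simps)
  finally show "\<mu> (2 * n + 2) = 2 * fact (2 * n + 2) * of_nat (2 * n + 3) * \<tau>3 * \<tau>1 ^ (2 * n - 1)"
    by (simp add: \<mu>)
qed

end

section \<open>Quasi-periodicity of the Laurent coefficients\<close>

lemma summable_polynomial_geometric:
  fixes s :: real
  assumes "0 \<le> s" "s < 1"
  shows "summable (\<lambda>k. (1 + real k) ^ d * s ^ k)"
proof -
  have "(\<lambda>k. ((2 + real k) / (1 + real k)) ^ d * s) \<longlonglongrightarrow> 1 ^ d * s"
  proof (intro tendsto_intros)
    have "(\<lambda>k. 1 + 1 / real (Suc k)) \<longlonglongrightarrow> 1 + 0"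
      by (intro tendsto_intros LIMSEQ_Suc lim_1_over_n)
    then show "(\<lambda>k. (2 + real k) / (1 + real k)) \<longlonglongrightarrow> 1"
      by (rule filterlim_cong[THEN iffD1, rotated -1]) (auto simp: field_simps intro!: always_eventually)
  qed
  then have "eventually (\<lambda>k. ((2 + real k) / (1 + real k)) ^ d * s < (1 + s) / 2) sequentially"
    by (rule order_tendstoD) (use assms in auto)
  then obtain N where N: "\<And>k. k \<ge> N \<Longrightarrow> ((2 + real k) / (1 + real k)) ^ d * s < (1 + s) / 2"
    by (auto simp: eventually_sequentially)
  show ?thesis
  proof (rule summable_ratio_test)
    show "norm ((1 + real (Suc k)) ^ d * s ^ Suc k) \<le> (1 + s) / 2 * norm ((1 + real k) ^ d * s ^ k)"
      if "k \<ge> N" for k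
    proof -
      have "norm ((1 + real (Suc k)) ^ d * s ^ Suc k) = (((2 + real k) / (1 + real k)) ^ d * s) * ((1 + real k) ^ d * s ^ k)"
        using assms by (simp add: power_divide)
      also have "\<dots> \<le> (1 + s) / 2 * ((1 + real k) ^ d * s ^ k)"
        using N[OF that] assms by (intro mult_right_mono) auto
      finally show ?thesis using assms by simp
    qed
  qed (use assms in auto)
qed

lemma PiE_insert_bij:
  assumes "j \<notin> J"
  shows "bij_betw (\<lambda>(x, r). r(j := x)) (B j \<times> PiE J B) (PiE (insert j J) B)"
  using assms inj_combinator[OF assms, of B] by (simp add: bij_betw_def PiE_insert_eq)

lemma summable_on_prod_PiE:
  fixes g :: "'a \<Rightarrow> 'b \<Rightarrow> real"
  assumes "finite I" "\<And>i. i \<in> I \<Longrightarrow> g i summable_on B i" "\<And>i x. i \<in> I \<Longrightarrow> g i x \<ge> 0"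
  shows "(\<lambda>r. \<Prod>i\<in>I. g i (r i)) summable_on PiE I B"
  using assms
proof (induction I rule: finite_induct)
  case (insert j J)
  define f where "f = (\<lambda>p. \<Prod>i\<in>insert j J. g i ((\<lambda>(x, r). r(j := x)) p i))"
  have f: "f (x, r) = g j x * (\<Prod>i\<in>J. g i (r i))" for x r
    using insert.hyps by (auto simp: f_def intro!: prod.cong)
  have nonneg: "(\<Prod>i\<in>J. g i (r i)) \<ge> 0" for r
    using insert.prems by (intro prod_nonneg) auto
  have "(\<lambda>p. norm (case p of (x, r) \<Rightarrow> g j x * (\<Prod>i\<in>J. g i (r i)))) summable_on B j \<times> PiE J B"
    by (rule abs_summable_on_times) (use insert nonneg in auto)
  also have "(\<lambda>p. norm (case p of (x, r) \<Rightarrow> g j x * (\<Prod>i\<in>J. g i (r i)))) = f"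
    using insert.prems nonneg by (auto simp: fun_eq_iff f abs_mult)
  finally have "f summable_on B j \<times> PiE J B" .
  then show ?case
    unfolding f_def by (subst (asm) summable_on_reindex_bij_betw[OF PiE_insert_bij[OF insert.hyps(2)]])
qed simp

text \<open>For v = l - 1/2 + (2n+3) r this is (v^2 - (l - 1/2)^2) / (2 (2n+3)), the share of one
  coordinate in the exponent on the right-hand side; \<open>zval\<close> is v^2.\<close>

definition wexp :: "nat \<Rightarrow> nat \<Rightarrow> int \<Rightarrow> int" where
  "wexp n l r = r * (2 * int l - 1 + (2 * int n + 3) * r) div 2"

definition zval :: "nat \<Rightarrow> nat \<Rightarrow> int \<Rightarrow> complex" where
  "zval n l r = (of_nat l - 1 / 2 + of_nat (2 * n + 3) * of_int r)\<^sup>2"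

lemma two_wexp: "2 * wexp n l r = r * (2 * int l - 1 + (2 * int n + 3) * r)"
  by (simp add: wexp_def)

text \<open>As 2l - 1 lies between 1 and 2n + 1, it stays 2 below the modulus 2n + 3. For nonzero
  \<open>r\<close> the bracket therefore has the sign of \<open>r\<close> and absolute value at
  least 2.\<close>

lemma wexp_ge:
  assumes "l \<in> {1..n + 1}"
  shows "wexp n l r \<ge> \<bar>r\<bar>"
proof -
  have l: "int l \<ge> 1" "int l \<le> int n + 1" "int n \<ge> 0" using assms by auto
  have aux1: "2 * int l - 1 + y \<ge> 2" if "(2 * int n + 3) * 1 \<le> y" for y using that l by simp
  have aux2: "- (2 * int l - 1 + y) \<ge> 2" if "y \<le> (2 * int n + 3) * (-1)" for y using that l by simp
  have "r * (2 * int l - 1 + (2 * int n + 3) * r) \<ge> 2 * \<bar>r\<bar>"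
  proof (cases "r \<ge> 0")
    case True
    show ?thesis
    proof (cases "r = 0")
      case False
      have "(2 * int n + 3) * 1 \<le> (2 * int n + 3) * r"
        using True False by (intro mult_left_mono) auto
      then have "2 * int l - 1 + (2 * int n + 3) * r \<ge> 2" by (rule aux1)
      then have "r * (2 * int l - 1 + (2 * int n + 3) * r) \<ge> r * 2"
        using True by (intro mult_left_mono) auto
      then show ?thesis using True by simp
    qed simp
  next
    case False
    have "(2 * int n + 3) * r \<le> (2 * int n + 3) * (-1)"
      using False by (intro mult_left_mono) auto
    then have "- (2 * int l - 1 + (2 * int n + 3) * r) \<ge> 2" by (rule aux2)
    then have "2 * int l - 1 + (2 * int n + 3) * r \<le> - 2" by simp
    then have "r * (- 2) \<le> r * (2 * int l - 1 + (2 * int n + 3) * r)"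
      by (rule mult_left_mono_neg) (use False in simp)
    moreover have "2 * \<bar>r\<bar> = r * (- 2)" using False by simp
    ultimately show ?thesis by (simp only:)
  qed
  then have "2 * \<bar>r\<bar> \<le> 2 * wexp n l r" unfolding two_wexp .
  then show ?thesis by simp
qed

lemma norm_zval_le:
  assumes "l \<in> {1..n + 1}"
  shows "norm (zval n l r) \<le> real (2 * n + 3) ^ 2 * (1 + real (nat \<bar>r\<bar>)) ^ 2"
proof -
  have "norm (of_nat l - 1 / 2 + of_nat (2 * n + 3) * of_int r :: complex)
      \<le> norm (of_real (real l - 1 / 2) :: complex) + norm (of_nat (2 * n + 3) * of_int r :: complex)"
    using norm_triangle_ineq[of "of_real (real l - 1 / 2) :: complex" "of_nat (2 * n + 3) * of_int r"] by simp
  also have "norm (of_real (real l - 1 / 2) :: complex) = real l - 1 / 2"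
    using assms unfolding norm_of_real by simp
  also have "norm (of_nat (2 * n + 3) * of_int r :: complex) = real (2 * n + 3) * real (nat \<bar>r\<bar>)"
    by (simp add: norm_mult del: of_nat_add of_nat_mult)
  also have "real l - 1 / 2 \<le> real (2 * n + 3)" using assms by simp
  finally have "norm (of_nat l - 1 / 2 + of_nat (2 * n + 3) * of_int r :: complex) \<le> real (2 * n + 3) * (1 + real (nat \<bar>r\<bar>))"
    by (simp add: algebra_simps)
  then show ?thesis
    unfolding zval_def norm_power power_mult_distrib[symmetric] by (intro power_mono) auto
qed

lemma sum_fold_symmetric:
  fixes A :: "nat \<Rightarrow> complex"
  assumes "\<And>s. s \<le> 2 * n + 1 \<Longrightarrow> A (2 * n + 1 - s) = A s"
  shows "(\<Sum>s\<le>2 * n + 1. A s) = 2 * (\<Sum>l=1..n + 1. A (n + l))"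
proof -
  have "(\<Sum>s\<le>2 * n + 1. A s) = (\<Sum>s\<in>{..n} \<union> {n + 1..2 * n + 1}. A s)"
    by (intro sum.cong) auto
  also have "\<dots> = (\<Sum>s\<le>n. A s) + (\<Sum>s=n + 1..2 * n + 1. A s)"
    by (intro sum.union_disjoint) auto
  also have "(\<Sum>s\<le>n. A s) = (\<Sum>s=n + 1..2 * n + 1. A s)"
    by (rule sum.reindex_bij_witness[of _ "\<lambda>s. 2 * n + 1 - s" "\<lambda>s. 2 * n + 1 - s"]) (auto simp: assms[simplified])
  also have "(\<Sum>s=n + 1..2 * n + 1. A s) = (\<Sum>l=1..n + 1. A (n + l))"
    by (rule sum.reindex_bij_witness[of _ "\<lambda>l. n + l" "\<lambda>s. s - n"]) auto
  finally show ?thesis by simp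
qed

section \<open>Functional equations of the coefficients and the reduced linear system\<close>

context qdisc
begin

definition wt :: "nat \<Rightarrow> nat \<Rightarrow> int \<Rightarrow> complex" where
  "wt n l r = (-1) powi r * q powi wexp n l r"

lemma norm_wt_le:
  assumes "l \<in> {1..n + 1}"
  shows "norm (wt n l r) \<le> norm q ^ nat \<bar>r\<bar>"
proof -
  have "norm (wt n l r) = norm q ^ nat (wexp n l r)"
    using wexp_ge[OF assms, of r] by (simp add: wt_def norm_mult norm_power norm_power_int power_int_nonneg_exp)
  also have "\<dots> \<le> norm q ^ nat \<bar>r\<bar>"
    using wexp_ge[OF assms, of r] norm_q by (intro power_decreasing) auto
  finally show ?thesis .
qed

text \<open>Inverting x contributes one sign for each of the 2n theta factors, an even number, and
  the monomial x^(-2-(2n-1)).\<close>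

lemma bosF_coeff_symmetric:
  assumes n: "n > 0" and F: "laurent (bosF n) c"
  shows "c (2 * int n + 1 - k) = c k"
proof -
  have "laurent (\<lambda>x. bosF n (1 / x)) (\<lambda>k. c (k - (- (2 * int n + 1))))"
  proof (rule laurent_cong[OF laurent_shift[OF F]])
    fix x :: complex assume x: "x \<noteq> 0"
    have "theta ((1 / x)\<^sup>2) = - theta (x\<^sup>2) / x\<^sup>2"
      using theta_inverse[of "x\<^sup>2"] x by (simp add: power_one_over)
    moreover have "theta (1 / x) ^ (2 * n - 1) = - (theta x ^ (2 * n - 1) / x ^ (2 * n - 1))"
      unfolding theta_inverse[OF x] using n by (simp add: power_divide)
    moreover have "x powi (- (2 * int n + 1)) = 1 / (x\<^sup>2 * x ^ (2 * n - 1))"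
    proof -
      have e: "- (2 * int n + 1) = - int (2 + (2 * n - 1))" using n by (simp add: of_nat_diff)
      show ?thesis unfolding e power_int_minus power_int_of_nat power_add by (simp add: divide_inverse)
    qed
    ultimately show "x powi (- (2 * int n + 1)) * bosF n x = bosF n (1 / x)"
      by (simp add: bosF_def)
  qed
  from fun_cong[OF laurent_unique[OF laurent_inverse[OF F] this], of "- k"]
  show ?thesis by (simp add: algebra_simps)
qed

text \<open>Under x -> qx the argument of theta(x^2) moves by q^2, which costs 1/(q x^4); each other
  factor costs -1/x. The degrees add up to 2n + 3.\<close>

lemma bosF_coeff_shift:
  assumes q: "q \<noteq> 0" and n: "n > 0" and F: "laurent (bosF n) c"
  shows "c (k + (2 * int n + 3)) = - (q powi (k + 1) * c k)"
proof -
  have "laurent (\<lambda>x. bosF n (q * x)) (\<lambda>k. - (1 / q) * c (k - (- (2 * int n + 3))))"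
  proof (rule laurent_cong[OF laurent_cmult[OF laurent_shift[OF F]]])
    fix x :: complex assume x: "x \<noteq> 0"
    have "(q * x)\<^sup>2 = q * (q * x\<^sup>2)" by (simp add: power2_eq_square)
    then have "theta ((q * x)\<^sup>2) = theta (x\<^sup>2) / (q * (x\<^sup>2 * x\<^sup>2))"
      using theta_q_mult[of "q * x\<^sup>2"] theta_q_mult[of "x\<^sup>2"] x q by simp
    moreover have "theta (q * x) ^ (2 * n - 1) = - (theta x ^ (2 * n - 1) / x ^ (2 * n - 1))"
      unfolding theta_q_mult[OF x q] using n by (simp add: power_divide)
    moreover have "x powi (- (2 * int n + 3)) = 1 / ((x\<^sup>2 * x\<^sup>2) * x ^ (2 * n - 1))"
    proof -
      have e: "- (2 * int n + 3) = - int (2 + 2 + (2 * n - 1))" using n by (simp add: of_nat_diff)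
      show ?thesis unfolding e power_int_minus power_int_of_nat power_add by (simp add: divide_inverse)
    qed
    ultimately show "- (1 / q) * (x powi (- (2 * int n + 3)) * bosF n x) = bosF n (q * x)"
      by (simp add: bosF_def)
  qed
  from fun_cong[OF laurent_unique[OF laurent_scale[OF F q] this], of k]
  have "c k * q powi k = - (1 / q) * c (k + (2 * int n + 3))" unfolding diff_minus_eq_add .
  then show ?thesis using q by (simp add: power_int_add field_simps)
qed

lemma bosF_coeff_shift_multiple:
  assumes q: "q \<noteq> 0" and n: "n > 0" and F: "laurent (bosF n) c"
  shows "c (k + (2 * int n + 3) * r) = (-1) powi r * q powi (r * (k + 1) + (2 * int n + 3) * tri r) * c k"
proof -
  define K where "K = 2 * int n + 3"
  have up: "c (k + K * (r + 1)) = - (q powi (k + K * r + 1) * c (k + K * r))" for r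
    using bosF_coeff_shift[OF q n F, of "k + K * r"] by (simp add: K_def algebra_simps)
  have e: "(r + 1) * (k + 1) + K * tri (r + 1) = (r * (k + 1) + K * tri r) + (k + K * r + 1)" for r
    by (simp add: tri_add algebra_simps)
  have "c (k + K * r) = (-1) powi r * q powi (r * (k + 1) + K * tri r) * c k"
  proof (induction r rule: int_induct[where k = 0])
    case (step1 r)
    then show ?case unfolding up e using q by (simp add: power_int_add)
  next
    case (step2 r)
    have "(-1) powi r * q powi (r * (k + 1) + K * tri r) * c k
        = - (q powi (k + K * (r - 1) + 1) * ((-1) powi (r - 1) * q powi ((r - 1) * (k + 1) + K * tri (r - 1)) * c k))"
      using e[of "r - 1"] q by (simp add: power_int_add power_int_diff)
    moreover have "c (k + K * r) = - (q powi (k + K * (r - 1) + 1) * c (k + K * (r - 1)))"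
      using up[of "r - 1"] by simp
    ultimately have "q powi (k + K * (r - 1) + 1) * c (k + K * (r - 1))
        = q powi (k + K * (r - 1) + 1) * ((-1) powi (r - 1) * q powi ((r - 1) * (k + 1) + K * tri (r - 1)) * c k)"
      using step2 by (metis neg_equal_iff_equal)
    moreover have "q powi (k + K * (r - 1) + 1) \<noteq> 0" using q by simp
    ultimately show ?case by (metis mult_left_cancel)
  qed simp
  then show ?thesis unfolding K_def .
qed

lemma bosF_coeff_class:
  assumes "q \<noteq> 0" "n > 0" "laurent (bosF n) c"
  shows "c (int (n + l) + (2 * int n + 3) * r) = wt n l r * c (int (n + l))"
proof -
  have "2 * (r * (int (n + l) + 1) + (2 * int n + 3) * tri r) = 2 * wexp n l r"
    using arg_cong[OF two_tri[of r], of "\<lambda>u. (2 * int n + 3) * u"] by (simp add: two_wexp algebra_simps)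
  then have "r * (int (n + l) + 1) + (2 * int n + 3) * tri r = wexp n l r" by simp
  then show ?thesis
    using bosF_coeff_shift_multiple[OF assms, of "int (n + l)" r] by (simp add: wt_def)
qed

text \<open>The shift from index -1 carries the power q^0, so it gives c(2n+2) = - c(-1), while the
  symmetry gives c(2n+2) = c(-1). Of the 2n + 3 residue classes, 2n + 2 remain, and the symmetry
  pairs them into n + 1.\<close>

lemma bosF_coeff_zero:
  assumes "q \<noteq> 0" "n > 0" "laurent (bosF n) c"
  shows "c (2 * int n + 2 + (2 * int n + 3) * r) = 0"
proof -
  have e1: "- 1 + (2 * int n + 3) = 2 * int n + 2" and e2: "2 * int n + 1 - (- 1) = 2 * int n + 2" by simp_all
  have "c (2 * int n + 2) = - (q powi (- 1 + 1) * c (- 1))"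
    using bosF_coeff_shift[OF assms, of "- 1"] unfolding e1 .
  moreover have "c (2 * int n + 2) = c (- 1)"
    using bosF_coeff_symmetric[OF assms(2,3), of "- 1"] unfolding e2 .
  ultimately have "c (2 * int n + 2) = 0" by simp
  then show ?thesis
    unfolding bosF_coeff_shift_multiple[OF assms] by simp
qed

lemma wt_poly_abs_summable:
  assumes l: "l \<in> {1..n + 1}"
  shows "(\<lambda>r. norm (wt n l r * poly p (zval n l r))) summable_on UNIV"
proof -
  define C where "C = real (2 * n + 3) ^ 2"
  define b where "b k = (\<Sum>i\<le>degree p. norm (coeff p i) * C ^ i * ((1 + real k) ^ (2 * i) * norm q ^ k))" for k
  have "summable b"
    unfolding b_def using norm_q by (intro summable_sum summable_mult summable_polynomial_geometric) auto
  then have b: "(\<lambda>r::int. b (nat \<bar>r\<bar>)) summable_on UNIV"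
    by (rule summable_on_int_abs) (auto simp: b_def C_def intro!: sum_nonneg)
  show ?thesis
  proof (rule summable_on_comparison_test[OF b])
    fix r :: int
    have "norm (poly p (zval n l r)) \<le> (\<Sum>i\<le>degree p. norm (coeff p i) * (C * (1 + real (nat \<bar>r\<bar>)) ^ 2) ^ i)"
      unfolding poly_altdef
    proof (rule sum_norm_le)
      fix i
      show "norm (coeff p i * zval n l r ^ i) \<le> norm (coeff p i) * (C * (1 + real (nat \<bar>r\<bar>)) ^ 2) ^ i"
        unfolding norm_mult norm_power C_def by (intro mult_left_mono power_mono norm_zval_le[OF l]) auto
    qed
    then have "norm (wt n l r * poly p (zval n l r))
        \<le> norm q ^ nat \<bar>r\<bar> * (\<Sum>i\<le>degree p. norm (coeff p i) * (C * (1 + real (nat \<bar>r\<bar>)) ^ 2) ^ i)"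
      unfolding norm_mult by (intro mult_mono norm_wt_le[OF l]) auto
    also have "\<dots> = b (nat \<bar>r\<bar>)"
      unfolding b_def sum_distrib_left power_mult power_mult_distrib by (intro sum.cong refl) (simp add: mult_ac)
    finally show "norm (wt n l r * poly p (zval n l r)) \<le> b (nat \<bar>r\<bar>)" .
  qed auto
qed

text \<open>The sum over all k is sorted by residues modulo 2n + 3. The class 2n + 2 vanishes, and k
  -> 2n + 1 - k pairs the others, whence the division by 2. What remains is k = n + l + (2n+3) r,
  for which (k - n - 1/2)^2 is \<open>zval n l r\<close>.\<close>

lemma moment_functional:
  assumes q: "q \<noteq> 0" and n: "n > 0" and F: "laurent (bosF n) c"
  shows "(\<Sum>l=1..n + 1. c (int (n + l)) * (\<Sum>\<^sub>\<infinity>r. wt n l r * poly p (zval n l r)))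
    = (\<Sum>i\<le>degree p. coeff p i * moment c (of_nat n + 1 / 2) (2 * i)) / 2"
proof -
  define \<alpha> :: complex where "\<alpha> = of_nat n + 1 / 2"
  define g where "g k = c k * poly p ((of_int k - \<alpha>)\<^sup>2)" for k :: int
  define K where "K = 2 * n + 3"
  have g_sum: "(g has_sum (\<Sum>i\<le>degree p. coeff p i * moment c \<alpha> (2 * i))) UNIV"
  proof -
    have "((\<lambda>k. \<Sum>i\<le>degree p. coeff p i * (c k * (of_int k - \<alpha>) ^ (2 * i))) has_sum
       (\<Sum>i\<le>degree p. coeff p i * moment c \<alpha> (2 * i))) UNIV"
      unfolding moment_def by (intro has_sum_sum has_sum_cmult_right has_sum_infsum laurent_moment_summable[OF F])
    also have "(\<lambda>k. \<Sum>i\<le>degree p. coeff p i * (c k * (of_int k - \<alpha>) ^ (2 * i))) = g"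
      unfolding g_def poly_altdef sum_distrib_left power_mult by (intro ext sum.cong refl) (simp add: mult_ac)
    finally show ?thesis .
  qed
  have g_sym: "g (2 * int n + 1 - k) = g k" for k
  proof -
    have "(of_int (2 * int n + 1 - k) - \<alpha>)\<^sup>2 = (of_int k - \<alpha>)\<^sup>2"
      by (simp add: \<alpha>_def power2_eq_square field_simps)
    then show ?thesis
      by (simp only: g_def bosF_coeff_symmetric[OF n F])
  qed
  define A where "A s = (\<Sum>\<^sub>\<infinity>r. g (int s + int K * r))" for s
  have bij: "bij_betw (\<lambda>(s, r). int s + int K * r) ({..<K} \<times> UNIV) UNIV"
    by (rule bij_betwI[of _ _ _ "\<lambda>k. (nat (k mod int K), k div int K)"])
       (auto simp: K_def nat_less_iff)
  have "((\<lambda>p. g ((\<lambda>(s, r). int s + int K * r) p)) has_sum (\<Sum>i\<le>degree p. coeff p i * moment c \<alpha> (2 * i))) ({..<K} \<times> UNIV)"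
    by (subst has_sum_reindex_bij_betw[OF bij]) (rule g_sum)
  then have hs: "((\<lambda>(s, r). g (int s + int K * r)) has_sum (\<Sum>i\<le>degree p. coeff p i * moment c \<alpha> (2 * i))) ({..<K} \<times> UNIV)"
    by (simp add: case_prod_unfold)
  have A: "((\<lambda>r. g (int s + int K * r)) has_sum A s) UNIV" if "s < K" for s
    unfolding A_def using summable_on_SigmaD1[OF has_sum_imp_summable[OF hs], of s] that
    by (intro has_sum_infsum) auto
  have "(A has_sum (\<Sum>i\<le>degree p. coeff p i * moment c \<alpha> (2 * i))) {..<K}"
    by (rule has_sum_SigmaD[OF hs]) (simp add: A)
  then have "(\<Sum>i\<le>degree p. coeff p i * moment c \<alpha> (2 * i)) = (\<Sum>s<K. A s)"
    using has_sum_finite[of "{..<K}" A] has_sum_unique by blast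
  also have "{..<K} = insert (2 * n + 2) {..2 * n + 1}"
    by (auto simp: K_def)
  also have "(\<Sum>s\<in>insert (2 * n + 2) {..2 * n + 1}. A s) = A (2 * n + 2) + (\<Sum>s\<le>2 * n + 1. A s)"
    by (rule sum.insert) auto
  also have "A (2 * n + 2) = 0"
  proof -
    have e: "int (2 * n + 2) + int K * r = 2 * int n + 2 + (2 * int n + 3) * r" for r by (simp add: K_def)
    show ?thesis
      unfolding A_def e g_def bosF_coeff_zero[OF q n F] by simp
  qed
  also have "(\<Sum>s\<le>2 * n + 1. A s) = 2 * (\<Sum>l=1..n + 1. A (n + l))"
  proof (rule sum_fold_symmetric)
    fix s assume s: "s \<le> 2 * n + 1"
    have "g (int (2 * n + 1 - s) + int K * r) = g (int s + int K * (- r))" for r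
    proof -
      have "int (2 * n + 1 - s) + int K * r = 2 * int n + 1 - (int s + int K * (- r))" using s by simp
      then show ?thesis by (simp only: g_sym)
    qed
    then have "A (2 * n + 1 - s) = (\<Sum>\<^sub>\<infinity>r. g (int s + int K * (- r)))"
      by (simp add: A_def)
    also have "\<dots> = A s"
      unfolding A_def by (rule infsum_reindex_bij_witness[of _ uminus uminus]) auto
    finally show "A (2 * n + 1 - s) = A s" .
  qed
  finally have "(\<Sum>i\<le>degree p. coeff p i * moment c \<alpha> (2 * i)) = 0 + 2 * (\<Sum>l=1..n + 1. A (n + l))" .
  moreover have "A (n + l) = c (int (n + l)) * (\<Sum>\<^sub>\<infinity>r. wt n l r * poly p (zval n l r))" for l
  proof -
    have "g (int (n + l) + int K * r) = c (int (n + l)) * (wt n l r * poly p (zval n l r))" for r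
    proof -
      have "int (n + l) + int K * r = int (n + l) + (2 * int n + 3) * r" by (simp add: K_def)
      then have "c (int (n + l) + int K * r) = wt n l r * c (int (n + l))"
        by (simp only: bosF_coeff_class[OF q n F])
      moreover have "(of_int (int (n + l) + int K * r) - \<alpha>)\<^sup>2 = zval n l r"
        by (simp add: zval_def \<alpha>_def K_def algebra_simps)
      ultimately show ?thesis by (simp only: g_def) simp
    qed
    then show ?thesis by (simp add: A_def infsum_cmult_right')
  qed
  ultimately show ?thesis by (simp add: \<alpha>_def)
qed

end

section \<open>Vandermonde sums and Cramer's rule\<close>

text \<open>Arbitrary index sets allow the deletion of a single row; the orientation is that of the
  products in \<open>xi\<close>.\<close>

definition vdm :: "nat set \<Rightarrow> (nat \<Rightarrow> complex) \<Rightarrow> complex" where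
  "vdm I z = (\<Prod>(i, j)\<in>{(i, j). i \<in> I \<and> j \<in> I \<and> i < j}. z i - z j)"

lemma vdm_cong: "(\<And>i. i \<in> I \<Longrightarrow> z i = z' i) \<Longrightarrow> vdm I z = vdm I z'"
  unfolding vdm_def by (intro prod.cong) auto

lemma vdm_split:
  assumes I: "finite I" and j: "j \<in> I"
  shows "vdm I z = (-1) ^ card {i \<in> I. i < j} * vdm (I - {j}) z * (\<Prod>i\<in>I - {j}. z j - z i)"
proof -
  define A where "A = {i \<in> I. i < j}"
  define B where "B = {i \<in> I. j < i}"
  have fin: "finite A" "finite B" using I by (auto simp: A_def B_def)
  have pairs: "{(i, k). i \<in> I \<and> k \<in> I \<and> i < k}
      = {(i, k). i \<in> I - {j} \<and> k \<in> I - {j} \<and> i < k} \<union> ((\<lambda>i. (i, j)) ` A \<union> (\<lambda>k. (j, k)) ` B)"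
    using j by (auto simp: A_def B_def)
  have fin': "finite {(i, k). i \<in> I - {j} \<and> k \<in> I - {j} \<and> i < k}"
    by (rule finite_subset[of _ "I \<times> I"]) (use I in auto)
  have "vdm I z = vdm (I - {j}) z * ((\<Prod>i\<in>A. z i - z j) * (\<Prod>k\<in>B. z j - z k))"
  proof -
    have "vdm I z = vdm (I - {j}) z * (\<Prod>(i, k)\<in>(\<lambda>i. (i, j)) ` A \<union> (\<lambda>k. (j, k)) ` B. z i - z k)"
      unfolding vdm_def pairs by (rule prod.union_disjoint) (use fin fin' in auto)
    also have "(\<Prod>(i, k)\<in>(\<lambda>i. (i, j)) ` A \<union> (\<lambda>k. (j, k)) ` B. z i - z k)
        = (\<Prod>(i, k)\<in>(\<lambda>i. (i, j)) ` A. z i - z k) * (\<Prod>(i, k)\<in>(\<lambda>k. (j, k)) ` B. z i - z k)"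
      by (rule prod.union_disjoint) (use fin in \<open>auto simp: A_def B_def\<close>)
    finally show ?thesis by (simp add: prod.reindex inj_on_def)
  qed
  also have "(\<Prod>i\<in>A. z i - z j) = (\<Prod>i\<in>A. (-1) * (z j - z i))"
    by (intro prod.cong) auto
  also have "\<dots> = (-1) ^ card A * (\<Prod>i\<in>A. z j - z i)"
    by (simp only: prod.distrib prod_constant)
  also have "vdm (I - {j}) z * ((-1) ^ card A * (\<Prod>i\<in>A. z j - z i) * (\<Prod>k\<in>B. z j - z k))
      = (-1) ^ card A * vdm (I - {j}) z * ((\<Prod>i\<in>A. z j - z i) * (\<Prod>k\<in>B. z j - z k))"
    by simp
  also have "(\<Prod>i\<in>A. z j - z i) * (\<Prod>k\<in>B. z j - z k) = (\<Prod>i\<in>A \<union> B. z j - z i)"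
    by (rule prod.union_disjoint[symmetric]) (use fin in \<open>auto simp: A_def B_def\<close>)
  also have "A \<union> B = I - {j}" by (auto simp: A_def B_def)
  finally show ?thesis unfolding A_def .
qed

lemma norm_diff_le_prod: "norm (a - b) \<le> (1 + norm a) * (1 + norm (b :: 'a :: real_normed_vector))"
proof -
  have "norm (a - b) \<le> norm a + norm b" by (rule norm_triangle_ineq4)
  also have "\<dots> \<le> (1 + norm a) * (1 + norm b)" by (simp add: algebra_simps)
  finally show ?thesis .
qed

text \<open>Crude, but a product of functions of one variable each, so that multiple sums
  separate.\<close>

lemma norm_vdm_le:
  assumes I: "finite I"
  shows "norm (vdm I z) \<le> (\<Prod>i\<in>I. (1 + norm (z i)) ^ (2 * card I))"
proof -
  define P where "P = {(i, j). i \<in> I \<and> j \<in> I \<and> i < j}"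
  define f where "f i = 1 + norm (z i)" for i
  have sub: "P \<subseteq> I \<times> I" by (auto simp: P_def)
  have f: "f i \<ge> 1" for i by (simp add: f_def)
  have "norm (vdm I z) = (\<Prod>(i, j)\<in>P. norm (z i - z j))"
    unfolding vdm_def P_def by (simp add: prod_norm[symmetric] case_prod_unfold)
  also have "\<dots> \<le> (\<Prod>(i, j)\<in>P. f i * f j)"
    by (rule prod_mono) (auto simp: f_def norm_diff_le_prod)
  also have "\<dots> \<le> (\<Prod>(i, j)\<in>I \<times> I. f i * f j)"
  proof (rule prod_mono2[OF _ sub])
    show "1 \<le> (case b of (i, j) \<Rightarrow> f i * f j)" for b
      using f mult_mono[of 1 "f (fst b)" 1 "f (snd b)"] by (auto simp: case_prod_unfold order_trans[OF zero_le_one f])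
    show "0 \<le> (case b of (i, j) \<Rightarrow> f i * f j)" for b
      by (auto simp: f_def case_prod_unfold)
  qed (use I in auto)
  also have "\<dots> = (\<Prod>i\<in>I. \<Prod>j\<in>I. f i * f j)"
    by (rule prod.cartesian_product[symmetric])
  also have "\<dots> = (\<Prod>i\<in>I. f i ^ (2 * card I))"
    by (simp add: prod.distrib prod_power_distrib power_mult power2_eq_square power_mult_distrib mult.commute[of 2])
  finally show ?thesis by (simp add: f_def)
qed

lemma norm_sum_le_prod:
  fixes z :: "'b \<Rightarrow> complex"
  shows "norm (\<Sum>i\<in>I. z i) \<le> (\<Prod>i\<in>I. 1 + norm (z i))"
proof -
  have "norm (\<Sum>i\<in>I. z i) \<le> (\<Sum>i\<in>I. norm (z i))" by (rule norm_sum)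
  also have "\<dots> \<le> (\<Prod>i\<in>I. 1 + norm (z i))" by (rule sum_le_prod) auto
  finally show ?thesis .
qed

lemma linear_prod_poly:
  fixes a :: "'b \<Rightarrow> 'a :: idom"
  assumes "finite A"
  defines "p \<equiv> (\<Prod>i\<in>A. [:- a i, 1:])"
  shows "degree p = card A" "coeff p (card A) = 1"
    "card A > 0 \<Longrightarrow> coeff p (card A - 1) = - (\<Sum>i\<in>A. a i)"
proof -
  have "degree p = card A \<and> coeff p (card A) = 1 \<and> (card A > 0 \<longrightarrow> coeff p (card A - 1) = - (\<Sum>i\<in>A. a i))"
    using assms(1) unfolding p_def
  proof (induction A rule: finite_induct)
    case (insert b A)
    define p where "p = (\<Prod>i\<in>A. [:- a i, 1:])"
    have p: "degree p = card A" "coeff p (card A) = 1" "card A > 0 \<longrightarrow> coeff p (card A - 1) = - (\<Sum>i\<in>A. a i)"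
      using insert.IH by (simp_all add: p_def)
    have p0: "p \<noteq> 0" using p(2) by auto
    have "degree ([:- a b, 1:] * p) = Suc (card A)"
      using degree_mult_eq[of "[:- a b, 1:]" p] p0 p(1) by simp
    moreover have "coeff ([:- a b, 1:] * p) (Suc (card A)) = 1"
      using p by (simp add: coeff_eq_0)
    moreover have "coeff ([:- a b, 1:] * p) (card A) = - (a b + (\<Sum>i\<in>A. a i))"
    proof (cases "card A")
      case 0
      then show ?thesis using p insert.hyps by simp
    next
      case (Suc k)
      then show ?thesis using p by simp
    qed
    ultimately show ?case
      using insert.hyps by (simp add: p_def)
  qed simp
  then show "degree p = card A" "coeff p (card A) = 1"
    "card A > 0 \<Longrightarrow> coeff p (card A - 1) = - (\<Sum>i\<in>A. a i)" by auto
qed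

section \<open>Vandermonde sums over residue classes\<close>

context qdisc
begin

text \<open>The power of the sum of squares is symmetric and leaves the alternating structure
  intact. The sums of interest have \<open>e = 0\<close>; \<open>e = 1\<close> serves Macdonald's
  identity.\<close>

definition wterm :: "nat \<Rightarrow> nat \<Rightarrow> nat set \<Rightarrow> (nat \<Rightarrow> int) \<Rightarrow> complex" where
  "wterm n e I r = (\<Sum>i\<in>I. zval n i (r i)) ^ e * vdm I (\<lambda>i. zval n i (r i)) * (\<Prod>i\<in>I. wt n i (r i))"

definition wsum :: "nat \<Rightarrow> nat \<Rightarrow> nat set \<Rightarrow> complex" where
  "wsum n e I = (\<Sum>\<^sub>\<infinity>r\<in>PiE I (\<lambda>_. UNIV). wterm n e I r)"

text \<open>A row of class \<open>l\<close> with its own summation variable is added to the rows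
  \<open>J\<close>. If \<open>l\<close> is not in \<open>J\<close>, this is \<open>wterm\<close> of
  the larger set up to sign; if \<open>l\<close> is in \<open>J\<close>, two rows run over the same
  class and the total sum vanishes.\<close>

definition split_term :: "nat \<Rightarrow> nat \<Rightarrow> nat set \<Rightarrow> nat \<Rightarrow> int \<times> (nat \<Rightarrow> int) \<Rightarrow> complex" where
  "split_term n e J l = (\<lambda>(x, r). ((\<Sum>i\<in>J. zval n i (r i)) + zval n l x) ^ e * vdm J (\<lambda>i. zval n i (r i))
     * (\<Prod>i\<in>J. zval n l x - zval n i (r i)) * (\<Prod>i\<in>J. wt n i (r i)) * wt n l x)"

lemma wt_power_summable:
  assumes "l \<in> {1..n + 1}"
  shows "(\<lambda>r. (1 + norm (zval n l r)) ^ m * norm (wt n l r)) summable_on UNIV"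
proof -
  have "((\<lambda>r. \<Sum>k\<le>m. real (m choose k) * norm (wt n l r * poly (monom 1 k) (zval n l r))) has_sum
      (\<Sum>k\<le>m. real (m choose k) * (\<Sum>\<^sub>\<infinity>r. norm (wt n l r * poly (monom 1 k) (zval n l r))))) UNIV"
    by (intro has_sum_sum has_sum_cmult_right has_sum_infsum wt_poly_abs_summable[OF assms])
  then have "(\<lambda>r. \<Sum>k\<le>m. real (m choose k) * norm (wt n l r * poly (monom 1 k) (zval n l r))) summable_on UNIV"
    by (rule has_sum_imp_summable)
  also have "(\<lambda>r. \<Sum>k\<le>m. real (m choose k) * norm (wt n l r * poly (monom 1 k) (zval n l r)))
      = (\<lambda>r. (1 + norm (zval n l r)) ^ m * norm (wt n l r))"
    unfolding add.commute[of 1] binomial_ring sum_distrib_right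
    by (intro ext sum.cong refl) (simp add: poly_monom norm_mult norm_power mult_ac)
  finally show ?thesis .
qed

lemma split_term_abs_summable:
  assumes l: "l \<in> {1..n + 1}" and J: "J \<subseteq> {1..n + 1}"
  shows "(\<lambda>p. norm (split_term n e J l p)) summable_on UNIV \<times> PiE J (\<lambda>_. UNIV)"
proof -
  have fin: "finite J" using J by (rule finite_subset) auto
  define A where "A x = (1 + norm (zval n l x)) ^ (card J + e) * norm (wt n l x)" for x
  define m where "m = 2 * card J + 1 + e"
  define B where "B r = (\<Prod>i\<in>J. (1 + norm (zval n i (r i))) ^ m * norm (wt n i (r i)))" for r
  have A: "A summable_on UNIV" unfolding A_def by (rule wt_power_summable[OF l])
  have B: "B summable_on PiE J (\<lambda>_. UNIV)"
    unfolding B_def by (rule summable_on_prod_PiE[OF fin])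
      (use J in \<open>auto intro!: wt_power_summable\<close>)
  have A0: "A x \<ge> 0" for x by (simp add: A_def)
  have B0: "B r \<ge> 0" for r unfolding B_def by (intro prod_nonneg) auto
  have "(\<lambda>p. norm (case p of (x, r) \<Rightarrow> A x * B r)) summable_on UNIV \<times> PiE J (\<lambda>_. UNIV)"
    by (rule abs_summable_on_times) (use A B A0 B0 in simp_all)
  then show ?thesis
  proof (rule summable_on_comparison_test)
    fix p :: "int \<times> (nat \<Rightarrow> int)"
    obtain x r where p: "p = (x, r)" by (cases p)
    define X where "X = 1 + norm (zval n l x)"
    define f where "f i = 1 + norm (zval n i (r i))" for i
    have X: "X \<ge> 1" and f: "f i \<ge> 1" for i by (simp_all add: X_def f_def)
    have F: "(\<Prod>i\<in>J. f i) \<ge> 1" using f by (intro prod_ge_1) auto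
    have 1: "norm ((\<Sum>i\<in>J. zval n i (r i)) + zval n l x) \<le> X * (\<Prod>i\<in>J. f i)"
    proof -
      have "norm ((\<Sum>i\<in>J. zval n i (r i)) + zval n l x) \<le> norm (\<Sum>i\<in>J. zval n i (r i)) + norm (zval n l x)"
        by (rule norm_triangle_ineq)
      also have "\<dots> \<le> (\<Prod>i\<in>J. f i) + norm (zval n l x) * (\<Prod>i\<in>J. f i)"
        using F unfolding f_def
        by (intro add_mono norm_sum_le_prod) (simp add: mult_left_le mult_le_cancel_left1)
      finally show ?thesis by (simp add: X_def algebra_simps)
    qed
    have 2: "norm (vdm J (\<lambda>i. zval n i (r i))) \<le> (\<Prod>i\<in>J. f i ^ (2 * card J))"
      unfolding f_def by (rule norm_vdm_le[OF fin])
    have 3: "norm (\<Prod>i\<in>J. zval n l x - zval n i (r i)) \<le> X ^ card J * (\<Prod>i\<in>J. f i)"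
    proof -
      have "norm (\<Prod>i\<in>J. zval n l x - zval n i (r i)) = (\<Prod>i\<in>J. norm (zval n l x - zval n i (r i)))"
        by (simp add: prod_norm)
      also have "\<dots> \<le> (\<Prod>i\<in>J. X * f i)"
        unfolding X_def f_def by (intro prod_mono conjI norm_diff_le_prod) auto
      finally show ?thesis by (simp add: prod.distrib)
    qed
    have "norm (split_term n e J l p) = norm ((\<Sum>i\<in>J. zval n i (r i)) + zval n l x) ^ e
        * norm (vdm J (\<lambda>i. zval n i (r i))) * norm (\<Prod>i\<in>J. zval n l x - zval n i (r i))
        * ((\<Prod>i\<in>J. norm (wt n i (r i))) * norm (wt n l x))"
      by (simp add: split_term_def p norm_mult norm_power prod_norm)
    also have "\<dots> \<le> (X * (\<Prod>i\<in>J. f i)) ^ e * (\<Prod>i\<in>J. f i ^ (2 * card J)) * (X ^ card J * (\<Prod>i\<in>J. f i))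
        * ((\<Prod>i\<in>J. norm (wt n i (r i))) * norm (wt n l x))"
      using X f by (intro mult_right_mono mult_mono power_mono 1 2 3)
        (auto intro!: prod_nonneg mult_nonneg_nonneg zero_le_power simp: f_def X_def)
    also have "\<dots> = A x * B r"
      by (simp add: A_def B_def m_def X_def[symmetric] f_def[symmetric] prod.distrib prod_power_distrib power_add
          power_mult_distrib mult_ac)
    finally show "norm (split_term n e J l p) \<le> norm (case p of (x, r) \<Rightarrow> A x * B r)"
      using A0 B0 by (simp add: p)
  qed auto
qed

lemma wterm_upd:
  assumes "finite J" "j \<notin> J"
  shows "wterm n e (insert j J) (r(j := x)) = (-1) ^ card {i \<in> insert j J. i < j} * split_term n e J j (x, r)"
proof -
  have eqs: "zval n i ((r(j := x)) i) = zval n i (r i)" "wt n i ((r(j := x)) i) = wt n i (r i)" if "i \<in> J" for i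
    using that assms by auto
  have J: "insert j J - {j} = J" using assms by auto
  have "vdm (insert j J) (\<lambda>i. zval n i ((r(j := x)) i))
      = (-1) ^ card {i \<in> insert j J. i < j} * vdm J (\<lambda>i. zval n i ((r(j := x)) i))
        * (\<Prod>i\<in>J. zval n j ((r(j := x)) j) - zval n i ((r(j := x)) i))"
    using vdm_split[of "insert j J" j] assms unfolding J by simp
  also have "vdm J (\<lambda>i. zval n i ((r(j := x)) i)) = vdm J (\<lambda>i. zval n i (r i))"
    by (rule vdm_cong) (rule eqs)
  also have "(\<Prod>i\<in>J. zval n j ((r(j := x)) j) - zval n i ((r(j := x)) i)) = (\<Prod>i\<in>J. zval n j x - zval n i (r i))"
    by (intro prod.cong refl) (use assms in auto)
  finally have v: "vdm (insert j J) (\<lambda>i. zval n i ((r(j := x)) i))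
      = (-1) ^ card {i \<in> insert j J. i < j} * vdm J (\<lambda>i. zval n i (r i)) * (\<Prod>i\<in>J. zval n j x - zval n i (r i))" .
  have s': "(\<Sum>i\<in>J. zval n i ((r(j := x)) i)) = (\<Sum>i\<in>J. zval n i (r i))"
    and w': "(\<Prod>i\<in>J. wt n i ((r(j := x)) i)) = (\<Prod>i\<in>J. wt n i (r i))"
    by (intro sum.cong prod.cong refl; use assms in auto)+
  have s: "(\<Sum>i\<in>insert j J. zval n i ((r(j := x)) i)) = (\<Sum>i\<in>J. zval n i (r i)) + zval n j x"
    and w: "(\<Prod>i\<in>insert j J. wt n i ((r(j := x)) i)) = wt n j x * (\<Prod>i\<in>J. wt n i (r i))"
    unfolding sum.insert[OF assms] prod.insert[OF assms] s' w' by simp_all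
  show ?thesis
    unfolding wterm_def v s w by (simp add: split_term_def mult_ac)
qed

lemma wterm_abs_summable:
  assumes "I \<subseteq> {1..n + 1}"
  shows "(\<lambda>r. norm (wterm n e I r)) summable_on PiE I (\<lambda>_. UNIV)"
proof (cases "I = {}")
  case False
  then obtain j where j: "j \<in> I" by auto
  define J where "J = I - {j}"
  have I: "I = insert j J" "j \<notin> J" "finite J"
    using j finite_subset[OF assms] by (auto simp: J_def)
  have "(\<lambda>p. norm (wterm n e I ((\<lambda>(x, r). r(j := x)) p))) summable_on UNIV \<times> PiE J (\<lambda>_. UNIV)"
    unfolding I(1) using split_term_abs_summable[of j n J e] assms I
    by (simp add: case_prod_unfold wterm_upd norm_mult norm_power)
  then show ?thesis
    unfolding I(1) by (subst (asm) summable_on_reindex_bij_betw[OF PiE_insert_bij[OF I(2), of "\<lambda>_. UNIV"]])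
qed simp

lemma split_term_swap:
  assumes J: "finite J" and l: "l \<in> J"
  shows "split_term n e J l (r l, r(l := x)) = - split_term n e J l (x, r)"
proof -
  define s where "s = (-1 :: complex) ^ card {i \<in> J. i < l}"
  define J' where "J' = J - {l}"
  have J': "J = insert l J'" "finite J'" "l \<notin> J'" using J l by (auto simp: J'_def)
  have eq: "split_term n e J l (a, r(l := b)) = ((\<Sum>i\<in>J'. zval n i (r i)) + zval n l b + zval n l a) ^ e
      * (s * vdm J' (\<lambda>i. zval n i (r i)) * (\<Prod>i\<in>J'. zval n l b - zval n i (r i)))
      * ((zval n l a - zval n l b) * (\<Prod>i\<in>J'. zval n l a - zval n i (r i)))
      * (wt n l b * (\<Prod>i\<in>J'. wt n i (r i))) * wt n l a" for a b
  proof -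
    have eqs: "(r(l := b)) i = r i" if "i \<in> J'" for i using that J' by auto
    have v1: "vdm J' (\<lambda>i. zval n i ((r(l := b)) i)) = vdm J' (\<lambda>i. zval n i (r i))"
      by (rule vdm_cong) (simp only: eqs)
    have v2: "(\<Prod>i\<in>J'. zval n l ((r(l := b)) l) - zval n i ((r(l := b)) i)) = (\<Prod>i\<in>J'. zval n l b - zval n i (r i))"
      by (intro prod.cong refl) (simp only: eqs fun_upd_same)
    have v3: "(\<Sum>i\<in>J'. zval n i ((r(l := b)) i)) = (\<Sum>i\<in>J'. zval n i (r i))"
      by (intro sum.cong refl) (simp only: eqs)
    have v4: "(\<Prod>i\<in>J'. zval n l a - zval n i ((r(l := b)) i)) = (\<Prod>i\<in>J'. zval n l a - zval n i (r i))"
      by (intro prod.cong refl) (simp only: eqs)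
    have v5: "(\<Prod>i\<in>J'. wt n i ((r(l := b)) i)) = (\<Prod>i\<in>J'. wt n i (r i))"
      by (intro prod.cong refl) (simp only: eqs)
    have "vdm J (\<lambda>i. zval n i ((r(l := b)) i)) = s * vdm J' (\<lambda>i. zval n i (r i)) * (\<Prod>i\<in>J'. zval n l b - zval n i (r i))"
      unfolding vdm_split[OF J l] s_def J'_def[symmetric] v1 v2 ..
    moreover have "(\<Sum>i\<in>J. zval n i ((r(l := b)) i)) = (\<Sum>i\<in>J'. zval n i (r i)) + zval n l b"
      unfolding J'(1) sum.insert[OF J'(2,3)] v3 by (simp add: add.commute)
    moreover have "(\<Prod>i\<in>J. zval n l a - zval n i ((r(l := b)) i)) = (zval n l a - zval n l b) * (\<Prod>i\<in>J'. zval n l a - zval n i (r i))"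
      unfolding J'(1) prod.insert[OF J'(2,3)] v4 by simp
    moreover have "(\<Prod>i\<in>J. wt n i ((r(l := b)) i)) = wt n l b * (\<Prod>i\<in>J'. wt n i (r i))"
      unfolding J'(1) prod.insert[OF J'(2,3)] v5 by simp
    ultimately show ?thesis by (simp add: split_term_def)
  qed
  have "split_term n e J l (r l, r(l := x)) = - split_term n e J l (x, r(l := r l))"
    unfolding eq by (simp add: algebra_simps)
  then show ?thesis by simp
qed

text \<open>Exchanging the extra variable with the one at \<open>l\<close> is an involution of the
  index set that reverses the sign of every term.\<close>

lemma split_term_infsum_zero:
  assumes J: "finite J" and l: "l \<in> J"
  shows "(\<Sum>\<^sub>\<infinity>p\<in>UNIV \<times> PiE J (\<lambda>_. UNIV). split_term n e J l p) = 0"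
proof -
  define \<phi> where "\<phi> = (\<lambda>(x :: int, r :: nat \<Rightarrow> int). (r l, r(l := x)))"
  define S where "S = (\<Sum>\<^sub>\<infinity>p\<in>UNIV \<times> PiE J (\<lambda>_. UNIV). split_term n e J l p)"
  have "S = (\<Sum>\<^sub>\<infinity>p\<in>UNIV \<times> PiE J (\<lambda>_. UNIV). split_term n e J l (\<phi> p))"
    unfolding S_def
    by (rule infsum_reindex_bij_witness[of _ \<phi> \<phi>])
       (use l in \<open>auto simp: \<phi>_def PiE_def extensional_def\<close>)
  also have "\<dots> = (\<Sum>\<^sub>\<infinity>p\<in>UNIV \<times> PiE J (\<lambda>_. UNIV). - split_term n e J l p)"
    by (intro infsum_cong) (auto simp: \<phi>_def split_term_swap[OF J l])
  also have "\<dots> = - S" by (simp add: infsum_uminus S_def)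
  finally show ?thesis unfolding S_def by simp
qed

definition kappa :: "nat \<Rightarrow> (int \<Rightarrow> complex) \<Rightarrow> nat \<Rightarrow> complex" where
  "kappa n c e = moment c (of_nat n + 1 / 2) (2 * n + 2 * e) / 2"

text \<open>Moments below 2n vanish, so only the coefficients of y^n and y^(n+1) matter. For
  \<open>e = 1\<close> the additional root is minus the sum of the others, which kills the
  coefficient of y^n and isolates the moment of order 2n + 2.\<close>

lemma moment_functional_monic:
  assumes q: "q \<noteq> 0" and n: "n > 0" and F: "laurent (bosF n) c"
    and e: "e \<le> 1" and J: "finite J" "card J = n"
  shows "(\<Sum>l=1..n + 1. c (int (n + l)) * (\<Sum>\<^sub>\<infinity>x. wt n l x * ((\<Prod>i\<in>J. zval n l x - a i) * ((\<Sum>i\<in>J. a i) + zval n l x) ^ e)))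
    = kappa n c e"
proof -
  define p where "p = (\<Prod>i\<in>J. [:- a i, 1:]) * [:(\<Sum>i\<in>J. a i), 1:] ^ e"
  have poly_p: "poly p y = (\<Prod>i\<in>J. y - a i) * ((\<Sum>i\<in>J. a i) + y) ^ e" for y
    by (simp add: p_def poly_prod poly_power)
  note lp = linear_prod_poly[OF J(1), of a, unfolded J(2)]
  have p_nz: "(\<Prod>i\<in>J. [:- a i, 1:]) \<noteq> 0" using lp(2) by auto
  define \<mu> where "\<mu> = moment c (of_nat n + 1 / 2)"
  have \<mu>0: "\<mu> i = 0" if "i < 2 * n" for i
    unfolding \<mu>_def by (rule bosF_moments(1)[OF q n F that])
  have "(\<Sum>i\<le>degree p. coeff p i * \<mu> (2 * i)) = \<mu> (2 * n + 2 * e)"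
  proof (cases "e = 0")
    case True
    then have p: "degree p = n" "coeff p n = 1" using lp by (simp_all add: p_def)
    have "(\<Sum>i\<le>degree p. coeff p i * \<mu> (2 * i)) = (\<Sum>i\<in>{n}. coeff p i * \<mu> (2 * i))"
      by (rule sum.mono_neutral_right) (auto simp: p \<mu>0)
    then show ?thesis using True p by simp
  next
    case False
    then have e1: "e = 1" using e by simp
    have pe: "p = (\<Prod>i\<in>J. [:- a i, 1:]) * [:(\<Sum>i\<in>J. a i), 1:]" by (simp add: p_def e1)
    have deg: "degree p = Suc n" unfolding pe using p_nz lp(1) by (subst degree_mult_eq) auto
    have c1: "coeff p (Suc n) = 1"
      using lp by (simp add: pe mult.commute[of "prod _ _"] coeff_eq_0)
    have c0: "coeff p n = 0"
      using lp n by (cases n) (simp_all add: pe mult.commute[of "prod _ _"])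
    have "(\<Sum>i\<le>degree p. coeff p i * \<mu> (2 * i)) = (\<Sum>i\<in>{n, Suc n}. coeff p i * \<mu> (2 * i))"
      by (rule sum.mono_neutral_right) (auto simp: deg \<mu>0)
    then show ?thesis using c0 c1 by (simp add: e1)
  qed
  then show ?thesis
    using moment_functional[OF q n F, of p] unfolding poly_p kappa_def \<mu>_def by simp
qed

text \<open>Cramer's rule for the linear system of \<open>moment_functional\<close> against a monic polynomial;
  the off-diagonal contributions cancel because the Vandermonde product is alternating.\<close>

lemma wsum_cramer:
  assumes q: "q \<noteq> 0" and n: "n > 0" and F: "laurent (bosF n) c"
    and e: "e \<le> 1" and j: "j \<in> {1..n + 1}"
  shows "c (int (n + j)) * wsum n e {1..n + 1} = (-1) ^ (j - 1) * kappa n c e * wsum n 0 ({1..n + 1} - {j})"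
proof -
  define J where "J = {1..n + 1} - {j}"
  have I: "{1..n + 1} = insert j J" "j \<notin> J" "finite J" and Jsub: "J \<subseteq> {1..n + 1}" and cardJ: "card J = n"
    using j by (auto simp: J_def)
  have cj: "{i \<in> insert j J. i < j} = {1..<j}" using j by (auto simp: J_def)
  define R where "R = PiE J (\<lambda>_. UNIV :: int set)"
  define T where "T l = (\<Sum>\<^sub>\<infinity>p\<in>UNIV \<times> R. split_term n e J l p)" for l
  have "wsum n e {1..n + 1} = (\<Sum>\<^sub>\<infinity>p\<in>UNIV \<times> R. wterm n e (insert j J) ((\<lambda>(x, r). r(j := x)) p))"
    unfolding wsum_def I(1) R_def
    by (subst infsum_reindex_bij_betw[OF PiE_insert_bij[OF I(2), of "\<lambda>_. UNIV"]]) simp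
  also have "\<dots> = (\<Sum>\<^sub>\<infinity>p\<in>UNIV \<times> R. (-1) ^ (j - 1) * split_term n e J j p)"
    by (intro infsum_cong) (use wterm_upd[OF I(3,2)] cj in auto)
  also have "\<dots> = (-1) ^ (j - 1) * T j"
    unfolding T_def by (rule infsum_cmult_right')
  finally have 1: "wsum n e {1..n + 1} = (-1) ^ (j - 1) * T j" .
  have inner: "((\<lambda>r. \<Sum>\<^sub>\<infinity>x. split_term n e J l (x, r)) has_sum T l) R" if "l \<in> {1..n + 1}" for l
  proof -
    have "split_term n e J l summable_on UNIV \<times> R"
      unfolding R_def by (rule abs_summable_summable[OF split_term_abs_summable[OF that Jsub]])
    then have "(split_term n e J l has_sum T l) (UNIV \<times> R)"
      unfolding T_def by (rule has_sum_infsum)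
    then have hs: "((\<lambda>(r, x). split_term n e J l (x, r)) has_sum T l) (R \<times> UNIV)"
      by (subst has_sum_swap) simp
    show ?thesis
    proof (rule has_sum_SigmaD[OF hs])
      fix r assume "r \<in> R"
      then show "((\<lambda>x. case (r, x) of (r, x) \<Rightarrow> split_term n e J l (x, r)) has_sum (\<Sum>\<^sub>\<infinity>x. split_term n e J l (x, r))) UNIV"
        using summable_on_SigmaD1[OF has_sum_imp_summable[OF hs], of r] by (simp add: has_sum_infsum)
    qed
  qed
  have "((\<lambda>r. \<Sum>l=1..n + 1. c (int (n + l)) * (\<Sum>\<^sub>\<infinity>x. split_term n e J l (x, r))) has_sum
      (\<Sum>l=1..n + 1. c (int (n + l)) * T l)) R"
    by (intro has_sum_sum has_sum_cmult_right inner)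
  also have "(\<lambda>r. \<Sum>l=1..n + 1. c (int (n + l)) * (\<Sum>\<^sub>\<infinity>x. split_term n e J l (x, r))) = (\<lambda>r. kappa n c e * wterm n 0 J r)"
  proof
    fix r
    define U where "U l x = wt n l x * ((\<Prod>i\<in>J. zval n l x - zval n i (r i)) * ((\<Sum>i\<in>J. zval n i (r i)) + zval n l x) ^ e)" for l x
    have "split_term n e J l (x, r) = wterm n 0 J r * U l x" for l x
      by (simp add: split_term_def wterm_def U_def mult_ac)
    then have "(\<Sum>l=1..n + 1. c (int (n + l)) * (\<Sum>\<^sub>\<infinity>x. split_term n e J l (x, r)))
        = wterm n 0 J r * (\<Sum>l=1..n + 1. c (int (n + l)) * (\<Sum>\<^sub>\<infinity>x. U l x))"
      by (simp add: infsum_cmult_right' sum_distrib_left mult.left_commute del: sum.cl_ivl_Suc)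
    also have "(\<Sum>l=1..n + 1. c (int (n + l)) * (\<Sum>\<^sub>\<infinity>x. U l x)) = kappa n c e"
      unfolding U_def by (rule moment_functional_monic[OF q n F e I(3) cardJ])
    finally show "(\<Sum>l=1..n + 1. c (int (n + l)) * (\<Sum>\<^sub>\<infinity>x. split_term n e J l (x, r))) = kappa n c e * wterm n 0 J r"
      by simp
  qed
  finally have "(\<Sum>l=1..n + 1. c (int (n + l)) * T l) = kappa n c e * wsum n 0 J"
    unfolding wsum_def R_def[symmetric] infsum_cmult_right'[symmetric] by (rule infsumI[symmetric])
  also have "(\<Sum>l=1..n + 1. c (int (n + l)) * T l) = (\<Sum>l\<in>{j}. c (int (n + l)) * T l)"
  proof (rule sum.mono_neutral_right)
    show "\<forall>l\<in>{1..n + 1} - {j}. c (int (n + l)) * T l = 0"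
      using split_term_infsum_zero[OF I(3)] by (auto simp: T_def R_def J_def)
  qed (use j in auto)
  finally have "c (int (n + j)) * T j = kappa n c e * wsum n 0 J" by simp
  then show ?thesis
    unfolding 1 J_def[symmetric] by simp
qed

end

section \<open>Macdonald's identity\<close>

text \<open>A majorant at every radius below 1 gives uniform convergence on discs, hence termwise
  differentiation. The derivative is multiplied by \<open>q\<close> so that each term is merely
  weighted by its exponent.\<close>

lemma qseries_has_derivative:
  fixes a :: "'a \<Rightarrow> complex" and e :: "'a \<Rightarrow> nat"
  assumes summ: "\<And>\<rho>. 0 < \<rho> \<Longrightarrow> \<rho> < 1 \<Longrightarrow> (\<lambda>x. norm (a x) * \<rho> ^ e x) summable_on X"
    and q: "norm q < 1"
  obtains D' where "((\<lambda>z. \<Sum>\<^sub>\<infinity>x\<in>X. a x * z ^ e x) has_field_derivative D') (at q)"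
    "((\<lambda>x. of_nat (e x) * (a x * q ^ e x)) has_sum q * D') X"
proof -
  define R where "R = (1 + norm q) / 2"
  have R: "0 < R" "R < 1" "norm q < R"
    using q norm_ge_zero[of q] by (auto simp: R_def simp del: norm_ge_zero)
  define f where "f Y w = (\<Sum>x\<in>Y. a x * w ^ e x)" for Y w
  define f' where "f' Y w = (\<Sum>x\<in>Y. a x * (of_nat (e x) * w ^ (e x - 1)))" for Y w
  have lim: "uniform_limit (cball 0 R) f (\<lambda>w. \<Sum>\<^sub>\<infinity>x\<in>X. a x * w ^ e x) (finite_subsets_at_top X)"
    unfolding f_def
    by (rule Weierstrass_m_test_general[OF _ summ[OF R(1,2)]])
       (auto simp: norm_mult norm_power intro!: mult_left_mono power_mono)
  obtain g' where g': "\<And>w. w \<in> ball 0 R \<Longrightarrow> ((\<lambda>w. \<Sum>\<^sub>\<infinity>x\<in>X. a x * w ^ e x) has_field_derivative g' w) (at w)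
      \<and> ((\<lambda>Y. f' Y w) \<longlongrightarrow> g' w) (finite_subsets_at_top X)"
  proof (rule has_complex_derivative_uniform_limit[OF _ lim])
    have "continuous_on (cball 0 R) (f Y)" for Y
      unfolding f_def by (intro continuous_intros)
    moreover have "(f Y has_field_derivative f' Y w) (at w)" for Y w
      unfolding f_def f'_def by (rule DERIV_sum) (auto intro!: derivative_eq_intros)
    ultimately show "\<forall>\<^sub>F Y in finite_subsets_at_top X. continuous_on (cball 0 R) (f Y) \<and>
        (\<forall>w\<in>ball 0 R. (f Y has_field_derivative f' Y w) (at w))"
      by (intro always_eventually) auto
  qed (use R in auto)
  have qR: "q \<in> ball 0 R" using R by simp
  have "((\<lambda>Y. q * f' Y q) \<longlongrightarrow> q * g' q) (finite_subsets_at_top X)"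
    using g'[OF qR] by (intro tendsto_intros) auto
  moreover have "q * f' Y q = (\<Sum>x\<in>Y. of_nat (e x) * (a x * q ^ e x))" for Y
    unfolding f'_def sum_distrib_left
  proof (rule sum.cong[OF refl])
    fix x
    show "q * (a x * (of_nat (e x) * q ^ (e x - 1))) = of_nat (e x) * (a x * q ^ e x)"
      by (cases "e x") (simp_all add: mult_ac)
  qed
  ultimately have "((\<lambda>x. of_nat (e x) * (a x * q ^ e x)) has_sum q * g' q) X"
    by (simp add: has_sum_def)
  with g'[OF qR] show ?thesis using that by blast
qed

text \<open>Here argument and base vary together, so the product is taken as a locally uniform limit
  of polynomials in \<open>z\<close>.\<close>

lemma qpoch_inf_holomorphic: "(\<lambda>z. qpoch_inf z z) holomorphic_on ball 0 1"
proof (rule holomorphic_uniform_sequence)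
  show "(\<lambda>z. \<Prod>i<n. 1 - z * z ^ i) holomorphic_on ball 0 1" for n
    by (intro holomorphic_intros)
  fix x :: complex assume x: "x \<in> ball 0 1"
  define d where "d = (1 - norm x) / 2"
  define R where "R = (1 + norm x) / 2"
  have d: "d > 0" "R < 1" "R \<ge> 0" using x by (auto simp: d_def R_def)
  have le: "norm z \<le> R" if "z \<in> cball x d" for z
  proof -
    have "norm z \<le> norm x + norm (z - x)" by (metis add.commute diff_add_cancel norm_triangle_ineq)
    also have "norm (z - x) \<le> d" using that by (simp add: dist_norm norm_minus_commute)
    finally show ?thesis by (simp add: d_def R_def field_simps)
  qed
  have "uniformly_convergent_on (cball x d) (\<lambda>n z. \<Prod>i<n. 1 - z * z ^ i)"
  proof (rule Infinite_Products.uniformly_convergent_on_prod')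
    show "uniformly_convergent_on (cball x d) (\<lambda>N z. \<Sum>n<N. norm (1 - z * z ^ n - 1))"
    proof (rule Weierstrass_m_test')
      fix n z assume "z \<in> cball x d"
      then have "norm z ^ Suc n \<le> R ^ Suc n" by (intro power_mono le) auto
      then show "norm (norm (1 - z * z ^ n - 1)) \<le> R ^ Suc n"
        by (simp add: norm_mult norm_power)
    qed (use d in \<open>simp add: summable_Suc_iff del: power_Suc\<close>)
  qed (auto intro!: continuous_intros)
  then have "uniform_limit (cball x d) (\<lambda>n z. \<Prod>i<n. 1 - z * z ^ i) (\<lambda>z. lim (\<lambda>n. \<Prod>i<n. 1 - z * z ^ i)) sequentially"
    by (simp add: uniformly_convergent_uniform_limit_iff)
  also have "?this \<longleftrightarrow> uniform_limit (cball x d) (\<lambda>n z. \<Prod>i<n. 1 - z * z ^ i) (\<lambda>z. qpoch_inf z z) sequentially"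
  proof (rule uniform_limit_cong')
    fix z assume "z \<in> cball x d"
    then interpret qdisc z using le d by unfold_locales force
    show "lim (\<lambda>n. \<Prod>i<n. 1 - z * z ^ i) = qpoch_inf z z"
      unfolding qpoch_lessThan[symmetric] by (rule limI) (rule qpoch_tendsto)
  qed simp
  moreover have "cball x d \<subseteq> ball 0 1" using le d by force
  ultimately show "\<exists>d>0. cball x d \<subseteq> ball 0 1 \<and>
      uniform_limit (cball x d) (\<lambda>n z. \<Prod>i<n. 1 - z * z ^ i) (\<lambda>z. qpoch_inf z z) sequentially"
    using d by blast
qed simp

text \<open>The part of \<open>wterm\<close> that is free of \<open>q\<close>. Together with
  \<open>wsum_exponent\<close>, whose conversion to natural numbers is exact by
  \<open>wexp_ge\<close>, it exhibits the Vandermonde sums as power series in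
  \<open>q\<close>.\<close>

definition wsum_coeff :: "nat \<Rightarrow> nat set \<Rightarrow> (nat \<Rightarrow> int) \<Rightarrow> complex" where
  "wsum_coeff n I r = vdm I (\<lambda>i. zval n i (r i)) * (\<Prod>i\<in>I. (-1) powi r i)"

definition wsum_exponent :: "nat \<Rightarrow> nat set \<Rightarrow> (nat \<Rightarrow> int) \<Rightarrow> nat" where
  "wsum_exponent n I r = (\<Sum>i\<in>I. nat (wexp n i (r i)))"

definition rho_vdm :: "nat \<Rightarrow> nat set \<Rightarrow> complex" where
  "rho_vdm n I = vdm I (\<lambda>i. zval n i 0)"

text \<open>Square and exponent are affinely related. Consequently multiplication of the terms by
  the sum of the squares acts, up to constants, as the derivation q d/dq.\<close>

lemma zval_wexp: "zval n l r = zval n l 0 + 2 * of_nat (2 * n + 3) * of_int (wexp n l r)"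
proof -
  have "(2 :: complex) * of_int (wexp n l r) = of_int (2 * wexp n l r)" by simp
  also have "\<dots> = of_int r * (2 * of_nat l - 1 + of_nat (2 * n + 3) * of_int r)"
    unfolding two_wexp by simp
  finally have e: "(2 :: complex) * of_int (wexp n l r) = of_int r * (2 * of_nat l - 1 + of_nat (2 * n + 3) * of_int r)" .
  have "zval n l r = zval n l 0 + of_nat (2 * n + 3) * (2 * of_int (wexp n l r))"
    unfolding e zval_def by (simp add: power2_eq_square algebra_simps)
  then show ?thesis by (simp add: mult_ac)
qed

lemma sum_rho_squares:
  "(\<Sum>l=1..m. (of_nat l - 1 / 2 :: complex)\<^sup>2) = of_nat m * (4 * (of_nat m)\<^sup>2 - 1) / 12"
proof (induction m)
  case (Suc m)
  have S: "(\<Sum>l=1..Suc m. (of_nat l - 1 / 2 :: complex)\<^sup>2) = (\<Sum>l=1..m. (of_nat l - 1 / 2 :: complex)\<^sup>2) + (of_nat (Suc m) - 1 / 2)\<^sup>2"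
    by simp
  show ?case unfolding S Suc.IH by (simp add: power2_eq_square field_simps)
qed simp

context qdisc
begin

lemma wterm_0_eq:
  assumes "I \<subseteq> {1..n + 1}"
  shows "wterm n 0 I r = wsum_coeff n I r * q ^ wsum_exponent n I r"
proof -
  have "wt n i (r i) = (-1) powi r i * q ^ nat (wexp n i (r i))" if "i \<in> I" for i
    using wexp_ge[of i n "r i"] that assms by (auto simp: wt_def power_int_nonneg_exp)
  then have "(\<Prod>i\<in>I. wt n i (r i)) = (\<Prod>i\<in>I. (-1) powi r i) * q ^ wsum_exponent n I r"
    by (simp add: prod.distrib power_sum wsum_exponent_def)
  then show ?thesis by (simp add: wterm_def wsum_coeff_def)
qed

lemma wterm_1_eq:
  assumes "I \<subseteq> {1..n + 1}"
  shows "of_nat (wsum_exponent n I r) * wterm n 0 I r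
    = (wterm n 1 I r - (\<Sum>i\<in>I. zval n i 0) * wterm n 0 I r) / (2 * of_nat (2 * n + 3))"
proof -
  have K: "(2 * of_nat (2 * n + 3) :: complex) \<noteq> 0" by (metis add_eq_0_iff_both_eq_0 mult_eq_0_iff of_nat_eq_0_iff zero_neq_numeral)
  have "of_nat (nat (wexp n i (r i))) = (of_int (wexp n i (r i)) :: complex)" if "i \<in> I" for i
    using wexp_ge[of i n "r i"] that assms by (intro of_nat_nat) auto
  then have "(of_nat (wsum_exponent n I r) :: complex) = (\<Sum>i\<in>I. of_int (wexp n i (r i)))"
    by (simp add: wsum_exponent_def)
  moreover have "(\<Sum>i\<in>I. zval n i (r i)) = (\<Sum>i\<in>I. zval n i 0) + 2 * of_nat (2 * n + 3) * (\<Sum>i\<in>I. of_int (wexp n i (r i)))"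
    unfolding sum_distrib_left sum.distrib[symmetric] by (intro sum.cong refl zval_wexp)
  ultimately have "of_nat (wsum_exponent n I r) = ((\<Sum>i\<in>I. zval n i (r i)) - (\<Sum>i\<in>I. zval n i 0)) / (2 * of_nat (2 * n + 3))"
    using K by simp
  moreover have "wterm n 1 I r = (\<Sum>i\<in>I. zval n i (r i)) * wterm n 0 I r"
    by (simp add: wterm_def)
  ultimately show ?thesis by (simp only: left_diff_distrib times_divide_eq_left)
qed

end

lemma wsum_coeff_summable:
  assumes "I \<subseteq> {1..n + 1}" "0 < \<rho>" "\<rho> < 1"
  shows "(\<lambda>r. norm (wsum_coeff n I r) * \<rho> ^ wsum_exponent n I r) summable_on PiE I (\<lambda>_. UNIV)"
proof -
  interpret qdisc "of_real \<rho>" by unfold_locales (use assms in simp)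
  show ?thesis
    using wterm_abs_summable[OF assms(1), of 0] assms(2)
    by (simp add: wterm_0_eq[OF assms(1)] norm_mult norm_power)
qed

definition wseries :: "nat \<Rightarrow> nat set \<Rightarrow> complex \<Rightarrow> complex" where
  "wseries n I z = (\<Sum>\<^sub>\<infinity>r\<in>PiE I (\<lambda>_. UNIV). wsum_coeff n I r * z ^ wsum_exponent n I r)"

lemma (in qdisc) wsum_0_eq: "I \<subseteq> {1..n + 1} \<Longrightarrow> wsum n 0 I = wseries n I q"
  by (simp add: wsum_def wseries_def wterm_0_eq)

lemma wseries_continuous:
  assumes "I \<subseteq> {1..n + 1}" "norm q < 1"
  shows "isCont (wseries n I) q"
proof -
  obtain D' where "((\<lambda>z. \<Sum>\<^sub>\<infinity>r\<in>PiE I (\<lambda>_. UNIV). wsum_coeff n I r * z ^ wsum_exponent n I r) has_field_derivative D') (at q)"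
    using qseries_has_derivative[OF wsum_coeff_summable[OF assms(1)] assms(2)] by blast
  then show ?thesis
    unfolding wseries_def[abs_def] by (rule DERIV_isCont)
qed

lemma wseries_at_0:
  assumes "I \<subseteq> {1..n + 1}"
  shows "wseries n I 0 = rho_vdm n I"
proof -
  define r0 where "r0 = restrict (\<lambda>_. 0 :: int) I"
  have fin: "finite I" using assms by (rule finite_subset) auto
  have "wseries n I 0 = (\<Sum>\<^sub>\<infinity>r\<in>{r0}. wsum_coeff n I r * 0 ^ wsum_exponent n I r)"
    unfolding wseries_def
  proof (rule infsum_cong_neutral)
    fix r assume r: "r \<in> PiE I (\<lambda>_. UNIV) - {r0}"
    then obtain i where i: "i \<in> I" "r i \<noteq> 0"
      by (auto simp: r0_def PiE_def extensional_def fun_eq_iff restrict_def split: if_splits)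
    have "nat (wexp n i (r i)) > 0" using wexp_ge[of i n "r i"] i assms by auto
    then have "wsum_exponent n I r > 0"
      unfolding wsum_exponent_def using fin i(1) by (intro sum_pos2[of _ i]) auto
    then show "wsum_coeff n I r * 0 ^ wsum_exponent n I r = 0" by simp
  qed (auto simp: r0_def)
  also have "\<dots> = wsum_coeff n I r0 * 0 ^ wsum_exponent n I r0" by simp
  also have "wsum_exponent n I r0 = 0"
    by (simp add: wsum_exponent_def r0_def wexp_def)
  also have "wsum_coeff n I r0 = rho_vdm n I"
  proof -
    have "vdm I (\<lambda>i. zval n i (r0 i)) = vdm I (\<lambda>i. zval n i 0)"
      by (rule vdm_cong) (simp add: r0_def)
    moreover have "(\<Prod>i\<in>I. (-1 :: complex) powi r0 i) = 1"
      by (rule prod.neutral) (simp add: r0_def)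
    ultimately show ?thesis by (simp add: wsum_coeff_def rho_vdm_def)
  qed
  finally show ?thesis by simp
qed

section \<open>The differential equation of the full Vandermonde sum\<close>

context qdisc
begin

text \<open>Cramer's rule for \<open>e = 0\<close> and \<open>e = 1\<close> has the same reduced sum
  on the right, so the two full sums are proportional to the moments of orders 2n and 2n + 2. Some
  unknown can be divided out: if all vanished, so would the moment of order 2n.\<close>

lemma wsum_1_0_ratio:
  assumes q: "q \<noteq> 0" and n: "n > 0"
  shows "wsum n 1 {1..n + 1} * theta_moment 1
    = of_nat ((2 * n + 2) * (2 * n + 1) * (2 * n + 3)) * (theta_moment 3 / 6) * wsum n 0 {1..n + 1}"
proof -
  obtain c where F: "laurent (bosF n) c" using laurent_bosF[OF q] by blast
  define \<tau>1 where "\<tau>1 = theta_moment 1"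
  define \<tau>3 where "\<tau>3 = theta_moment 3 / 6"
  have \<tau>1: "\<tau>1 \<noteq> 0" unfolding \<tau>1_def theta_moment_1[OF q] by simp
  have k0: "kappa n c 0 = fact (2 * n) * \<tau>1 ^ (2 * n - 1) * \<tau>1"
    using bosF_moments(2)[OF q n F] n by (simp add: kappa_def \<tau>1_def power_eq_if)
  have k1: "kappa n c 1 = fact (2 * n) * \<tau>1 ^ (2 * n - 1) * (of_nat ((2 * n + 2) * (2 * n + 1) * (2 * n + 3)) * \<tau>3)"
  proof -
    have f: "fact (2 * n + 2) = (of_nat ((2 * n + 2) * (2 * n + 1)) * fact (2 * n) :: complex)"
      by (simp add: algebra_simps)
    have "kappa n c 1 = fact (2 * n + 2) * of_nat (2 * n + 3) * \<tau>3 * \<tau>1 ^ (2 * n - 1)"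
    proof -
      have e: "2 * n + 2 * 1 = 2 * n + 2" by simp
      show ?thesis unfolding kappa_def e bosF_moments(3)[OF q n F] \<tau>1_def \<tau>3_def by simp
    qed
    then show ?thesis unfolding f by (simp only: of_nat_mult mult_ac)
  qed
  have "\<exists>j\<in>{1..n + 1}. c (int (n + j)) \<noteq> 0"
  proof (rule ccontr)
    assume "\<not> ?thesis"
    then have "kappa n c 0 = 0"
      using moment_functional_monic[OF q n F, of 0 "{..<n}" "\<lambda>_. 0"] by simp
    then show False using k0 \<tau>1 by simp
  qed
  then obtain j where j: "j \<in> {1..n + 1}" "c (int (n + j)) \<noteq> 0" by blast
  define S where "S = (-1) ^ (j - 1) * wsum n 0 ({1..n + 1} - {j})"
  have "c (int (n + j)) * wsum n 0 {1..n + 1} = kappa n c 0 * S" "c (int (n + j)) * wsum n 1 {1..n + 1} = kappa n c 1 * S"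
    using wsum_cramer[OF q n F _ j(1), of 0] wsum_cramer[OF q n F _ j(1), of 1] by (simp_all add: S_def mult_ac)
  then have "c (int (n + j)) * (wsum n 1 {1..n + 1} * kappa n c 0) = c (int (n + j)) * (kappa n c 1 * wsum n 0 {1..n + 1})"
    by (metis mult.assoc mult.commute)
  then have "wsum n 1 {1..n + 1} * kappa n c 0 = kappa n c 1 * wsum n 0 {1..n + 1}"
    using j(2) by simp
  then have "(fact (2 * n) * \<tau>1 ^ (2 * n - 1)) * (wsum n 1 {1..n + 1} * \<tau>1)
      = (fact (2 * n) * \<tau>1 ^ (2 * n - 1)) * (of_nat ((2 * n + 2) * (2 * n + 1) * (2 * n + 3)) * \<tau>3 * wsum n 0 {1..n + 1})"
    unfolding k0 k1 by (simp only: mult_ac)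
  then show ?thesis
    using \<tau>1 unfolding \<tau>1_def[symmetric] \<tau>3_def[symmetric] by simp
qed

end

text \<open>The first theta moment as an explicit series in its base, which has to vary for
  differentiation.\<close>

definition theta_series :: "complex \<Rightarrow> complex" where
  "theta_series z = (\<Sum>\<^sub>\<infinity>k. ((-1) powi k * (of_int k - 1 / 2)) * z ^ nat (tri k))"

lemma (in qdisc) theta_coeff_eq: "theta_coeff k = (-1) powi k * q ^ nat (tri k)"
  by (simp add: theta_coeff_def power_int_nonneg_exp tri_nonneg)

lemma (in qdisc) theta_moment_1_series: "theta_moment 1 = theta_series q"
  by (simp add: theta_moment_def moment_def theta_series_def theta_coeff_eq mult_ac)

text \<open>Since \<open>tri k\<close> is ((k - 1/2)^2 - 1/4) / 2, the derivation z d/dz maps the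
  first moment to a combination of the third and the first.\<close>

lemma theta_series_derivative:
  assumes "norm q < 1" "q \<noteq> 0"
  obtains T' where "(theta_series has_field_derivative T') (at q)"
    "q * T' = qdisc.theta_moment q 3 / 2 - theta_series q / 8"
proof -
  interpret qdisc q by unfold_locales fact
  define a where "a k = ((-1) powi k * (of_int k - 1 / 2) :: complex)" for k :: int
  have summ: "(\<lambda>k. norm (a k) * \<rho> ^ nat (tri k)) summable_on UNIV" if "0 < \<rho>" "\<rho> < 1" for \<rho>
  proof -
    interpret r: qdisc "of_real \<rho>" by unfold_locales (use that in simp)
    have "(\<lambda>k. r.theta_coeff k * (of_int k - 1 / 2) ^ 1) summable_on UNIV"
      by (rule laurent_moment_summable[OF r.laurent_theta']) (use that in simp)
    then have "(\<lambda>k. norm (r.theta_coeff k * (of_int k - 1 / 2) ^ 1)) summable_on UNIV"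
      by (rule summable_on_iff_abs_summable_on_complex[THEN iffD1])
    then show ?thesis
      using that by (simp add: r.theta_coeff_eq a_def norm_mult norm_power mult_ac)
  qed
  obtain T' where T': "(theta_series has_field_derivative T') (at q)"
    "((\<lambda>k. of_nat (nat (tri k)) * (a k * q ^ nat (tri k))) has_sum q * T') UNIV"
    using qseries_has_derivative[OF summ assms(1)] unfolding a_def theta_series_def[abs_def] by blast
  have s: "(\<lambda>k. theta_coeff k * (of_int k - 1 / 2) ^ i) summable_on UNIV" for i
    by (rule laurent_moment_summable[OF laurent_theta'[OF assms(2)]])
  have hs: "((\<lambda>k. 1 / 2 * (theta_coeff k * (of_int k - 1 / 2) ^ 3) + (- 1 / 8) * (theta_coeff k * (of_int k - 1 / 2) ^ 1))
      has_sum 1 / 2 * theta_moment 3 + (- 1 / 8) * theta_moment 1) UNIV"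
    unfolding theta_moment_def moment_def by (intro has_sum_add has_sum_cmult_right has_sum_infsum s)
  have cube: "1 / 2 * (X * y ^ 3) + (- 1 / 8) * (X * y ^ 1) = (y\<^sup>2 - 1 / 4) / 2 * (s * y * Q)" if "X = s * Q" for X y s Q :: complex
    by (simp add: that power2_eq_square power3_eq_cube field_simps)
  have "(\<lambda>k. 1 / 2 * (theta_coeff k * (of_int k - 1 / 2) ^ 3) + (- 1 / 8) * (theta_coeff k * (of_int k - 1 / 2) ^ 1))
      = (\<lambda>k. of_nat (nat (tri k)) * (a k * q ^ nat (tri k)))"
  proof
    fix k :: int
    have "(of_nat (nat (tri k)) :: complex) = of_int (tri k)"
      by (simp add: tri_nonneg of_nat_nat)
    also have "\<dots> = of_int (2 * tri k) / 2" by simp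
    also have "\<dots> = ((of_int k - 1 / 2)\<^sup>2 - 1 / 4) / 2"
      unfolding two_tri by (simp add: power2_eq_square field_simps)
    finally have e: "(of_nat (nat (tri k)) :: complex) = ((of_int k - 1 / 2)\<^sup>2 - 1 / 4) / 2" .
    show "1 / 2 * (theta_coeff k * (of_int k - 1 / 2) ^ 3) + (- 1 / 8) * (theta_coeff k * (of_int k - 1 / 2) ^ 1)
        = of_nat (nat (tri k)) * (a k * q ^ nat (tri k))"
      unfolding e a_def by (rule cube[OF theta_coeff_eq])
  qed
  then have "q * T' = 1 / 2 * theta_moment 3 + (- 1 / 8) * theta_moment 1"
    using T'(2) hs has_sum_unique by simp
  then have "q * T' = theta_moment 3 / 2 - theta_series q / 8"
    unfolding theta_moment_1_series by simp
  with T'(1) show ?thesis using that by blast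
qed

text \<open>Macdonald's identity of type \<open>A\<^bsub>2m\<^esub>\<^bsup>(2)\<^esup>\<close>, \<open>m = n + 1\<close>: both sides satisfy the same first order
  linear differential equation in \<open>q\<close> and agree at \<open>q = 0\<close>.\<close>

lemma macdonald:
  assumes n: "n > 0" and q: "norm q < 1"
  shows "wseries n {1..n + 1} q = rho_vdm n {1..n + 1} * qpoch_inf q q ^ ((n + 1) * (2 * n + 1))"
proof -
  define I where "I = {1..n + 1}"
  define M where "M = (n + 1) * (2 * n + 1)"
  define D where "D = wseries n I"
  define P where "P = (\<lambda>z. qpoch_inf z z)"
  define h where "h z = D z / P z ^ M" for z
  have I: "I \<subseteq> {1..n + 1}" by (simp add: I_def)
  have P_nz: "P z \<noteq> 0" if "norm z < 1" for z
    unfolding P_def by (rule qdisc.qpoch_inf_q_nonzero) (use that in \<open>simp add: qdisc_def\<close>)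
  have P_deriv: "(P has_field_derivative deriv P z) (at z)" if "norm z < 1" for z
    unfolding P_def using that by (intro holomorphic_derivI[OF qpoch_inf_holomorphic]) auto
  have cont: "continuous_on (ball 0 1) h"
  proof (rule continuous_at_imp_continuous_on, rule ballI)
    fix z :: complex assume "z \<in> ball 0 1"
    then have z: "norm z < 1" by simp
    have "isCont P z" using P_deriv[OF z] by (rule DERIV_isCont)
    then show "isCont h z"
      unfolding h_def D_def using wseries_continuous[OF I z] P_nz[OF z] by (intro continuous_intros) auto
  qed
  have zero: "(h has_field_derivative 0) (at z)" if "z \<in> ball 0 1 - {0}" for z
  proof -
    have z: "norm z < 1" "z \<noteq> 0" using that by auto
    interpret qdisc z by unfold_locales (use z in simp)
    obtain D' where D': "((\<lambda>z. \<Sum>\<^sub>\<infinity>r\<in>PiE I (\<lambda>_. UNIV). wsum_coeff n I r * z ^ wsum_exponent n I r) has_field_derivative D') (at z)"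
        "((\<lambda>r. of_nat (wsum_exponent n I r) * (wsum_coeff n I r * z ^ wsum_exponent n I r)) has_sum z * D') (PiE I (\<lambda>_. UNIV))"
      using qseries_has_derivative[OF wsum_coeff_summable[OF I] z(1)] by blast
    have D_deriv: "(D has_field_derivative D') (at z)"
      using D'(1) by (simp add: D_def wseries_def[abs_def])
    obtain T' where T': "(theta_series has_field_derivative T') (at z)"
        "z * T' = theta_moment 3 / 2 - theta_series z / 8"
      using theta_series_derivative[OF z] by blast
    define K :: complex where "K = of_nat (2 * n + 3)"
    define m :: complex where "m = of_nat (n + 1)"
    define N where "N = (\<Sum>i\<in>I. zval n i 0)"
    have K: "K = 2 * m + 1" "K \<noteq> 0"
      unfolding K_def m_def by (simp, metis add_eq_0_iff_both_eq_0 of_nat_eq_0_iff zero_neq_numeral)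
    \<comment> \<open>The factor \<open>K\<close> in the sum of the squares of rho is what lets the
      two terms of \<open>z * D'\<close> merge below into a multiple of
      \<open>z * T'\<close>.\<close>
    have N: "N = m * (2 * m - 1) * K / 12"
    proof -
      have "N = (\<Sum>l=1..n + 1. (of_nat l - 1 / 2 :: complex)\<^sup>2)" by (simp add: N_def I_def zval_def)
      also have "\<dots> = m * (4 * m\<^sup>2 - 1) / 12" unfolding m_def by (rule sum_rho_squares)
      also have "4 * m\<^sup>2 - 1 = (2 * m - 1) * K" by (simp add: K(1) power2_eq_square algebra_simps)
      finally show ?thesis by (simp add: mult_ac)
    qed
    have sum1: "wterm n e I summable_on PiE I (\<lambda>_. UNIV)" for e
      by (rule abs_summable_summable[OF wterm_abs_summable[OF I]])
    have "((\<lambda>r. (wterm n 1 I r - N * wterm n 0 I r) / (2 * K)) has_sum (wsum n 1 I - N * wsum n 0 I) / (2 * K)) (PiE I (\<lambda>_. UNIV))"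
    proof -
      have "((\<lambda>r. wterm n 1 I r + (- N) * wterm n 0 I r) has_sum wsum n 1 I + (- N) * wsum n 0 I) (PiE I (\<lambda>_. UNIV))"
        unfolding wsum_def by (intro has_sum_add has_sum_cmult_right has_sum_infsum sum1)
      from has_sum_divide_const[OF this, of "2 * K"] show ?thesis by simp
    qed
    moreover have "(wterm n 1 I r - N * wterm n 0 I r) / (2 * K) = of_nat (wsum_exponent n I r) * (wsum_coeff n I r * z ^ wsum_exponent n I r)" for r
      using wterm_1_eq[OF I, of r] by (simp add: wterm_0_eq[OF I] N_def K_def)
    ultimately have zD': "z * D' = (wsum n 1 I - N * wsum n 0 I) / (2 * K)"
      using D'(2) has_sum_unique by (simp only:) blast
    define \<tau> where "\<tau> = theta_series z"
    define \<sigma> where "\<sigma> = theta_moment 3"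
    have W0: "wsum n 0 I = D z" by (simp add: wsum_0_eq[OF I] D_def)
    have "wsum n 1 I * \<tau> = of_nat ((2 * n + 2) * (2 * n + 1) * (2 * n + 3)) * (\<sigma> / 6) * D z"
      using wsum_1_0_ratio[OF z(2) n] unfolding I_def[symmetric] W0 theta_moment_1_series \<tau>_def \<sigma>_def .
    also have "(of_nat ((2 * n + 2) * (2 * n + 1) * (2 * n + 3)) :: complex) = 2 * m * (2 * m - 1) * K"
      by (simp add: m_def K_def algebra_simps)
    finally have W1: "wsum n 1 I * \<tau> = 2 * m * (2 * m - 1) * K * (\<sigma> / 6) * D z" .
    have "z * D' * \<tau> = (wsum n 1 I * \<tau> - N * D z * \<tau>) / (2 * K)"
      unfolding zD' W0 by (simp add: field_simps)
    \<comment> \<open>The bracket is precisely \<open>z * T'\<close>. The logarithmic derivative of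
      \<open>D\<close> is thus m(2m-1)/3 times that of the theta series, which is minus the cube of
      \<open>P\<close>; this gives the exponent m(2m-1) of \<open>P\<close>.\<close>
    also have "\<dots> = m * (2 * m - 1) / 3 * (\<sigma> / 2 - \<tau> / 8) * D z"
      unfolding W1 N using K(2) by (simp add: field_simps)
    also have "\<dots> = m * (2 * m - 1) / 3 * (z * T') * D z"
      using T'(2) by (simp add: \<tau>_def \<sigma>_def)
    finally have "z * (D' * \<tau>) = z * (m * (2 * m - 1) / 3 * T' * D z)" by (simp add: mult_ac)
    then have eq1: "D' * \<tau> = m * (2 * m - 1) / 3 * T' * D z"
      by (rule mult_left_cancel[OF z(2), THEN iffD1])
    have "\<tau> = - (P z ^ 3)"
      using theta_moment_1[OF z(2)] unfolding theta_moment_1_series \<tau>_def P_def .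
    moreover have "T' = - (3 * P z ^ 2 * deriv P z)"
    proof (rule DERIV_unique[OF T'(1)])
      have "((\<lambda>w. - (P w ^ 3)) has_field_derivative - (3 * P z ^ 2 * deriv P z)) (at z)"
        by (auto intro!: derivative_eq_intros P_deriv[OF z(1)])
      moreover have "eventually (\<lambda>w. w \<in> ball 0 1 - {0}) (nhds z)"
        using that by (intro eventually_nhds_in_open) auto
      then have "eventually (\<lambda>w. - (P w ^ 3) = theta_series w) (nhds z)"
      proof eventually_elim
        case (elim w)
        interpret w: qdisc w by unfold_locales (use elim in simp)
        show ?case using w.theta_moment_1 elim unfolding w.theta_moment_1_series P_def by simp
      qed
      ultimately show "(theta_series has_field_derivative - (3 * P z ^ 2 * deriv P z)) (at z)"
        by (simp add: DERIV_cong_ev)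
    qed
    ultimately have eq2: "D' * - (P z ^ 3) = m * (2 * m - 1) / 3 * - (3 * P z ^ 2 * deriv P z) * D z"
      using eq1 by (simp only:)
    have "(P z)\<^sup>2 * (D' * P z) = - (D' * - (P z ^ 3))"
      by (simp add: power2_eq_square power3_eq_cube)
    also have "\<dots> = (P z)\<^sup>2 * (m * (2 * m - 1) * deriv P z * D z)"
      unfolding eq2 by simp
    finally have eq3: "(P z)\<^sup>2 * (D' * P z) = (P z)\<^sup>2 * (m * (2 * m - 1) * deriv P z * D z)" .
    have ode: "D' * P z = of_nat M * deriv P z * D z"
    proof -
      have "(P z)\<^sup>2 \<noteq> 0" using P_nz[OF z(1)] by simp
      then have "D' * P z = m * (2 * m - 1) * deriv P z * D z"
        using eq3 mult_left_cancel by blast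
      also have "m * (2 * m - 1) = of_nat M" by (simp add: M_def m_def algebra_simps)
      finally show ?thesis .
    qed
    obtain M' where M': "M = Suc M'" by (cases M) (auto simp: M_def)
    have pd: "((\<lambda>z. P z ^ M) has_field_derivative (of_nat M * P z ^ M' * deriv P z)) (at z)"
      using DERIV_power[OF P_deriv[OF z(1)], of M] by (simp add: M' mult_ac)
    have "(h has_field_derivative (D' * P z ^ M - D z * (of_nat M * P z ^ M' * deriv P z)) / (P z ^ M * P z ^ M)) (at z)"
      unfolding h_def
      by (rule DERIV_divide[OF D_deriv pd]) (use P_nz[OF z(1)] in simp)
    also have "D' * P z ^ M - D z * (of_nat M * P z ^ M' * deriv P z) = P z ^ M' * (D' * P z - of_nat M * deriv P z * D z)"
      by (simp add: M' algebra_simps)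
    also have "\<dots> = 0" by (simp add: ode)
    finally show ?thesis by simp
  qed
  \<comment> \<open>The derivative is known to vanish only off 0, where the theta expansions are
    available. Continuity of \<open>h\<close> at 0 allows the constant to be evaluated
    there.\<close>
  obtain c where c: "\<And>z. z \<in> ball 0 1 \<Longrightarrow> h z = c"
    using DERIV_zero_connected_constant[of "ball 0 1" "{0}" h] cont zero by auto
  have "P 0 = 1"
  proof -
    interpret z: qdisc 0 by unfold_locales simp
    have "qpoch 0 0 = (\<lambda>_. 1 :: complex)" by (rule ext) (simp add: qpoch_def)
    then show ?thesis using z.qpoch_tendsto[of 0] by (simp add: P_def LIMSEQ_const_iff)
  qed
  then have "h 0 = rho_vdm n I" by (simp add: h_def D_def wseries_at_0[OF I])
  then have "h q = rho_vdm n I" using c[of 0] c[of q] q by simp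
  then have "D q = rho_vdm n I * P q ^ M"
    using P_nz[OF q] by (simp add: h_def field_simps)
  then show ?thesis unfolding D_def I_def P_def M_def .
qed

section \<open>The bosonic sums\<close>

lemma rho_vdm_nonzero: "rho_vdm n I \<noteq> 0" if "finite I" "0 \<notin> I"
proof -
  have "zval n i 0 - zval n j 0 \<noteq> 0" if "i \<in> I" "j \<in> I" "i < j" for i j
  proof -
    have "zval n i 0 - zval n j 0 = of_nat (i + j - 1) * (of_int (int i - int j))"
      using that by (simp add: zval_def power2_eq_square algebra_simps of_nat_diff)
    moreover have "i > 0" using that(1) \<open>0 \<notin> I\<close> by (cases i) auto
    then have "i + j - 1 > 0" "int i - int j \<noteq> 0" using that by auto
    ultimately show ?thesis by (metis of_int_eq_0_iff of_nat_eq_0_iff mult_eq_0_iff less_numeral_extra(3))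
  qed
  moreover have "finite {(i, j). i \<in> I \<and> j \<in> I \<and> i < j}"
    by (rule finite_subset[of _ "I \<times> I"]) (use that in auto)
  ultimately show ?thesis unfolding rho_vdm_def vdm_def by auto
qed

text \<open>The factors (n + 1/2)^2 - (i - 1/2)^2 = (n + 1 - i)(n + i) multiply to (2n)!, which
  later cancels the factorial in the moment of order 2n.\<close>

lemma rho_vdm_Suc: "rho_vdm n {1..n + 1} = (-1) ^ n * fact (2 * n) * rho_vdm n {1..n}"
proof -
  have J: "{i \<in> {1..n + 1}. i < n + 1} = {1..n}" "{1..n + 1} - {n + 1} = {1..n}" by auto
  have "zval n (n + 1) 0 - zval n i 0 = of_nat (n + 1 - i) * of_nat (n + i)" if "i \<in> {1..n}" for i
    using that by (simp add: zval_def power2_eq_square algebra_simps of_nat_diff)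
  then have "(\<Prod>i\<in>{1..n}. zval n (n + 1) 0 - zval n i 0)
      = of_nat ((\<Prod>i=1..n. n + 1 - i) * (\<Prod>i=1..n. n + i))"
    by (simp add: prod.distrib)
  also have "(\<Prod>i=1..n. n + 1 - i) = (\<Prod>i=1..n. i)"
    by (rule prod.reindex_bij_witness[of _ "\<lambda>i. n + 1 - i" "\<lambda>i. n + 1 - i"]) auto
  also have "(\<Prod>i=1..n. n + i) = (\<Prod>i=n+1..n+n. i)"
    by (rule prod.reindex_bij_witness[of _ "\<lambda>i. i - n" "\<lambda>i. n + i"]) auto
  also have "(\<Prod>i=1..n. i) * (\<Prod>i=n+1..n+n. i) = (\<Prod>i=1..n+n. i)"
    using prod.ub_add_nat[of 1 n "\<lambda>i. i" n] by simp
  also have "\<dots> = fact (2 * n)" by (simp add: fact_prod mult_2)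
  finally show ?thesis
    using vdm_split[of "{1..n + 1}" "n + 1" "\<lambda>i. zval n i 0"] unfolding rho_vdm_def J by simp
qed

context qdisc
begin

text \<open>Cramer's rule at j = n + 1 yields c(2n+1) = c(0) and keeps the classes 1, ..., n, that
  is rho; at j = 1 it yields c(n+1) and keeps 2, ..., n + 1, that is rho + 1. The sign of
  \<open>rho_vdm_Suc\<close> cancels the cofactor sign in the first case and survives as (-1)^n in
  the second.\<close>

lemma bosF_coeff_eq:
  assumes q: "q \<noteq> 0" and n: "n > 0" and F: "laurent (bosF n) c"
  defines "D \<equiv> qpoch_inf q q ^ (2 * n - 1) / qpoch_inf q q ^ (2 * n\<^sup>2 - n) / rho_vdm n {1..n}"
  shows "c 0 = wseries n {1..n} q * D" "(-1) ^ n * c (int n + 1) = wseries n {2..n + 1} q * D"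
proof -
  define P where "P = qpoch_inf q q"
  define M where "M = (n + 1) * (2 * n + 1)"
  define R where "R = rho_vdm n {1..n}"
  have P: "P \<noteq> 0" and R: "R \<noteq> 0" by (simp_all add: P_def R_def rho_vdm_nonzero)
  have tm: "theta_moment 1 ^ (2 * n) = P ^ (6 * n)"
    unfolding theta_moment_1[OF q] P_def[symmetric] by (simp add: power_mult[symmetric] flip: power_mult)
  have k: "kappa n c 0 = fact (2 * n) * P ^ (6 * n)"
    using bosF_moments(2)[OF q n F] unfolding tm by (simp add: kappa_def)
  have w: "wsum n 0 {1..n + 1} = (-1) ^ n * fact (2 * n) * R * P ^ M"
    using macdonald[OF n norm_q] unfolding wsum_0_eq[OF order_refl] rho_vdm_Suc P_def M_def R_def .
  \<comment> \<open>The balance of powers of (q)_inf: \<open>M\<close> from Macdonald's identity and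
    2n - 1 from the fermionic side, against 6n = 3 * 2n from the moment of order 2n.\<close>
  have e: "M + (2 * n - 1) = 6 * n + (2 * n\<^sup>2 - n)"
    using n le_square[of n] by (simp add: M_def power2_eq_square algebra_simps)
  have D: "D * (R * P ^ M) = P ^ (6 * n)"
  proof -
    have "P ^ M * P ^ (2 * n - 1) = P ^ (6 * n) * P ^ (2 * n\<^sup>2 - n)"
      unfolding e[symmetric] power_add[symmetric] ..
    then have "P ^ (2 * n - 1) / P ^ (2 * n\<^sup>2 - n) / R * (R * P ^ M) = P ^ (6 * n)"
      using P R by (simp add: field_simps)
    then show ?thesis unfolding D_def P_def R_def .
  qed
  have f: "fact (2 * n) \<noteq> (0 :: complex)" "R * P ^ M \<noteq> 0" using P R by auto
  have s: "c (int (n + (n + 1))) = c 0"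
    using bosF_coeff_symmetric[OF n F, of 0] by (simp add: algebra_simps)
  have J: "{1..n + 1} - {n + 1} = {1..n}" "{1..n + 1} - {1} = {2..n + 1}" by auto
  have "c 0 * ((-1) ^ n * fact (2 * n) * R * P ^ M) = (-1) ^ n * (fact (2 * n) * P ^ (6 * n)) * wseries n {1..n} q"
    using wsum_cramer[OF q n F, of 0 "n + 1"] unfolding s w k J by (simp add: wsum_0_eq)
  then have "fact (2 * n) * (-1) ^ n * (c 0 * (R * P ^ M)) = fact (2 * n) * (-1) ^ n * (wseries n {1..n} q * P ^ (6 * n))"
    by (simp only: mult_ac)
  then have "c 0 * (R * P ^ M) = wseries n {1..n} q * P ^ (6 * n)" using f(1) by simp
  then have "c 0 * (R * P ^ M) = wseries n {1..n} q * D * (R * P ^ M)" by (simp only: D mult.assoc)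
  then show "c 0 = wseries n {1..n} q * D" using f(2) mult_right_cancel by blast
  have "{2..n + 1} \<subseteq> {1..n + 1}" by auto
  then have "c (int n + 1) * ((-1) ^ n * fact (2 * n) * R * P ^ M) = fact (2 * n) * P ^ (6 * n) * wseries n {2..n + 1} q"
    using wsum_cramer[OF q n F, of 0 1] unfolding w k J by (simp add: wsum_0_eq add.commute)
  then have "fact (2 * n) * (((-1) ^ n * c (int n + 1)) * (R * P ^ M)) = fact (2 * n) * (wseries n {2..n + 1} q * P ^ (6 * n))"
    by (simp only: mult_ac)
  then have "((-1) ^ n * c (int n + 1)) * (R * P ^ M) = wseries n {2..n + 1} q * P ^ (6 * n)" using f(1) by simp
  then have "((-1) ^ n * c (int n + 1)) * (R * P ^ M) = wseries n {2..n + 1} q * D * (R * P ^ M)" by (simp only: D mult.assoc)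
  then show "(-1) ^ n * c (int n + 1) = wseries n {2..n + 1} q * D" using f(2) mult_right_cancel by blast
qed

end

text \<open>Coordinate \<open>i\<close> carries the class label l = i + s, for which rho i + s = l -
  1/2. So s = 0 and s = 1 use the two index sets of \<open>bosF_coeff_eq\<close>.\<close>

definition bos_vector :: "nat \<Rightarrow> nat \<Rightarrow> (nat \<Rightarrow> int) \<Rightarrow> nat \<Rightarrow> real" where
  "bos_vector n s r = (\<lambda>i\<in>{1..n}. rho i + real s + of_int (r (i + s)) * (2 * real n + 3))"

lemma bos_vector_bij:
  "bij_betw (bos_vector n s) (PiE {1 + s..n + s} (\<lambda>_. UNIV)) (cong_vectors n (shift rho (real s)))"
proof (rule bij_betwI')
  fix r r' assume r: "r \<in> PiE {1 + s..n + s} (\<lambda>_. UNIV :: int set)" "r' \<in> PiE {1 + s..n + s} (\<lambda>_. UNIV :: int set)"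
  show "(bos_vector n s r = bos_vector n s r') = (r = r')"
  proof
    assume e: "bos_vector n s r = bos_vector n s r'"
    show "r = r'"
    proof (rule PiE_ext[OF r])
      fix j assume j: "j \<in> {1 + s..n + s}"
      define i where "i = j - s"
      have i: "j = i + s" "i \<in> {1..n}" using j by (auto simp: i_def)
      have "bos_vector n s r i = bos_vector n s r' i" using e by simp
      then have "of_int (r j) * (2 * real n + 3) = of_int (r' j) * (2 * real n + 3)"
        using i by (simp add: bos_vector_def)
      moreover have "2 * real n + 3 > 0" by simp
      ultimately show "r j = r' j" by (metis mult_right_cancel of_int_eq_iff less_irrefl)
    qed
  qed simp
next
  fix r assume r: "r \<in> PiE {1 + s..n + s} (\<lambda>_. UNIV :: int set)"
  have "2 * (rho i + real s + of_int k * (2 * real n + 3)) = of_int (2 * int i - 1 + 2 * int s + 2 * k * (2 * int n + 3))" for i k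
    by (simp add: rho_def algebra_simps)
  then have "rho i + real s + of_int k * (2 * real n + 3) \<in> half_integers" for i k
    unfolding half_integers_def by (metis (no_types, lifting) Ints_of_int mem_Collect_eq)
  moreover have "[rho i + real s + of_int k * (2 * real n + 3) = rho i + real s] (rmod (2 * real n + 3))" for i k
    by (rule rcong_sym) (auto simp: rcong_altdef)
  ultimately show "bos_vector n s r \<in> cong_vectors n (shift rho (real s))"
    by (auto simp: cong_vectors_def bos_vector_def shift_def)
next
  fix v assume v: "v \<in> cong_vectors n (shift rho (real s))"
  have "\<forall>i\<in>{1..n}. \<exists>k::int. v i = rho i + real s + of_int k * (2 * real n + 3)"
    using v rcong_imp_int_multiple by (auto simp: cong_vectors_def shift_def)
  then obtain k :: "nat \<Rightarrow> int" where k: "\<forall>i\<in>{1..n}. v i = rho i + real s + of_int (k i) * (2 * real n + 3)"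
    by (rule bchoice[THEN exE])
  have ve: "v \<in> extensional {1..n}" using v by (auto simp: cong_vectors_def PiE_def)
  have "v = bos_vector n s (\<lambda>j\<in>{1 + s..n + s}. k (j - s))"
  proof
    fix i show "v i = bos_vector n s (\<lambda>j\<in>{1 + s..n + s}. k (j - s)) i"
      using k ve by (cases "i \<in> {1..n}") (auto simp: bos_vector_def extensional_def)
  qed
  then show "\<exists>r\<in>PiE {1 + s..n + s} (\<lambda>_. UNIV). v = bos_vector n s r" by (auto intro!: bexI)
qed

text \<open>The denominators of \<open>xi\<close> are those of rho for both values of
  \<open>s\<close>, hence the normalisation over {1..n} even when the classes are shifted.\<close>

lemma xi_bos_vector:
  "of_real (xi n (bos_vector n s r) rho) = vdm {1 + s..n + s} (\<lambda>i. zval n i (r i)) / rho_vdm n {1..n}"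
proof -
  have "of_real (xi n (bos_vector n s r) rho) = (\<Prod>(i, j)\<in>{(i, j). 1 \<le> i \<and> i < j \<and> j \<le> n}.
      (zval n (i + s) (r (i + s)) - zval n (j + s) (r (j + s))) / (zval n i 0 - zval n j 0))"
    unfolding xi_def of_real_prod
    by (intro prod.cong) (auto simp: bos_vector_def rho_def zval_def algebra_simps)
  also have "\<dots> = (\<Prod>(i, j)\<in>{(i, j). 1 \<le> i \<and> i < j \<and> j \<le> n}. zval n (i + s) (r (i + s)) - zval n (j + s) (r (j + s)))
      / (\<Prod>(i, j)\<in>{(i, j). 1 \<le> i \<and> i < j \<and> j \<le> n}. zval n i 0 - zval n j 0)"
    by (simp add: case_prod_unfold prod_dividef)
  also have "(\<Prod>(i, j)\<in>{(i, j). 1 \<le> i \<and> i < j \<and> j \<le> n}. zval n (i + s) (r (i + s)) - zval n (j + s) (r (j + s)))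
      = vdm {1 + s..n + s} (\<lambda>i. zval n i (r i))"
    unfolding vdm_def
    by (rule prod.reindex_bij_witness[of _ "\<lambda>(i, j). (i - s, j - s)" "\<lambda>(i, j). (i + s, j + s)"]) auto
  also have "(\<Prod>(i, j)\<in>{(i, j). 1 \<le> i \<and> i < j \<and> j \<le> n}. zval n i 0 - zval n j 0) = rho_vdm n {1..n}"
    unfolding rho_vdm_def vdm_def by (intro prod.cong) auto
  finally show ?thesis .
qed

lemma sum_shift_index: "(\<Sum>i=1..n. f (i + s)) = (\<Sum>i\<in>{1 + s..n + s}. f i)" for f :: "nat \<Rightarrow> 'a :: comm_monoid_add"
  by (rule sum.reindex_bij_witness[of _ "\<lambda>i. i - s" "\<lambda>i. i + s"]) auto

lemma rhs_term_bos_vector: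
  fixes n s :: nat
  assumes s: "s \<le> 1"
  defines "J \<equiv> {1 + s..n + s}"
  shows "rhs_term q n (shift rho (real s)) (bos_vector n s r)
    = wsum_coeff n J r * q ^ wsum_exponent n J r / rho_vdm n {1..n}"
proof -
  define w where "w = shift rho (real s)"
  have J: "J \<subseteq> {1..n + 1}" using s by (auto simp: J_def)
  have "vsum n (bos_vector n s r) - vsum n w = (\<Sum>i=1..n. of_int (r (i + s)) * (2 * real n + 3))"
    unfolding vsum_def sum_subtractf[symmetric] by (rule sum.cong) (auto simp: bos_vector_def w_def shift_def)
  also have "\<dots> = of_int ((\<Sum>i\<in>J. r i) * (2 * int n + 3))"
    unfolding J_def sum_shift_index[symmetric] by (simp add: sum_distrib_right)
  finally have f1: "\<lfloor>vsum n (bos_vector n s r) - vsum n w\<rfloor> = (\<Sum>i\<in>J. r i) * (2 * int n + 3)"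
    by (simp only: floor_of_int)
  have "odd (2 * int n + 3)" by simp
  then have "((-1) powi ((\<Sum>i\<in>J. r i) * (2 * int n + 3)) :: complex) = (-1) powi (\<Sum>i\<in>J. r i)"
    by (simp add: power_int_minus_left)
  also have "\<dots> = (\<Prod>i\<in>J. (-1) powi r i)" by (rule power_int_sum[symmetric]) simp
  finally have s1: "((-1) powi ((\<Sum>i\<in>J. r i) * (2 * int n + 3)) :: complex) = (\<Prod>i\<in>J. (-1) powi r i)" .
  have "((bos_vector n s r i)\<^sup>2 - (w i)\<^sup>2) = of_int (wexp n (i + s) (r (i + s))) * (2 * (2 * real n + 3))" if "i \<in> {1..n}" for i
  proof -
    have "(2 :: real) * of_int (wexp n (i + s) (r (i + s))) = of_int (2 * wexp n (i + s) (r (i + s)))" by simp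
    also have "\<dots> = of_int (r (i + s)) * (2 * (real i + real s) - 1 + (2 * real n + 3) * of_int (r (i + s)))"
      unfolding two_wexp by simp
    finally have "2 * of_int (wexp n (i + s) (r (i + s))) * (2 * real n + 3)
       = of_int (r (i + s)) * (2 * (real i + real s) - 1 + (2 * real n + 3) * of_int (r (i + s))) * (2 * real n + 3)"
      by (rule arg_cong)
    then show ?thesis using that
      by (simp add: bos_vector_def w_def shift_def rho_def power2_eq_square algebra_simps)
  qed
  then have "normsq n (bos_vector n s r) - normsq n w = (\<Sum>i=1..n. of_int (wexp n (i + s) (r (i + s))) * (2 * (2 * real n + 3)))"
    unfolding normsq_def sum_subtractf[symmetric] by (intro sum.cong) auto
  also have "\<dots> = of_int (\<Sum>i\<in>J. wexp n i (r i)) * (2 * (2 * real n + 3))"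
    unfolding J_def sum_shift_index[symmetric] by (simp add: sum_distrib_right)
  also have "(\<Sum>i\<in>J. wexp n i (r i)) = int (wsum_exponent n J r)"
  proof -
    have "wexp n i (r i) = int (nat (wexp n i (r i)))" if "i \<in> J" for i
      using wexp_ge[of i n "r i"] that J by auto
    then show ?thesis by (simp add: wsum_exponent_def)
  qed
  finally have "normsq n (bos_vector n s r) - normsq n w = of_int (int (wsum_exponent n J r)) * (2 * (2 * real n + 3))" .
  moreover have "2 * (2 * real n + 3) \<noteq> 0" by (smt (verit) of_nat_0_le_iff)
  ultimately have "(normsq n (bos_vector n s r) - normsq n w) / (2 * (2 * real n + 3)) = of_int (int (wsum_exponent n J r))"
    by (rule nonzero_divide_eq_eq[THEN iffD2, rotated])
  then have f2: "\<lfloor>(normsq n (bos_vector n s r) - normsq n w) / (2 * (2 * real n + 3))\<rfloor> = int (wsum_exponent n J r)"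
    by (simp only: floor_of_int)
  show ?thesis
    unfolding rhs_term_def w_def[symmetric] f1 f2 s1 xi_bos_vector wsum_coeff_def
    unfolding J_def by simp
qed

lemma rhs_term_has_sum:
  assumes s: "s \<le> 1" and q: "norm q < 1"
  shows "(rhs_term q n (shift rho (real s)) has_sum wseries n {1 + s..n + s} q / rho_vdm n {1..n})
    (cong_vectors n (shift rho (real s)))"
proof -
  interpret qdisc q by unfold_locales fact
  have J: "{1 + s..n + s} \<subseteq> {1..n + 1}" using s by auto
  have "(\<lambda>r. norm (wterm n 0 {1 + s..n + s} r)) summable_on PiE {1 + s..n + s} (\<lambda>_. UNIV)"
    by (rule wterm_abs_summable[OF J])
  then have "(\<lambda>r. wsum_coeff n {1 + s..n + s} r * q ^ wsum_exponent n {1 + s..n + s} r) summable_on PiE {1 + s..n + s} (\<lambda>_. UNIV)"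
    unfolding wterm_0_eq[OF J] by (rule abs_summable_summable)
  then have "((\<lambda>r. wsum_coeff n {1 + s..n + s} r * q ^ wsum_exponent n {1 + s..n + s} r) has_sum wseries n {1 + s..n + s} q)
      (PiE {1 + s..n + s} (\<lambda>_. UNIV))"
    unfolding wseries_def by (rule has_sum_infsum)
  then have "((\<lambda>r. wsum_coeff n {1 + s..n + s} r * q ^ wsum_exponent n {1 + s..n + s} r * inverse (rho_vdm n {1..n}))
      has_sum wseries n {1 + s..n + s} q * inverse (rho_vdm n {1..n})) (PiE {1 + s..n + s} (\<lambda>_. UNIV))"
    by (rule has_sum_cmult_left)
  then have "((\<lambda>r. rhs_term q n (shift rho (real s)) (bos_vector n s r)) has_sum wseries n {1 + s..n + s} q / rho_vdm n {1..n})
      (PiE {1 + s..n + s} (\<lambda>_. UNIV))"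
    unfolding rhs_term_bos_vector[OF s] by (simp add: divide_inverse)
  then show ?thesis
    using has_sum_reindex_bij_betw[OF bos_vector_bij] by blast
qed


section \<open>Continuity of both sides at q = 0\<close>

lemma norm_inverse_qfact_le:
  assumes "norm z \<le> 1 / 2"
  shows "norm (1 / qpoch z z m) \<le> norm (1 / qpoch (1 / 2) (1 / 2) m)"
proof -
  interpret half: qdisc "1 / 2" by unfold_locales simp
  have "norm (qpoch (1 / 2) (1 / 2) m) = (\<Prod>i=1..m. 1 - (1 / 2) * (1 / 2) ^ (i - 1))"
  proof -
    have "qpoch (1 / 2) (1 / 2) m = of_real (\<Prod>i=1..m. 1 - (1 / 2) * (1 / 2) ^ (i - 1))"
      by (simp add: qpoch_def)
    moreover have "(\<Prod>i=1..m. 1 - (1 / 2) * (1 / 2) ^ (i - 1)) \<ge> (0 :: real)"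
      by (intro prod_nonneg ballI) (simp add: power_le_one flip: power_Suc)
    ultimately show ?thesis by (simp only: norm_of_real abs_of_nonneg)
  qed
  also have "\<dots> \<le> norm (qpoch z z m)"
    unfolding qpoch_def prod_norm[symmetric]
  proof (rule prod_mono, intro conjI)
    fix i
    show "0 \<le> 1 - 1 / 2 * (1 / 2 :: real) ^ (i - 1)" by (simp add: power_le_one flip: power_Suc)
    have "norm (z * z ^ (i - 1)) \<le> 1 / 2 * (1 / 2) ^ (i - 1)"
      unfolding norm_mult norm_power by (intro mult_mono power_mono assms) auto
    then show "1 - 1 / 2 * (1 / 2 :: real) ^ (i - 1) \<le> norm (1 - z * z ^ (i - 1))"
      using norm_triangle_ineq2[of 1 "z * z ^ (i - 1)"] by simp
  qed
  finally show ?thesis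
    using half.qfact_nonzero[of m] by (simp add: norm_divide frac_le)
qed

text \<open>On the disc of radius 1/2 every term is dominated by its value at 1/2. Summability at
  this single nonzero point gives uniform convergence, and in particular summability at 0.\<close>

lemma fermionic_sum_continuous:
  fixes E :: "(nat \<Rightarrow> nat) \<Rightarrow> int" and r :: nat
  defines "f \<equiv> \<lambda>m z. z powi E m / (\<Prod>i=1..r. qpoch z z (m i))"
  assumes E: "\<And>m. E m \<ge> 0" and summ: "(\<lambda>m. f m (1 / 2)) summable_on A"
  shows "continuous_on (cball 0 (1 / 2)) (\<lambda>z. \<Sum>\<^sub>\<infinity>m\<in>A. f m z)"
    and "norm z \<le> 1 / 2 \<Longrightarrow> (\<lambda>m. f m z) summable_on A"
proof -
  have f: "f m z = z ^ nat (E m) * (\<Prod>i=1..r. 1 / qpoch z z (m i))" for m z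
    using E[of m] by (simp add: f_def power_int_nonneg_exp prod_dividef)
  have le: "norm (f m z) \<le> norm (f m (1 / 2))" if "norm z \<le> 1 / 2" for m z
  proof -
    have "norm (z ^ nat (E m)) \<le> norm ((1 / 2 :: complex) ^ nat (E m))"
      using power_mono[OF that, of "nat (E m)"] by (simp add: norm_power norm_divide)
    moreover have "(\<Prod>i=1..r. norm (1 / qpoch z z (m i))) \<le> (\<Prod>i=1..r. norm (1 / qpoch (1 / 2) (1 / 2) (m i)))"
      using norm_inverse_qfact_le[OF that] by (intro prod_mono) auto
    ultimately show ?thesis unfolding f norm_mult prod_norm[symmetric]
      by (intro mult_mono) (auto intro!: prod_nonneg)
  qed
  have half: "(\<lambda>m. norm (f m (1 / 2))) summable_on A"
    using summ by (simp add: summable_on_iff_abs_summable_on_complex)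
  show "continuous_on (cball 0 (1 / 2)) (\<lambda>z. \<Sum>\<^sub>\<infinity>m\<in>A. f m z)"
  proof (rule uniform_limit_theorem)
    show "uniform_limit (cball 0 (1 / 2)) (\<lambda>X z. \<Sum>m\<in>X. f m z) (\<lambda>z. \<Sum>\<^sub>\<infinity>m\<in>A. f m z) (finite_subsets_at_top A)"
      by (rule Weierstrass_m_test_general[OF _ half]) (simp add: le)
    have "continuous_on (cball 0 (1 / 2)) (f m)" for m
    proof -
      have "qpoch z z k \<noteq> 0" if "norm z \<le> 1 / 2" for z k
      proof -
        interpret qdisc z by unfold_locales (use that in simp)
        show ?thesis by simp
      qed
      moreover have "continuous_on (cball 0 (1 / 2)) (\<lambda>z. qpoch z z k)" for k
        unfolding qpoch_def by (intro continuous_intros)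
      ultimately show ?thesis unfolding f by (intro continuous_intros) auto
    qed
    then show "\<forall>\<^sub>F X in finite_subsets_at_top A. continuous_on (cball 0 (1 / 2)) (\<lambda>z. \<Sum>m\<in>X. f m z)"
      by (intro always_eventually allI continuous_on_sum) auto
  qed simp
  show "(\<lambda>m. f m z) summable_on A" if "norm z \<le> 1 / 2"
    by (rule abs_summable_summable, rule summable_on_comparison_test[OF half]) (use le[OF that] in auto)
qed

lemma fermionic_sum:
  assumes n: "n > 0" and q: "norm q < 1" and s: "s \<le> 1"
  shows "((\<lambda>m. q powi (cartan_form (2 * n - 1) m div 2 + int s * alt_sum (2 * n - 1) m)
       / (\<Prod>i=1..2 * n - 1. qpoch q q (m i))) has_sum
     1 / qpoch_inf q q ^ (2 * n\<^sup>2 - n) * (wseries n {1 + s..n + s} q / rho_vdm n {1..n})) (nat_vectors (2 * n - 1))"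
proof -
  define r where "r = 2 * n - 1"
  define E where "E m = cartan_form r m div 2 + int s * alt_sum r m" for m
  define f where "f m z = z powi E m / (\<Prod>i=1..r. qpoch z z (m i))" for m z
  define R where "R z = 1 / qpoch_inf z z ^ (2 * n\<^sup>2 - n) * (wseries n {1 + s..n + s} z / rho_vdm n {1..n})" for z
  have nz: "((\<lambda>m. f m z) has_sum R z) (nat_vectors r)" if z: "norm z < 1" "z \<noteq> 0" for z
  proof -
    interpret qdisc z by unfold_locales fact
    obtain c where F: "laurent (bosF n) c" using laurent_bosF[OF z(2)] by blast
    have P: "qpoch_inf z z ^ r \<noteq> 0" by simp
    show ?thesis
    proof (cases "s = 0")
      case True
      have "c 0 / qpoch_inf z z ^ r = R z"
        unfolding bosF_coeff_eq(1)[OF z(2) n F] R_def True r_def[symmetric] using P by simp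
      then show ?thesis
        using fermionic_sum_1[OF z(2) n F] unfolding f_def E_def True r_def[symmetric] by simp
    next
      case False
      then have s1: "s = 1" using s by simp
      have J: "{1 + 1..n + 1} = {2..n + 1}" by simp
      have "(-1) ^ n * c (int n + 1) / qpoch_inf z z ^ r = R z"
        unfolding bosF_coeff_eq(2)[OF z(2) n F] R_def s1 J r_def[symmetric] using P by simp
      then show ?thesis
        using fermionic_sum_2[OF z(2) n F] unfolding f_def E_def s1 r_def[symmetric] by simp
    qed
  qed
  \<comment> \<open>A step a contributes \<open>tri a\<close> or
    \<open>tri a + a = tri (- a)\<close>, both nonnegative. A negative exponent would spoil
    continuity of the terms at 0.\<close>
  have E: "E m \<ge> 0" for m
  proof -
    have "E m = (\<Sum>i\<le>r. tri (step r m i) + (if odd i then int s * step r m i else 0))"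
      unfolding E_def sum_tri_step[symmetric] sum_step_odd[symmetric] sum.distrib sum_distrib_left
      by (simp add: if_distrib cong: if_cong)
    moreover have "tri a + int s * a \<ge> 0" for a
    proof -
      have "s = 0 \<or> s = 1" using s by auto
      then show ?thesis using tri_nonneg[of a] tri_nonneg[of "- a"] tri_minus[of a] by auto
    qed
    ultimately show ?thesis using tri_nonneg by (auto intro!: sum_nonneg)
  qed
  have "(\<lambda>m. f m (1 / 2)) summable_on nat_vectors r"
    using nz[of "1 / 2"] by (auto simp: summable_on_def)
  note lhs = fermionic_sum_continuous[OF E this[unfolded f_def], folded f_def]
  have "continuous_on (cball 0 (1 / 2)) R"
  proof -
    have "continuous_on (cball 0 (1 / 2)) (\<lambda>z. qpoch_inf z z)"
      by (rule continuous_on_subset[OF holomorphic_on_imp_continuous_on[OF qpoch_inf_holomorphic]]) auto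
    moreover have "qpoch_inf z z \<noteq> 0" if "norm z \<le> 1 / 2" for z
    proof -
      interpret qdisc z by unfold_locales (use that in simp)
      show ?thesis by simp
    qed
    moreover have "continuous_on (cball 0 (1 / 2)) (wseries n {1 + s..n + s})"
      by (intro continuous_at_imp_continuous_on ballI wseries_continuous) (use s in auto)
    ultimately show ?thesis
      unfolding R_def by (intro continuous_intros) (auto simp: rho_vdm_nonzero)
  qed
  moreover have "g \<midarrow>0\<rightarrow> g 0" if "continuous_on (cball 0 (1 / 2)) g" for g :: "complex \<Rightarrow> complex"
    using continuous_on_interior[OF that, of 0] by (simp add: isCont_def)
  ultimately have lim: "R \<midarrow>0\<rightarrow> R 0" "(\<lambda>z. \<Sum>\<^sub>\<infinity>m\<in>nat_vectors r. f m z) \<midarrow>0\<rightarrow> (\<Sum>\<^sub>\<infinity>m\<in>nat_vectors r. f m 0)"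
    using lhs(1) by blast+
  have "eventually (\<lambda>z. z \<in> ball 0 1) (at (0 :: complex))"
    by (intro eventually_at_in_open') auto
  moreover have "eventually (\<lambda>z. z \<noteq> 0) (at (0 :: complex))"
    by (rule eventually_neq_at_within)
  ultimately have "eventually (\<lambda>z. (\<Sum>\<^sub>\<infinity>m\<in>nat_vectors r. f m z) = R z) (at 0)"
    by eventually_elim (auto intro!: infsumI nz)
  then have "R \<midarrow>0\<rightarrow> (\<Sum>\<^sub>\<infinity>m\<in>nat_vectors r. f m 0)"
    using lim(2) by (rule Lim_transform_eventually[rotated])
  then have "(\<Sum>\<^sub>\<infinity>m\<in>nat_vectors r. f m 0) = R 0"
    using lim(1) by (rule LIM_unique)
  then have "((\<lambda>m. f m 0) has_sum R 0) (nat_vectors r)"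
    using has_sum_infsum[OF lhs(2)[of 0]] by simp
  then have "((\<lambda>m. f m q) has_sum R q) (nat_vectors r)"
    using nz[of q] q by (cases "q = 0") auto
  then show ?thesis unfolding f_def R_def E_def r_def .
qed

theorem theorem1p2:
  fixes n N :: nat and q :: complex
  assumes "n > 0" and "N = 2 * n" and "norm q < 1"
  shows
    "(\<lambda>m. q powi (cartan_form (N - 1) m div 2) / (\<Prod>i=1..N - 1. qpoch q q (m i))) summable_on nat_vectors (N - 1)
     \<and> rhs_term q n rho summable_on cong_vectors n rho
     \<and> (\<Sum>\<^sub>\<infinity>m\<in>nat_vectors (N - 1). q powi (cartan_form (N - 1) m div 2) / (\<Prod>i=1..N - 1. qpoch q q (m i)))
       = 1 / qpoch_inf q q ^ (2 * n\<^sup>2 - n)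
         * (\<Sum>\<^sub>\<infinity>v\<in>cong_vectors n rho. rhs_term q n rho v)
     \<and> (\<lambda>m. q powi (cartan_form (N - 1) m div 2 + alt_sum (N - 1) m)
              / (\<Prod>i=1..N - 1. qpoch q q (m i))) summable_on nat_vectors (N - 1)
     \<and> rhs_term q n (shift rho 1) summable_on cong_vectors n (shift rho 1)
     \<and> (\<Sum>\<^sub>\<infinity>m\<in>nat_vectors (N - 1). q powi (cartan_form (N - 1) m div 2 + alt_sum (N - 1) m)
              / (\<Prod>i=1..N - 1. qpoch q q (m i)))
       = 1 / qpoch_inf q q ^ (2 * n\<^sup>2 - n)
         * (\<Sum>\<^sub>\<infinity>v\<in>cong_vectors n (shift rho 1). rhs_term q n (shift rho 1) v)"
proof -
  have sh: "shift rho (real 0) = rho" by (rule ext) (simp add: shift_def)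
  note R = rhs_term_has_sum[OF _ assms(3), of _ n]
  note L = fermionic_sum[OF assms(1,3)]
  note R0 = R[of 0, unfolded sh, OF le0] and R1 = R[of 1, unfolded of_nat_1, OF order_refl]
  note L0 = L[of 0, unfolded of_nat_0 mult_zero_left add_0_right, OF le0]
    and L1 = L[of 1, unfolded of_nat_1 mult_1_left, OF order_refl]
  show ?thesis
    unfolding assms(2) infsumI[OF R0] infsumI[OF R1] infsumI[OF L0] infsumI[OF L1]
    using R0 R1 L0 L1 by (auto simp: summable_on_def)
qed

end
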